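(* Let $d\ge1$ be an integer and $0<s<d$. There is a constant $C$, depending only on $d$ and $s$, such that for every measure function $h$ with $h(r)/r^d$ nonincreasing there is a compact set $E\subset\mathbb R^d$ such that $M_h(E)>0$ and $$\gamma_{s,+}(E)\le C\,M_h(E)\left[\int_0^{t_2}\Big(\frac{h(t)}{t^s}\Big)^2\frac{dt}t\right]^{-1/2},$$ where $t_2$ is defined by $h(t_2)=M_h(E)$ (if the integral diverges, the right-hand side is understood as $0$).
   Context: A measure (gauge) function is a continuous strictly increasing function $h:[0,+\infty)\to[0,+\infty)$ with $h(0)=0$ and $\lim_{r\to+\infty}h(r)=+\infty$. The Hausdorff content of $G\subset\mathbb R^d$ is $M_h(G)=\inf\sum_jh(r_j)$, the infimum being over all at most countable coverings of $G$ by balls of radii $r_j$. For a finite nonnegative Borel measure $\nu$, $R_\nu^s(x)=\lim_{\varepsilon\to0+}\int_{|y-x|>\varepsilon}\frac{y-x}{|y-x|^{s+1}}\,d\nu(y)$ (for $0<s<d$ the limit exists Lebesgue-a.e.). For compact $E\subset\mathbb R^d$, $\gamma_{s,+}(E)=\sup\{\|\nu\|:\nu\in M_+(E),\ \|R_\nu^s\|_{L^\infty(\mathbb R^d)}\le1\}$, where $M_+(E)$ is the class of positive Radon measures supported on $E$, $\|\nu\|$ is the total mass, and $L^\infty$ is with respect to Lebesgue measure. *)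

theory Defs
  imports "HOL-Probability.Probability"
begin

text \<open>Measure functions live on the half-line \<open>[0, \<infinity>)\<close>; values at negative arguments are irrelevant.\<close>

definition measure_function :: "(real \<Rightarrow> real) \<Rightarrow> bool" where
  "measure_function h \<longleftrightarrow>
     (\<forall>r\<ge>0. 0 \<le> h r) \<and> continuous_on {0..} h \<and> strict_mono_on {0..} h \<and>
     h 0 = 0 \<and> filterlim h at_top at_top"

text \<open>The index set \<open>J\<close> is an arbitrary set of naturals, so finite and countably infinite coverings
  are both allowed. Whether the balls are open or closed does not affect the value for a measure
  function, which is continuous and strictly increasing.\<close>

definition hausdorff_content :: "(real \<Rightarrow> real) \<Rightarrow> 'a::euclidean_space set \<Rightarrow> ennreal" where
  "hausdorff_content h G =
     Inf {(\<Sum>\<^sub>\<infinity>j\<in>J. ennreal (h (r j))) | (J :: nat set) c r.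
            (\<forall>j\<in>J. 0 < r j) \<and> G \<subseteq> (\<Union>j\<in>J. ball (c j) (r j))}"

text \<open>On a Euclidean space every locally finite Borel measure is regular, hence Radon; for closed
  \<open>E\<close> the support lies in \<open>E\<close> iff the complement of \<open>E\<close> is a null set.\<close>

definition radon_measures_on :: "'a::euclidean_space set \<Rightarrow> 'a measure set" where
  "radon_measures_on E =
     {\<nu>. sets \<nu> = sets borel \<and> (\<forall>K. compact K \<longrightarrow> emeasure \<nu> K < \<infinity>) \<and> emeasure \<nu> (- E) = 0}"

text \<open>Where the principal value does not exist (a Lebesgue null set for finite \<open>\<nu>\<close> and
  \<open>0 < s < d\<close>), \<^const>\<open>Lim\<close> returns an unspecified vector.\<close>

definition riesz_transform :: "real \<Rightarrow> 'a::euclidean_space measure \<Rightarrow> 'a \<Rightarrow> 'a" where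
  "riesz_transform s \<nu> x =
     Lim (at_right 0) (\<lambda>\<epsilon>. LINT y:{y. norm (y - x) > \<epsilon>}|\<nu>. (1 / norm (y - x) powr (s + 1)) *\<^sub>R (y - x))"

definition gamma_plus :: "real \<Rightarrow> 'a::euclidean_space set \<Rightarrow> ennreal" where
  "gamma_plus s E =
     Sup {emeasure \<nu> (space \<nu>) | \<nu>. \<nu> \<in> radon_measures_on E \<and>
            esssup lebesgue (\<lambda>x. ereal (norm (riesz_transform s \<nu> x))) \<le> 1}"

definition energy_integral :: "real \<Rightarrow> (real \<Rightarrow> real) \<Rightarrow> real \<Rightarrow> ennreal" where
  "energy_integral s h T = (\<integral>\<^sup>+t\<in>{0<..T}. ennreal ((h t / t powr s)\<^sup>2 / t) \<partial>lborel)"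

end

theory Submission
  imports Defs
begin

text \<open>
  Let d be the dimension and define lam j by h(lam j) = h(1) / 2^(d j); the energy integral over (0,1]
  is controlled by the sum of the numbers (h(lam j) / (lam j)^s)^2. Only a sparse set of scales is used
  for E: after lam i comes the first lam j with j >= i + J and h(lam j) / h(lam i) >= (lam j / lam i)^b,
  where s < b < min d (s + 1). The skipped scales contribute a geometric series, and the children of
  a cube can be separated by large multiples of their size. E is the resulting Cantor set, of
  finitely many stages if no further scale exists.

  For an arbitrary measure nu on the N-th stage, replaced by point masses, split the Riesz transform
  into pieces G k, where G k collects the pairs of points whose smallest common cube has generation k.
  As the kernel is odd, G k has nu-mean zero on every cube of generation k, while it varies little on
  much smaller cubes, so the G k are almost orthogonal in L2(nu). On a cube Q of size l, the squared
  norm of G k is at least of order nu(Q)^3 / l^(2s), unless one child of Q carries half of the mass,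
  and then the same quantity is at least twice as large for that child. Summing up bounds the sum of
  nu(Q)^3 / l(Q)^(2s) by a multiple of the mass of nu, and the power mean inequality
  gives the claim.
\<close>

subsection \<open>Trees of point masses\<close>

text \<open>No growth or doubling condition is available for nu, so neither the cross terms between
  different \<open>G k\<close> nor the error of passing to point masses can be bounded by the mass
  alone. Both are bounded by the energy that is to be estimated, times a small number
  \<open>\<omega>\<close>, and then absorbed. Absorption needs a finite energy, whence the work on
  finite stages with constants that do not depend on \<open>N\<close>. The number
  \<open>\<omega>\<close> bounds row sums of the kernel over the siblings of a cube. The kernel is
  dominated there by a power p of (size of a child / distance), with p < d and p <= s + 1; the row
  sums decay with the length of the step because b < p, while the skipped scales decay because s <
  b. These requirements fix b, p, \<open>\<omega>\<close> and the minimal step J in terms of d and s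
  only; h enters only through the positions of the scales. As the set may be chosen freely, E has
  unit size: its content lies between a fixed multiple of h(1) and h(1), so the t of the theorem is
  at most 1 and the energy over (0, 1] dominates.\<close>

definition riesz_kernel :: "real \<Rightarrow> 'a::euclidean_space \<Rightarrow> 'a" where
  "riesz_kernel s v = (1 / norm v powr (s + 1)) *\<^sub>R v"

text \<open>The 1 comes from moving the vector in the numerator of the kernel. The rest is
  \<open>p * 2 powr (p + 1) * (3/2)\<close> with p = s + 1: the derivative of the power at half the
  norm, times the size 3/2 of the perturbed vector.\<close>

definition lip_const :: "real \<Rightarrow> real" where
  "lip_const s = 1 + 3 * (s + 1) * 2 powr (s + 1)"

lemma lip_const_ge_1: "s > 0 \<Longrightarrow> lip_const s \<ge> 1"
  by (simp add: lip_const_def)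

lemma riesz_kernel_minus: "riesz_kernel s (- v) = - riesz_kernel s v"
  by (simp add: riesz_kernel_def)

lemma riesz_kernel_commute: "riesz_kernel s (x - y) = - riesz_kernel s (y - x)"
  using riesz_kernel_minus[of s "y - x"] by simp

lemma norm_riesz_kernel: "v \<noteq> 0 \<Longrightarrow> norm (riesz_kernel s v) = norm v powr (- s)"
  by (simp add: riesz_kernel_def powr_minus powr_add divide_simps)

lemma powr_minus_lipschitz:
  fixes u v w p :: real
  assumes "0 < w" "w \<le> u" "w \<le> v" "0 < p"
  shows "\<bar>u powr (- p) - v powr (- p)\<bar> \<le> p * w powr (- p - 1) * \<bar>u - v\<bar>"
proof -
  have "norm (u powr (- p) - v powr (- p)) \<le> (p * w powr (- p - 1)) * norm (u - v)"
  proof (rule field_differentiable_bound[of "{w..}" _ "\<lambda>z. - p * z powr (- p - 1)"])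
    fix z assume z: "z \<in> {w..}"
    show "((\<lambda>z. z powr - p) has_field_derivative - p * z powr (- p - 1)) (at z within {w..})"
      using z assms by (auto intro!: derivative_eq_intros)
    have "z powr (- p - 1) \<le> w powr (- p - 1)"
      using z assms by (intro powr_mono2') auto
    then show "norm (- p * z powr (- p - 1)) \<le> p * w powr (- p - 1)"
      using assms by (simp add: abs_mult)
  qed (use assms in auto)
  then show ?thesis by simp
qed

lemma riesz_lip_const:
  fixes a b :: "'a::euclidean_space"
  assumes s: "0 < s" and a: "a \<noteq> 0" and ab: "norm (a - b) \<le> norm a / 2"
  shows "norm (riesz_kernel s a - riesz_kernel s b)
    \<le> lip_const s * norm (a - b) * norm a powr (- s - 1)"
proof -
  define p where "p = s + 1"
  have p: "p > 0" using s by (simp add: p_def)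
  have na: "norm a > 0" using a by simp
  have nb1: "norm a / 2 \<le> norm b" using ab norm_triangle_ineq2[of a b] by linarith
  have nb2: "norm b \<le> 3 / 2 * norm a" using ab norm_triangle_ineq2[of b a] by (simp add: norm_minus_commute)
  \<comment> \<open>Product rule in difference form: first the vector changes, then the power of its
    norm.\<close>
  have eq: "riesz_kernel s a - riesz_kernel s b
     = (norm a powr (- p)) *\<^sub>R (a - b) + (norm a powr (- p) - norm b powr (- p)) *\<^sub>R b"
    by (simp add: riesz_kernel_def p_def powr_minus_divide algebra_simps del: minus_add_distrib)
  have 1: "norm ((norm a powr (- p)) *\<^sub>R (a - b)) = norm (a - b) * norm a powr (- p)"
    by simp
  have "\<bar>norm a powr (- p) - norm b powr (- p)\<bar> \<le> p * (norm a / 2) powr (- p - 1) * \<bar>norm a - norm b\<bar>"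
    using na nb1 p by (intro powr_minus_lipschitz) auto
  also have "\<dots> \<le> p * (norm a / 2) powr (- p - 1) * norm (a - b)"
    using p by (intro mult_left_mono norm_triangle_ineq3) auto
  finally have "norm ((norm a powr (- p) - norm b powr (- p)) *\<^sub>R b)
     \<le> (p * (norm a / 2) powr (- p - 1) * norm (a - b)) * (3 / 2 * norm a)"
    unfolding norm_scaleR using nb2 by (intro mult_mono) (use p in auto)
  also have "(norm a / 2) powr (- p - 1) = 2 powr (p + 1) * (norm a powr (- p) / norm a)"
  proof -
    have "(norm a / 2) powr (- p - 1) = norm a powr (- p - 1) / 2 powr (- p - 1)"
      using na by (simp add: powr_divide)
    also have "2 powr (- p - 1) = 1 / (2::real) powr (p + 1)"
      using powr_minus_divide[of "2::real" "p + 1"] by simp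
    also have "norm a powr (- p - 1) = norm a powr (- p) / norm a"
      using na by (simp add: powr_diff)
    finally show ?thesis by simp
  qed
  also have "p * (2 powr (p + 1) * (norm a powr (- p) / norm a)) * norm (a - b) * (3 / 2 * norm a)
     = 3 * p * 2 powr p * norm (a - b) * norm a powr (- p)"
    using na by (simp add: powr_add field_simps)
  finally have 2: "norm ((norm a powr (- p) - norm b powr (- p)) *\<^sub>R b)
     \<le> 3 * p * 2 powr p * norm (a - b) * norm a powr (- p)" .
  have "norm (riesz_kernel s a - riesz_kernel s b)
     \<le> norm (a - b) * norm a powr (- p) + 3 * p * 2 powr p * norm (a - b) * norm a powr (- p)"
    unfolding eq using 1 2 norm_triangle_ineq by (smt (verit))
  also have "\<dots> = lip_const s * norm (a - b) * norm a powr (- s - 1)"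
    by (simp add: lip_const_def p_def algebra_simps del: add_uminus_conv_diff)
  finally show ?thesis .
qed

text \<open>The elements of \<open>X\<close> are the leaves of a tree of depth \<open>N\<close>, carrying the masses \<open>m\<close> at the
  points \<open>c\<close>; \<open>pre k x\<close> names the cube of generation \<open>k\<close> containing the leaf \<open>x\<close>. In \<open>row\<close>, dividing \<open>m y\<close>
  by the mass of its cube makes the sum an average over each cube, so that it is governed by
  the geometry alone; cubes of mass zero contribute nothing because \<open>m y / 0 = 0\<close>.\<close>

locale separated_tree =
  fixes X :: "'x set" and pre :: "nat \<Rightarrow> 'x \<Rightarrow> 'b" and c :: "'x \<Rightarrow> 'a::euclidean_space"
    and l :: "nat \<Rightarrow> real" and N :: nat and s \<omega> :: real and m :: "'x \<Rightarrow> real"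
  assumes s_pos: "0 < s" and fin: "finite X"
    and pre_0: "x \<in> X \<Longrightarrow> y \<in> X \<Longrightarrow> pre 0 x = pre 0 y"
    and pre_Suc: "x \<in> X \<Longrightarrow> y \<in> X \<Longrightarrow> pre (Suc k) x = pre (Suc k) y \<Longrightarrow> pre k x = pre k y"
    and pre_N: "x \<in> X \<Longrightarrow> y \<in> X \<Longrightarrow> pre N x = pre N y \<Longrightarrow> x = y"
    and l_pos: "0 < l k"
    and l_half: "k < N \<Longrightarrow> l (Suc k) \<le> l k / 2"
    and l_small: "k < N \<Longrightarrow> 16 * l (Suc k) powr (2 * s) \<le> l k powr (2 * s)"
    and diam: "x \<in> X \<Longrightarrow> y \<in> X \<Longrightarrow> k \<le> N \<Longrightarrow> pre k x = pre k y \<Longrightarrow> norm (c x - c y) \<le> l k"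
    and sep: "x \<in> X \<Longrightarrow> y \<in> X \<Longrightarrow> k < N \<Longrightarrow> pre k x = pre k y \<Longrightarrow> pre (Suc k) x \<noteq> pre (Suc k) y
        \<Longrightarrow> 4 * l (Suc k) \<le> norm (c x - c y)"
    and m_nonneg: "0 \<le> m x"
    and row: "k < N \<Longrightarrow> x \<in> X \<Longrightarrow>
        (\<Sum>y\<in>{y\<in>X. pre k y = pre k x \<and> pre (Suc k) y \<noteq> pre (Suc k) x}.
           m y / sum m {z\<in>X. pre (Suc k) z = pre (Suc k) y} * norm (c y - c x) powr (- s - 1))
        \<le> \<omega> * l (Suc k) powr (- s - 1)"
begin

definition block :: "nat \<Rightarrow> 'x \<Rightarrow> 'x set" where
  "block k x = {y\<in>X. pre k y = pre k x}"
definition sib :: "nat \<Rightarrow> 'x \<Rightarrow> 'x set" where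
  "sib k x = {y\<in>X. pre k y = pre k x \<and> pre (Suc k) y \<noteq> pre (Suc k) x}"
definition mass :: "nat \<Rightarrow> 'x \<Rightarrow> real" where
  "mass k x = sum m (block k x)"
definition density :: "nat \<Rightarrow> 'x \<Rightarrow> real" where
  "density k x = mass k x / l k powr s"
text \<open>As density is constant on cubes, this is the sum of mass^3 / l^(2s) over the cubes of
  generation \<open>k\<close>, written over leaves so that it compares directly with L2 norms with
  respect to \<open>m\<close>.\<close>

definition energy :: "nat \<Rightarrow> real" where
  "energy k = (\<Sum>x\<in>X. m x * (density k x)\<^sup>2)"
definition G :: "nat \<Rightarrow> 'x \<Rightarrow> 'a" where
  "G k x = (\<Sum>y\<in>sib k x. m y *\<^sub>R riesz_kernel s (c y - c x))"
text \<open>Up to \<open>lip_const s\<close> this is a local Lipschitz constant of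
  \<open>G k\<close> near \<open>x\<close>, the derivative of the kernel having order -s -
  1.\<close>

definition slope :: "nat \<Rightarrow> 'x \<Rightarrow> real" where
  "slope k x = (\<Sum>y\<in>sib k x. m y * norm (c y - c x) powr (- s - 1))"

lemma finite_block: "finite (block k x)" and finite_sib: "finite (sib k x)"
  using fin by (auto simp: block_def sib_def)

lemma block_eq: "y \<in> block k x \<Longrightarrow> block k y = block k x"
  by (auto simp: block_def)

lemma mass_eq: "y \<in> block k x \<Longrightarrow> mass k y = mass k x"
  by (simp add: mass_def block_eq)

lemma self_in_block: "x \<in> X \<Longrightarrow> x \<in> block k x"
  by (simp add: block_def)

lemma mass_nonneg: "0 \<le> mass k x"
  unfolding mass_def by (intro sum_nonneg m_nonneg)

lemma density_nonneg: "0 \<le> density k x"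
  unfolding density_def using mass_nonneg[of k x] l_pos[of k] by simp

lemma energy_nonneg: "0 \<le> energy k"
  unfolding energy_def using m_nonneg by (intro sum_nonneg) simp

lemma slope_nonneg: "0 \<le> slope k x"
  unfolding slope_def using m_nonneg by (intro sum_nonneg) simp

lemma pre_mono: "x \<in> X \<Longrightarrow> y \<in> X \<Longrightarrow> j \<le> k \<Longrightarrow> pre k x = pre k y \<Longrightarrow> pre j x = pre j y"
proof (induction k)
  case (Suc k)
  then show ?case using pre_Suc[of x y k] by (cases "j = Suc k") auto
qed simp

lemma l_antimono: "j \<le> k \<Longrightarrow> k \<le> N \<Longrightarrow> l k \<le> l j * (1/2) ^ (k - j)"
proof (induction k)
  case (Suc k)
  show ?case
  proof (cases "j = Suc k")
    case False
    then have "l k \<le> l j * (1/2) ^ (k - j)" "Suc k - j = Suc (k - j)" using Suc by auto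
    moreover have "l (Suc k) \<le> l k / 2" using l_half[of k] Suc.prems by simp
    ultimately show ?thesis by simp
  qed simp
qed simp

lemma block_0: "x \<in> X \<Longrightarrow> block 0 x = X"
  unfolding block_def using pre_0 by blast

lemma block_N: "x \<in> X \<Longrightarrow> block N x = {x}"
  unfolding block_def using pre_N by blast

lemma block_Suc: "x \<in> X \<Longrightarrow> block k x = sib k x \<union> block (Suc k) x"
  unfolding block_def sib_def using pre_Suc by blast

lemma sib_disj: "sib k x \<inter> block (Suc k) x = {}"
  by (auto simp: block_def sib_def)

text \<open>Every leaf either shares the cube of generation n with \<open>x\<close> or leaves the
  branch of \<open>x\<close> at exactly one generation k < n; the latter leaves form
  \<open>sib k x\<close>.\<close>

lemma sum_telescope:
  fixes f :: "'x \<Rightarrow> 'v::comm_monoid_add"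
  assumes x: "x \<in> X"
  shows "sum f X = (\<Sum>k<n. sum f (sib k x)) + sum f (block n x)"
proof (induction n)
  case 0
  then show ?case by (simp add: block_0[OF x])
next
  case (Suc n)
  have "sum f (block n x) = sum f (sib n x) + sum f (block (Suc n) x)"
    by (subst block_Suc[OF x], rule sum.union_disjoint) (use sib_disj finite_sib finite_block in auto)
  with Suc show ?case by (simp add: add.assoc)
qed

lemma sum_sib:
  fixes f :: "'x \<Rightarrow> 'v::ab_group_add"
  assumes x: "x \<in> X"
  shows "sum f (X - {x}) = (\<Sum>k<N. sum f (sib k x))"
  using sum_telescope[OF x, of f N] block_N[OF x] fin x by (simp add: sum_diff1)

lemma sum_blocks:
  fixes f :: "'x \<Rightarrow> 'v::comm_monoid_add"
  shows "sum f X = (\<Sum>b\<in>pre k ` X. sum f {x\<in>X. pre k x = b})"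
  by (rule sum.image_gen[OF fin])

lemma sum_le_blocks:
  fixes f g :: "'x \<Rightarrow> real"
  assumes "\<And>z. z \<in> X \<Longrightarrow> sum f (block k z) \<le> sum g (block k z)"
  shows "sum f X \<le> sum g X"
proof -
  have "sum f {x\<in>X. pre k x = b} \<le> sum g {x\<in>X. pre k x = b}" if "b \<in> pre k ` X" for b
    using assms that unfolding block_def by auto
  then show ?thesis unfolding sum_blocks[of _ k] by (rule sum_mono)
qed

section \<open>Oddness of the kernel and almost orthogonality\<close>

lemma pairing:
  fixes \<phi> :: "'x \<Rightarrow> 'a"
  defines "d \<equiv> \<lambda>k x y. pre (Suc k) y \<noteq> pre (Suc k) x"
  shows "(\<Sum>x\<in>block k z. m x * (\<phi> x \<bullet> G k x)) =
    1/2 * (\<Sum>x\<in>block k z. \<Sum>y\<in>block k z.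
      if d k x y then m x * m y * ((\<phi> x - \<phi> y) \<bullet> riesz_kernel s (c y - c x)) else 0)"
proof -
  let ?B = "block k z"
  define F where "F x y = (if d k x y then m x * m y * (\<phi> x \<bullet> riesz_kernel s (c y - c x)) else 0)" for x y
  have 1: "m x * (\<phi> x \<bullet> G k x) = (\<Sum>y\<in>?B. F x y)" if "x \<in> ?B" for x
  proof -
    have "sib k x = {y\<in>?B. d k x y}" using that by (auto simp: sib_def block_def d_def)
    then have "m x * (\<phi> x \<bullet> G k x) = (\<Sum>y\<in>{y\<in>?B. d k x y}. m x * m y * (\<phi> x \<bullet> riesz_kernel s (c y - c x)))"
      by (simp add: G_def inner_sum_right sum_distrib_left mult_ac)
    also have "\<dots> = (\<Sum>y\<in>?B. F x y)"
      unfolding F_def using finite_block by (simp add: sum.inter_filter)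
    finally show ?thesis .
  qed
  \<comment> \<open>The kernel is odd and the condition \<open>d\<close> symmetric, so adding the
    transposed sum leaves only differences of \<open>\<phi>\<close>. A constant
    \<open>\<phi>\<close> gives mean zero, a monotone one gives a sign.\<close>
  have 2: "F x y + F y x = (if d k x y then m x * m y * ((\<phi> x - \<phi> y) \<bullet> riesz_kernel s (c y - c x)) else 0)" for x y
    using riesz_kernel_commute[of s "c x" "c y"]
    by (auto simp: F_def d_def inner_diff_left algebra_simps)
  have "(\<Sum>x\<in>?B. m x * (\<phi> x \<bullet> G k x)) = (\<Sum>x\<in>?B. \<Sum>y\<in>?B. F x y)"
    using 1 by (intro sum.cong) auto
  moreover have "(\<Sum>x\<in>?B. \<Sum>y\<in>?B. F x y) = (\<Sum>x\<in>?B. \<Sum>y\<in>?B. F y x)"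
    by (rule sum.swap)
  ultimately have "2 * (\<Sum>x\<in>?B. m x * (\<phi> x \<bullet> G k x)) = (\<Sum>x\<in>?B. \<Sum>y\<in>?B. F x y + F y x)"
    by (simp add: sum.distrib)
  then show ?thesis unfolding 2 by simp
qed

lemma block_mean_zero: "(\<Sum>x\<in>block k z. m x * (v \<bullet> G k x)) = 0"
  unfolding pairing[where \<phi> = "\<lambda>_. v"] by (simp cong: if_cong)

text \<open>Two leaves in one cube of generation j > k have the same siblings at generation k, all
  at distance at least 4 l(k+1). Their own distance is at most l(j) <= l(k+1), so the Lipschitz
  bound of the kernel applies term by term.\<close>

lemma G_osc:
  assumes x: "x \<in> X" "x' \<in> X" and k: "k < j" "j \<le> N" and eq: "pre j x = pre j x'"
  shows "norm (G k x - G k x') \<le> lip_const s * l j * slope k x"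
proof -
  have eqS: "pre (Suc k) x = pre (Suc k) x'" using pre_mono[OF x _ eq] k by simp
  have eqk: "pre k x = pre k x'" using pre_mono[OF x _ eq] k by simp
  have sb: "sib k x = sib k x'" using eqS eqk by (auto simp: sib_def)
  have lj: "l j \<le> l (Suc k)"
  proof -
    have "l j \<le> l (Suc k) * (1/2) ^ (j - Suc k)" using k by (intro l_antimono) auto
    also have "\<dots> \<le> l (Suc k) * 1" using l_pos[of "Suc k"] by (intro mult_left_mono power_le_one) auto
    finally show ?thesis by simp
  qed
  have cx: "norm (c x - c x') \<le> l j" using diam x k eq by simp
  have "norm (G k x - G k x') = norm (\<Sum>y\<in>sib k x. m y *\<^sub>R (riesz_kernel s (c y - c x) - riesz_kernel s (c y - c x')))"
    unfolding G_def sb by (simp add: sum_subtractf scaleR_diff_right)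
  also have "\<dots> \<le> (\<Sum>y\<in>sib k x. m y * (lip_const s * l j * norm (c y - c x) powr (- s - 1)))"
  proof (rule sum_norm_le)
    fix y assume y: "y \<in> sib k x"
    then have yX: "y \<in> X" and d: "4 * l (Suc k) \<le> norm (c y - c x)"
      using sep[of y x k] x k by (auto simp: sib_def)
    have nz: "c y - c x \<noteq> 0" using d l_pos[of "Suc k"] by auto
    have eqd: "(c y - c x) - (c y - c x') = c x' - c x" by simp
    have "norm (riesz_kernel s (c y - c x) - riesz_kernel s (c y - c x'))
       \<le> lip_const s * norm ((c y - c x) - (c y - c x')) * norm (c y - c x) powr (- s - 1)"
      by (rule riesz_lip_const[OF s_pos nz])
         (use d lj cx l_pos[of "Suc k"] in \<open>unfold eqd, simp add: norm_minus_commute\<close>)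
    also have "\<dots> \<le> lip_const s * l j * norm (c y - c x) powr (- s - 1)"
      unfolding eqd using cx lip_const_ge_1[OF s_pos]
      by (intro mult_right_mono mult_left_mono) (auto simp: norm_minus_commute)
    finally show "norm (m y *\<^sub>R (riesz_kernel s (c y - c x) - riesz_kernel s (c y - c x')))
       \<le> m y * (lip_const s * l j * norm (c y - c x) powr (- s - 1))"
      using m_nonneg[of y] by (simp add: mult_left_mono)
  qed
  also have "\<dots> = lip_const s * l j * slope k x"
    by (simp add: slope_def sum_distrib_left mult_ac)
  finally show ?thesis .
qed

text \<open>\<open>G j\<close> has mean zero on each cube of generation j, so \<open>G k\<close> may
  be replaced there by its difference from the value at a representative, which \<open>G_osc\<close>
  controls.\<close>

lemma cross_term:
  assumes k: "k < j" "j < N"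
  shows "\<bar>\<Sum>x\<in>X. m x * (G k x \<bullet> G j x)\<bar> \<le> lip_const s * l j * (\<Sum>x\<in>X. m x * slope k x * norm (G j x))"
proof -
  have "\<bar>\<Sum>x\<in>X. m x * (G k x \<bullet> G j x)\<bar> \<le> (\<Sum>b\<in>pre j ` X. \<bar>\<Sum>x\<in>{x\<in>X. pre j x = b}. m x * (G k x \<bullet> G j x)\<bar>)"
    unfolding sum_blocks[of _ j] by (rule sum_abs)
  also have "\<dots> \<le> (\<Sum>b\<in>pre j ` X. \<Sum>x\<in>{x\<in>X. pre j x = b}. lip_const s * l j * (m x * slope k x * norm (G j x)))"
  proof (rule sum_mono)
    fix b assume "b \<in> pre j ` X"
    then obtain z where z: "z \<in> X" "b = pre j z" by auto
    have B: "{x\<in>X. pre j x = b} = block j z" using z by (auto simp: block_def)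
    have eq: "(\<Sum>x\<in>block j z. m x * (G k x \<bullet> G j x)) = (\<Sum>x\<in>block j z. m x * ((G k x - G k z) \<bullet> G j x))"
      using block_mean_zero[of "G k z" j z] by (simp add: inner_diff_left right_diff_distrib sum_subtractf)
    have "\<bar>\<Sum>x\<in>block j z. m x * (G k x \<bullet> G j x)\<bar> \<le> (\<Sum>x\<in>block j z. \<bar>m x * ((G k x - G k z) \<bullet> G j x)\<bar>)"
      unfolding eq by (rule sum_abs)
    also have "\<dots> \<le> (\<Sum>x\<in>block j z. lip_const s * l j * (m x * slope k x * norm (G j x)))"
    proof (rule sum_mono)
      fix x assume "x \<in> block j z"
      then have x: "x \<in> X" "pre j x = pre j z" unfolding block_def by blast+
      have "\<bar>(G k x - G k z) \<bullet> G j x\<bar> \<le> norm (G k x - G k z) * norm (G j x)"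
        by (rule Cauchy_Schwarz_ineq2)
      also have "\<dots> \<le> (lip_const s * l j * slope k x) * norm (G j x)"
        using G_osc[OF x(1) z(1) k(1) _ x(2)] k(2) by (intro mult_right_mono) simp_all
      finally have "m x * \<bar>(G k x - G k z) \<bullet> G j x\<bar> \<le> m x * ((lip_const s * l j * slope k x) * norm (G j x))"
        using m_nonneg[of x] by (rule mult_left_mono)
      then show "\<bar>m x * ((G k x - G k z) \<bullet> G j x)\<bar> \<le> lip_const s * l j * (m x * slope k x * norm (G j x))"
        using m_nonneg[of x] by (simp add: abs_mult mult_ac)
    qed
    finally show "\<bar>\<Sum>x\<in>{x\<in>X. pre j x = b}. m x * (G k x \<bullet> G j x)\<bar>
       \<le> (\<Sum>x\<in>{x\<in>X. pre j x = b}. lip_const s * l j * (m x * slope k x * norm (G j x)))"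
      unfolding B .
  qed
  also have "\<dots> = lip_const s * l j * (\<Sum>x\<in>X. m x * slope k x * norm (G j x))"
    unfolding sum_blocks[of _ j, symmetric] by (simp add: sum_distrib_left)
  finally show ?thesis .
qed

text \<open>A Schur test, in trilinear form: the products \<open>M x * (M y)\<^sup>2\<close> are symmetrised by
  \<open>a b\<^sup>2 \<le> a\<^sup>3 + b\<^sup>3\<close>.\<close>

lemma slope_L2:
  assumes k: "k < N"
  shows "(\<Sum>x\<in>X. m x * (l (Suc k) * slope k x)\<^sup>2) \<le> 2 * \<omega>\<^sup>2 * energy (Suc k)"
proof -
  define M where "M = mass (Suc k)"
  define q where "q y = m y / M y" for y
  define ker where "ker x y = norm (c y - c x) powr (- s - 1)" for x y
  define \<Omega> where "\<Omega> = \<omega> * l (Suc k) powr (- s - 1)"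
  have M0: "0 \<le> M y" for y by (simp add: M_def mass_nonneg)
  have q0: "0 \<le> q y" for y using M0 m_nonneg by (simp add: q_def)
  have ker0: "0 \<le> ker x y" for x y by (simp add: ker_def)
  have kersym: "ker x y = ker y x" for x y by (simp add: ker_def norm_minus_commute)
  \<comment> \<open>When the cube has mass zero, so has the leaf, and the convention
    \<open>m y / 0 = 0\<close> does no harm.\<close>
  have mq: "m y = q y * M y" if "y \<in> X" for y
  proof (cases "M y = 0")
    case True
    have "m y \<le> M y" unfolding M_def mass_def using that self_in_block finite_block m_nonneg
      by (intro member_le_sum) auto
    with True m_nonneg[of y] show ?thesis by simp
  qed (simp add: q_def)
  have rw: "(\<Sum>y\<in>sib k x. q y * ker x y) \<le> \<Omega>" if "x \<in> X" for x
    using row[OF k that] unfolding q_def M_def mass_def block_def sib_def ker_def \<Omega>_def .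
  have Om0: "0 \<le> \<Omega>" if "x \<in> X" for x
    using rw[OF that] sum_nonneg[of "sib k x" "\<lambda>y. q y * ker x y"] q0 ker0 by (smt (verit) mult_nonneg_nonneg)
  \<comment> \<open>Cauchy-Schwarz with the weights \<open>q y * ker x y\<close>, whose total is at
    most \<open>\<Omega>\<close> by the row bound; \<open>slope\<close> is the weighted sum of the
    masses \<open>M y\<close>.\<close>
  have sl: "(slope k x)\<^sup>2 \<le> \<Omega> * (\<Sum>y\<in>sib k x. q y * ker x y * (M y)\<^sup>2)" if x: "x \<in> X" for x
  proof -
    have "slope k x = (\<Sum>y\<in>sib k x. sqrt (q y * ker x y) * (sqrt (q y * ker x y) * M y))"
      unfolding slope_def
    proof (rule sum.cong)
      fix y assume "y \<in> sib k x"
      then have "y \<in> X" by (auto simp: sib_def)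
      then show "m y * norm (c y - c x) powr (- s - 1) = sqrt (q y * ker x y) * (sqrt (q y * ker x y) * M y)"
        using mq q0[of y] ker0[of x y] by (simp add: ker_def mult_ac flip: mult.assoc)
    qed simp
    also have "(\<dots>)\<^sup>2 \<le> (\<Sum>y\<in>sib k x. (sqrt (q y * ker x y))\<^sup>2) * (\<Sum>y\<in>sib k x. (sqrt (q y * ker x y) * M y)\<^sup>2)"
      by (rule Cauchy_Schwarz_ineq_sum)
    also have "\<dots> = (\<Sum>y\<in>sib k x. q y * ker x y) * (\<Sum>y\<in>sib k x. q y * ker x y * (M y)\<^sup>2)"
      using q0 ker0 by (simp add: power_mult_distrib)
    also have "\<dots> \<le> \<Omega> * (\<Sum>y\<in>sib k x. q y * ker x y * (M y)\<^sup>2)"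
      using rw[OF x] q0 ker0 by (intro mult_right_mono sum_nonneg) auto
    finally show ?thesis .
  qed
  define T where "T x y = (if y \<in> sib k x then q x * q y * ker x y * (M y) ^ 3 else 0)" for x y
  have sibsym: "y \<in> sib k x \<longleftrightarrow> x \<in> sib k y" if "x \<in> X" "y \<in> X" for x y
    using that by (auto simp: sib_def)
  have young: "a * b\<^sup>2 \<le> a ^ 3 + b ^ 3" if "0 \<le> a" "0 \<le> b" for a b :: real
  proof (cases "a \<le> b")
    case True
    then have "a * b\<^sup>2 \<le> b * b\<^sup>2" by (intro mult_right_mono) auto
    also have "\<dots> = b ^ 3" by (simp add: power3_eq_cube power2_eq_square)
    finally show ?thesis using that zero_le_power[OF that(1), of 3] by linarith
  next
    case False
    then have "b\<^sup>2 \<le> a\<^sup>2" using that by (intro power_mono) auto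
    then have "a * b\<^sup>2 \<le> a * a\<^sup>2" using that by (intro mult_left_mono)
    also have "\<dots> = a ^ 3" by (simp add: power3_eq_cube power2_eq_square)
    finally show ?thesis using that zero_le_power[OF that(2), of 3] by linarith
  qed
  \<comment> \<open>After symmetrisation each term carries the cube of one mass only, and since
    \<open>ker\<close> is symmetric the other variable is again summed by the row bound.\<close>
  have tot: "(\<Sum>x\<in>X. \<Sum>y\<in>X. T y x) \<le> (\<Sum>x\<in>X. \<Omega> * (m x * (M x)\<^sup>2))"
  proof (rule sum_mono)
    fix x assume x: "x \<in> X"
    have "(\<Sum>y\<in>X. T y x) = (\<Sum>y\<in>sib k x. q y * ker x y * (q x * (M x) ^ 3))"
    proof -
      have "sib k x = {y\<in>X. x \<in> sib k y}" using sibsym x by (auto simp: sib_def)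
      then show ?thesis unfolding T_def
        by (simp add: sum.inter_filter[OF fin] kersym[of x] mult_ac cong: if_cong)
    qed
    also have "\<dots> = (\<Sum>y\<in>sib k x. q y * ker x y) * (q x * (M x) ^ 3)"
      by (simp add: sum_distrib_right)
    also have "\<dots> \<le> \<Omega> * (q x * (M x) ^ 3)"
      using rw[OF x] q0 M0 by (intro mult_right_mono) auto
    also have "q x * (M x) ^ 3 = m x * (M x)\<^sup>2"
      using mq[OF x] by (simp add: power3_eq_cube power2_eq_square)
    finally show "(\<Sum>y\<in>X. T y x) \<le> \<Omega> * (m x * (M x)\<^sup>2)" .
  qed
  have "(\<Sum>x\<in>X. m x * (slope k x)\<^sup>2) \<le> (\<Sum>x\<in>X. m x * (\<Omega> * (\<Sum>y\<in>sib k x. q y * ker x y * (M y)\<^sup>2)))"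
    using sl m_nonneg by (intro sum_mono mult_left_mono) auto
  also have "\<dots> \<le> (\<Sum>x\<in>X. \<Omega> * (\<Sum>y\<in>X. T x y + T y x))"
  proof (rule sum_mono)
    fix x assume x: "x \<in> X"
    have "m x * (\<Sum>y\<in>sib k x. q y * ker x y * (M y)\<^sup>2)
       = (\<Sum>y\<in>X. if y \<in> sib k x then q x * q y * ker x y * (M x * (M y)\<^sup>2) else 0)"
    proof -
      have "sib k x = {y\<in>X. y \<in> sib k x}" by (auto simp: sib_def)
      then show ?thesis
        by (simp add: sum.inter_filter[OF fin, symmetric] mq[OF x] sum_distrib_left mult_ac)
    qed
    also have "\<dots> \<le> (\<Sum>y\<in>X. T x y + T y x)"
    proof (rule sum_mono)
      fix y assume y: "y \<in> X"
      have "(q x * q y * ker x y) * (M x * (M y)\<^sup>2) \<le> (q x * q y * ker x y) * ((M x) ^ 3 + (M y) ^ 3)"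
        using young[OF M0[of x] M0[of y]] q0 ker0 by (intro mult_left_mono) auto
      then show "(if y \<in> sib k x then q x * q y * ker x y * (M x * (M y)\<^sup>2) else 0) \<le> T x y + T y x"
        using sibsym[OF x y] kersym[of x y] by (simp add: T_def algebra_simps)
    qed
    finally have "m x * (\<Sum>y\<in>sib k x. q y * ker x y * (M y)\<^sup>2) \<le> (\<Sum>y\<in>X. T x y + T y x)" .
    from mult_left_mono[OF this Om0[OF x]]
    show "m x * (\<Omega> * (\<Sum>y\<in>sib k x. q y * ker x y * (M y)\<^sup>2)) \<le> \<Omega> * (\<Sum>y\<in>X. T x y + T y x)"
      by (simp add: mult_ac)
  qed
  also have "\<dots> = \<Omega> * (2 * (\<Sum>x\<in>X. \<Sum>y\<in>X. T y x))"
    using sum.swap[of T X X] by (simp add: sum.distrib flip: sum_distrib_left)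
  also have "\<dots> \<le> \<Omega> * (2 * (\<Sum>x\<in>X. \<Omega> * (m x * (M x)\<^sup>2)))"
  \<comment> \<open>The sign of \<open>\<Omega>\<close> is known only through the row bound at some
    leaf.\<close>
  proof (cases "X = {}")
    case False
    then have "0 \<le> \<Omega>" using Om0 by auto
    then show ?thesis using tot by (intro mult_left_mono) auto
  qed simp
  finally have main: "(\<Sum>x\<in>X. m x * (slope k x)\<^sup>2) \<le> 2 * \<Omega>\<^sup>2 * (\<Sum>x\<in>X. m x * (M x)\<^sup>2)"
    by (simp add: power2_eq_square mult_ac flip: sum_distrib_left)
  have lp: "l (Suc k) > 0" by (rule l_pos)
  have "(\<Sum>x\<in>X. m x * (l (Suc k) * slope k x)\<^sup>2) = (l (Suc k))\<^sup>2 * (\<Sum>x\<in>X. m x * (slope k x)\<^sup>2)"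
    by (simp add: sum_distrib_left power_mult_distrib mult_ac)
  also have "\<dots> \<le> (l (Suc k))\<^sup>2 * (2 * \<Omega>\<^sup>2 * (\<Sum>x\<in>X. m x * (M x)\<^sup>2))"
    by (intro mult_left_mono main) simp
  also have "\<dots> = 2 * \<omega>\<^sup>2 * energy (Suc k)"
  proof -
    have "l (Suc k) * \<Omega> = \<omega> / l (Suc k) powr s"
      using lp by (simp add: \<Omega>_def powr_diff powr_minus field_simps)
    then have "(l (Suc k))\<^sup>2 * \<Omega>\<^sup>2 = \<omega>\<^sup>2 / (l (Suc k) powr s)\<^sup>2"
      by (simp add: power_divide flip: power_mult_distrib)
    moreover have "(l (Suc k))\<^sup>2 * (2 * \<Omega>\<^sup>2 * (\<Sum>x\<in>X. m x * (M x)\<^sup>2))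
        = 2 * ((l (Suc k))\<^sup>2 * \<Omega>\<^sup>2) * (\<Sum>x\<in>X. m x * (M x)\<^sup>2)"
      by simp
    moreover have "energy (Suc k) = (\<Sum>x\<in>X. m x * (M x)\<^sup>2) / (l (Suc k) powr s)\<^sup>2"
      by (simp add: energy_def density_def M_def power_divide sum_divide_distrib)
    ultimately show ?thesis by simp
  qed
  finally show ?thesis .
qed

end

section \<open>Monotonicity of truncated radial vector fields\<close>

lemma clamp_pairing:
  fixes u v :: "'a::euclidean_space"
  assumes "0 < r"
  shows "(norm u / max r (norm u) - norm v / max r (norm v)) * (norm u - norm v)
    \<le> ((1 / max r (norm u)) *\<^sub>R u - (1 / max r (norm v)) *\<^sub>R v) \<bullet> (u - v)"
proof -
  define \<mu> \<nu> where "\<mu> = 1 / max r (norm u)" and "\<nu> = 1 / max r (norm v)"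
  have "0 < max r (norm u)" "0 < max r (norm v)" using assms by auto
  then have "0 \<le> \<mu>" "0 \<le> \<nu>" by (auto simp: \<mu>_def \<nu>_def)
  \<comment> \<open>Cauchy-Schwarz for the mixed term reduces the claim to the radial profile
    \<open>x / max r x\<close>, which is increasing.\<close>
  then have "(\<mu> + \<nu>) * (u \<bullet> v) \<le> (\<mu> + \<nu>) * (norm u * norm v)"
    by (intro mult_left_mono norm_cauchy_schwarz) auto
  then have "(\<mu> * norm u - \<nu> * norm v) * (norm u - norm v) \<le> (\<mu> *\<^sub>R u - \<nu> *\<^sub>R v) \<bullet> (u - v)"
    by (simp add: inner_diff_left inner_diff_right inner_commute[of v u] algebra_simps
        power2_norm_eq_inner[symmetric] power2_eq_square)
  then show ?thesis by (simp add: \<mu>_def \<nu>_def)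
qed

lemma clamp_monotone:
  fixes u v :: "'a::euclidean_space"
  assumes "0 < r"
  shows "0 \<le> ((1 / max r (norm u)) *\<^sub>R u - (1 / max r (norm v)) *\<^sub>R v) \<bullet> (u - v)"
proof -
  have mono: "x / max r x \<le> y / max r y" if "0 \<le> x" "x \<le> y" for x y :: real
    using that assms by (auto simp: max_def field_simps intro: mult_mono)
  have "0 \<le> (norm u / max r (norm u) - norm v / max r (norm v)) * (norm u - norm v)"
    using mono[of "norm u" "norm v"] mono[of "norm v" "norm u"]
    by (cases "norm u \<le> norm v") (auto intro: mult_nonneg_nonneg mult_nonpos_nonpos)
  then show ?thesis using clamp_pairing[OF assms, of u v] by linarith
qed

text \<open>If both vectors lie in the ball of radius 2 \<open>\<rho>\<close>, the field is linear
  there with slope 1 / (2 \<open>\<rho>\<close>). Otherwise |v| > 2 \<open>\<rho>\<close>, so |v| -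
  |u| is at least a third of |u - v|, and the radial profile differs by at least 1/2; this is the
  1/6.\<close>

lemma clamp_strong:
  fixes u v :: "'a::euclidean_space"
  assumes "0 < \<rho>" "norm u \<le> \<rho>" "\<rho> \<le> norm (u - v)"
  shows "norm (u - v) / 6
    \<le> ((1 / max (2 * \<rho>) (norm u)) *\<^sub>R u - (1 / max (2 * \<rho>) (norm v)) *\<^sub>R v) \<bullet> (u - v)"
proof (cases "norm v \<le> 2 * \<rho>")
  case True
  have "1 / 6 \<le> norm (u - v) / (2 * \<rho>)"
    using assms by (simp add: field_simps)
  then have "norm (u - v) / 6 \<le> norm (u - v) * (norm (u - v) / (2 * \<rho>))"
    using mult_left_mono[of "1/6" "norm (u - v) / (2 * \<rho>)" "norm (u - v)"] by simp
  also have "\<dots> = ((1 / (2 * \<rho>)) *\<^sub>R (u - v)) \<bullet> (u - v)"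
    by (simp add: power2_norm_eq_inner[symmetric] power2_eq_square)
  also have "\<dots> = ((1 / max (2 * \<rho>) (norm u)) *\<^sub>R u - (1 / max (2 * \<rho>) (norm v)) *\<^sub>R v) \<bullet> (u - v)"
    using True assms by (simp add: max_def scaleR_diff_right)
  finally show ?thesis .
next
  case False
  have "norm (u - v) \<le> norm v + \<rho>" using norm_triangle_ineq4[of u v] assms by linarith
  then have "norm (u - v) \<le> 3 * (norm v - norm u)" using False assms(1,2) by argo
  then have "norm (u - v) / 6 \<le> 1/2 * (norm v - norm u)" by simp
  also have "\<dots> \<le> (1 - norm u / (2 * \<rho>)) * (norm v - norm u)"
    using assms False by (intro mult_right_mono) (auto simp: field_simps)
  also have "\<dots> = (norm u / max (2 * \<rho>) (norm u) - norm v / max (2 * \<rho>) (norm v)) * (norm u - norm v)"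
  proof -
    have "max (2 * \<rho>) (norm u) = 2 * \<rho>" "max (2 * \<rho>) (norm v) = norm v" "norm v / norm v = 1"
      using assms False by auto
    moreover have "(1 - a) * (V - U) = (a - 1) * (U - V)" for a U V :: real
      by (simp add: algebra_simps)
    ultimately show ?thesis by simp
  qed
  also have "\<dots> \<le> ((1 / max (2 * \<rho>) (norm u)) *\<^sub>R u - (1 / max (2 * \<rho>) (norm v)) *\<^sub>R v) \<bullet> (u - v)"
    using assms by (intro clamp_pairing) auto
  finally show ?thesis .
qed

section \<open>Lower bound for a single generation\<close>

context separated_tree
begin

definition sqnorm :: "nat \<Rightarrow> real" where
  "sqnorm k = (\<Sum>x\<in>X. m x * (norm (G k x))\<^sup>2)"

lemma sqnorm_nonneg: "0 \<le> sqnorm k"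
  unfolding sqnorm_def using m_nonneg by (intro sum_nonneg) auto

text \<open>Take the least radius \<open>\<rho>\<close> for which some closed ball about a leaf
  carries half of the mass. By minimality no open ball of radius \<open>\<rho>\<close> about a leaf
  carries more than half, so at least half of the mass is at distance \<open>\<rho>\<close> or more
  from every leaf.\<close>

lemma half_mass_ball:
  assumes z: "z \<in> X" and pos: "0 < mass k z"
  obtains b \<rho> where "b \<in> block k z"
    "mass k z / 2 \<le> sum m {x\<in>block k z. norm (c x - c b) \<le> \<rho>}"
    "\<And>x. x \<in> block k z \<Longrightarrow> mass k z / 2 \<le> sum m {y\<in>block k z. \<rho> \<le> norm (c x - c y)}"
proof -
  let ?B = "block k z" and ?M = "mass k z"
  define ball where "ball b r = {y\<in>?B. norm (c y - c b) \<le> r}" for b r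
  define P where "P = (\<lambda>(b, x). norm (c x - c b)) ` {(b, x) \<in> ?B \<times> ?B. ?M / 2 \<le> sum m (ball b (norm (c x - c b)))}"
  have fB: "finite ?B" by (rule finite_block)
  have zB: "z \<in> ?B" using z by (rule self_in_block)
  have finP: "finite P" unfolding P_def using fB by (auto intro: finite_subset[of _ "?B \<times> ?B"])
  have inP: "norm (c x - c b) \<in> P" if "b \<in> ?B" "x \<in> ?B" "?M / 2 \<le> sum m (ball b (norm (c x - c b)))" for b x
    using that unfolding P_def by force
  have far: "\<exists>x\<in>A. \<forall>y\<in>A. norm (c y - c b) \<le> norm (c x - c b)" if "finite A" "A \<noteq> {}" for A b
  proof -
    let ?f = "\<lambda>y. norm (c y - c b)"
    have "Max (?f ` A) \<in> ?f ` A" using that by (intro Max_in) auto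
    then obtain x where "x \<in> A" "Max (?f ` A) = ?f x" by auto
    moreover have "?f y \<le> Max (?f ` A)" if "y \<in> A" for y using that \<open>finite A\<close> by (intro Max_ge) auto
    ultimately show ?thesis by auto
  qed
  have "P \<noteq> {}"
  proof -
    obtain x where x: "x \<in> ?B" "\<forall>y\<in>?B. norm (c y - c z) \<le> norm (c x - c z)"
      using far[OF fB, of z] zB by auto
    then have "ball z (norm (c x - c z)) = ?B" by (auto simp: ball_def)
    then show ?thesis using inP[OF zB x(1)] pos by (auto simp: mass_def)
  qed
  then have "Min P \<in> P" using finP by simp
  then obtain b x0 where b: "b \<in> ?B" "?M / 2 \<le> sum m (ball b (Min P))" and x0: "Min P = norm (c x0 - c b)"
    unfolding P_def by auto
  show thesis
  proof (rule that[of b "Min P"])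
    show "b \<in> ?B" by fact
    show "?M / 2 \<le> sum m {x \<in> ?B. norm (c x - c b) \<le> Min P}" using b by (simp add: ball_def)
    fix x assume x: "x \<in> ?B"
    show "?M / 2 \<le> sum m {y\<in>?B. Min P \<le> norm (c x - c y)}"
    proof (rule ccontr)
      let ?F = "{y\<in>?B. Min P \<le> norm (c x - c y)}" and ?A = "{y\<in>?B. norm (c y - c x) < Min P}"
      assume lt: "\<not> ?M / 2 \<le> sum m ?F"
      have "?M = sum m ?F + sum m ?A"
        unfolding mass_def using fB
        by (subst sum.union_disjoint[symmetric]) (auto simp: norm_minus_commute intro!: sum.cong)
      then have A: "?M / 2 < sum m ?A" using lt by simp
      then have "?A \<noteq> {}" using pos by (metis sum.empty half_gt_zero_iff order_less_asym)
      \<comment> \<open>The farthest leaf of an open ball that is too heavy yields an admissible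
        radius below the minimum.\<close>
      then obtain y where y: "y \<in> ?A" "\<forall>y'\<in>?A. norm (c y' - c x) \<le> norm (c y - c x)"
        using far[of ?A x] fB by auto
      have "sum m ?A \<le> sum m (ball x (norm (c y - c x)))"
        using y fB m_nonneg by (intro sum_mono2) (auto simp: ball_def)
      then have "norm (c y - c x) \<in> P" using inP[OF x, of y] y A by auto
      then have "Min P \<le> norm (c y - c x)" using finP by simp
      then show False using y by auto
    qed
  qed
qed

text \<open>By oddness of the kernel, testing \<open>G k\<close> against a monotone vector field only produces terms of
  one sign. The field is \<open>x - b\<close>, truncated at twice the radius of a smallest ball carrying half of
  the mass.\<close>

lemma level_lower_bound_spread:
  assumes z: "z \<in> X" and k: "k < N" and pos: "0 < mass k z"
    and good: "\<And>w. w \<in> block k z \<Longrightarrow> mass (Suc k) w < mass k z / 2"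
  shows "mass k z * (density k z)\<^sup>2 \<le> 2304 * (\<Sum>x\<in>block k z. m x * (norm (G k x))\<^sup>2)"
proof -
  let ?B = "block k z" and ?M = "mass k z"
  obtain b \<rho> where b: "b \<in> ?B" and half: "?M / 2 \<le> sum m {x\<in>?B. norm (c x - c b) \<le> \<rho>}"
    and far: "\<And>x. x \<in> ?B \<Longrightarrow> ?M / 2 \<le> sum m {y\<in>?B. \<rho> \<le> norm (c x - c y)}"
    using half_mass_ball[OF z pos] by blast
  have fB: "finite ?B" by (rule finite_block)
  have bX: "b \<in> X" and bz: "pre k b = pre k z" using b by (auto simp: block_def)
  \<comment> \<open>A smaller ball would lie in a single child, and no child carries half of the
    mass.\<close>
  have \<rho>: "4 * l (Suc k) \<le> \<rho>"
  proof (rule ccontr)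
    assume lt: "\<not> 4 * l (Suc k) \<le> \<rho>"
    have "{x\<in>?B. norm (c x - c b) \<le> \<rho>} \<subseteq> block (Suc k) b"
    proof
      fix x assume x: "x \<in> {x\<in>?B. norm (c x - c b) \<le> \<rho>}"
      then have xX: "x \<in> X" and "pre k x = pre k b" using bz by (auto simp: block_def)
      then have "pre (Suc k) x = pre (Suc k) b" using sep[OF xX bX k] x lt by fastforce
      then show "x \<in> block (Suc k) b" using xX by (simp add: block_def)
    qed
    then have "sum m {x\<in>?B. norm (c x - c b) \<le> \<rho>} \<le> mass (Suc k) b"
      unfolding mass_def using finite_block m_nonneg by (intro sum_mono2) auto
    then show False using half good[OF b] by linarith
  qed
  have lS: "0 < l (Suc k)" and lk: "0 < l k" by (rule l_pos)+
  have \<rho>0: "0 < \<rho>" using \<rho> lS by linarith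
  define \<phi> where "\<phi> x = (1 / max (2 * \<rho>) (norm (c x - c b))) *\<^sub>R (c x - c b)" for x
  define d where "d x y \<longleftrightarrow> pre (Suc k) y \<noteq> pre (Suc k) x" for x y
  have kern: "- ((\<phi> x - \<phi> y) \<bullet> riesz_kernel s (c y - c x))
      = ((\<phi> x - \<phi> y) \<bullet> ((c x - c b) - (c y - c b))) / norm (c x - c y) powr (s + 1)" for x y
    by (subst riesz_kernel_commute) (simp add: riesz_kernel_def)
  define T where "T x y = (if d x y then m x * m y * - ((\<phi> x - \<phi> y) \<bullet> riesz_kernel s (c y - c x)) else 0)" for x y
  have T0: "0 \<le> T x y" for x y
  proof -
    have "0 \<le> - ((\<phi> x - \<phi> y) \<bullet> riesz_kernel s (c y - c x))"
      unfolding kern using clamp_monotone[of "2 * \<rho>" "c x - c b" "c y - c b"] \<rho>0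
      by (simp add: \<phi>_def)
    from mult_nonneg_nonneg[OF mult_nonneg_nonneg[OF m_nonneg m_nonneg] this]
    show ?thesis unfolding T_def by simp
  qed
  \<comment> \<open>Pairs at distance at least \<open>\<rho>\<close> > l(k+1) lie in different
    children, so they do occur in \<open>G k\<close>.\<close>
  have Tlow: "m x * m y * (1 / (6 * l k powr s)) \<le> T x y"
    if x: "x \<in> ?B" "norm (c x - c b) \<le> \<rho>" and y: "y \<in> ?B" "\<rho> \<le> norm (c x - c y)" for x y
  proof -
    have X: "x \<in> X" "y \<in> X" "pre k x = pre k y" using x y by (auto simp: block_def)
    have "d x y"
    proof (rule ccontr)
      assume "\<not> d x y"
      then have "norm (c x - c y) \<le> l (Suc k)" using diam[OF X(1,2), of "Suc k"] k by (auto simp: d_def)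
      then show False using y \<rho> lS by linarith
    qed
    have n0: "0 < norm (c x - c y)" using y \<rho>0 by linarith
    have nl: "norm (c x - c y) \<le> l k" using diam[OF X(1,2)] k X(3) by simp
    have "1 / (6 * l k powr s) \<le> 1 / (6 * norm (c x - c y) powr s)"
      using n0 nl s_pos lk by (intro divide_left_mono mult_left_mono powr_mono2 mult_pos_pos) auto
    also have "\<dots> = (norm (c x - c y) / 6) / norm (c x - c y) powr (s + 1)"
      using n0 by (simp add: powr_add)
    also have "\<dots> \<le> ((\<phi> x - \<phi> y) \<bullet> ((c x - c b) - (c y - c b))) / norm (c x - c y) powr (s + 1)"
      unfolding \<phi>_def using clamp_strong[of \<rho> "c x - c b" "c y - c b"] \<rho>0 x y n0
      by (intro divide_right_mono) auto
    finally have "m x * m y * (1 / (6 * l k powr s)) \<le> m x * m y * - ((\<phi> x - \<phi> y) \<bullet> riesz_kernel s (c y - c x))"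
      unfolding kern using m_nonneg by (intro mult_left_mono mult_nonneg_nonneg)
    then show ?thesis using \<open>d x y\<close> by (simp add: T_def)
  qed
  have "?M\<^sup>2 / (24 * l k powr s) \<le> (\<Sum>x\<in>?B. \<Sum>y\<in>?B. T x y)"
  proof -
    let ?D = "{x\<in>?B. norm (c x - c b) \<le> \<rho>}" and ?e = "1 / (6 * l k powr s)"
    have e0: "0 < ?e" using lk by simp
    have "?M\<^sup>2 / (24 * l k powr s) = (?M / 2) * ((?M / 2) * ?e)"
      by (simp add: power2_eq_square)
    also have "\<dots> \<le> sum m ?D * ((?M / 2) * ?e)"
      using half pos e0 by (intro mult_right_mono) auto
    also have "\<dots> = (\<Sum>x\<in>?D. m x * ((?M / 2) * ?e))" by (rule sum_distrib_right)
    also have "\<dots> \<le> (\<Sum>x\<in>?D. \<Sum>y\<in>?B. T x y)"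
    proof (rule sum_mono)
      fix x assume x: "x \<in> ?D"
      have "m x * ((?M / 2) * ?e) \<le> m x * (sum m {y\<in>?B. \<rho> \<le> norm (c x - c y)} * ?e)"
        using far[of x] x e0 m_nonneg by (intro mult_left_mono mult_right_mono) auto
      also have "\<dots> = (\<Sum>y\<in>{y\<in>?B. \<rho> \<le> norm (c x - c y)}. m x * m y * ?e)"
        by (simp only: sum_distrib_left sum_distrib_right mult.assoc)
      also have "\<dots> \<le> (\<Sum>y\<in>{y\<in>?B. \<rho> \<le> norm (c x - c y)}. T x y)"
        using Tlow x by (intro sum_mono) auto
      also have "\<dots> \<le> (\<Sum>y\<in>?B. T x y)" using fB T0 by (intro sum_mono2) auto
      finally show "m x * ((?M / 2) * ?e) \<le> (\<Sum>y\<in>?B. T x y)" .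
    qed
    also have "\<dots> \<le> (\<Sum>x\<in>?B. \<Sum>y\<in>?B. T x y)" using fB T0 by (intro sum_mono2 sum_nonneg) auto
    finally show ?thesis .
  qed
  also have "\<dots> = - 2 * (\<Sum>x\<in>?B. m x * (\<phi> x \<bullet> G k x))"
    unfolding pairing T_def d_def by (simp add: sum_negf[symmetric] cong: if_cong) (intro sum.cong refl, auto)
  also have "\<dots> = 2 * (\<Sum>x\<in>?B. m x * - (\<phi> x \<bullet> G k x))" by (simp add: sum_negf)
  also have "\<dots> \<le> 2 * (\<Sum>x\<in>?B. m x * norm (G k x))"
  proof (intro mult_left_mono sum_mono)
    fix x
    have "norm (\<phi> x) \<le> 1" using \<rho>0 unfolding \<phi>_def by (simp add: divide_simps max_def)
    then have "norm (\<phi> x) * norm (G k x) \<le> 1 * norm (G k x)" by (intro mult_right_mono) auto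
    then show "- (\<phi> x \<bullet> G k x) \<le> norm (G k x)"
      using Cauchy_Schwarz_ineq2[of "\<phi> x" "G k x"] by linarith
  qed (use m_nonneg in auto)
  finally have 1: "?M\<^sup>2 / (48 * l k powr s) \<le> (\<Sum>x\<in>?B. m x * norm (G k x))" by simp
  let ?g = "\<Sum>x\<in>?B. m x * (norm (G k x))\<^sup>2"
  have "(\<Sum>x\<in>?B. m x * norm (G k x))\<^sup>2 = (\<Sum>x\<in>?B. sqrt (m x) * (sqrt (m x) * norm (G k x)))\<^sup>2"
    using m_nonneg by (simp flip: mult.assoc)
  also have "\<dots> \<le> (\<Sum>x\<in>?B. (sqrt (m x))\<^sup>2) * (\<Sum>x\<in>?B. (sqrt (m x) * norm (G k x))\<^sup>2)"
    by (rule Cauchy_Schwarz_ineq_sum)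
  also have "\<dots> = ?M * ?g"
    using m_nonneg by (simp add: mass_def power_mult_distrib)
  finally have 2: "(\<Sum>x\<in>?B. m x * norm (G k x))\<^sup>2 \<le> ?M * ?g" .
  \<comment> \<open>48 = 2 * 2 * 6 * 2: two factors of half the mass, the 1/6 of
    \<open>clamp_strong\<close>, and the symmetrisation in \<open>pairing\<close>. Its square is
    2304.\<close>
  have "(?M\<^sup>2 / (48 * l k powr s))\<^sup>2 \<le> ?M * ?g"
    using power_mono[OF 1, of 2] 2 by simp
  moreover have "(?M\<^sup>2 / (48 * l k powr s))\<^sup>2 = ?M * (?M * (density k z)\<^sup>2 / 2304)"
    by (simp add: density_def power2_eq_square field_simps)
  ultimately have "?M * (?M * (density k z)\<^sup>2 / 2304) \<le> ?M * ?g"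
    by (simp only:)
  then have "?M * (density k z)\<^sup>2 / 2304 \<le> ?g"
    using pos by (simp only: mult_le_cancel_left_pos)
  then show ?thesis by simp
qed

lemma sum_density_block:
  "(\<Sum>x\<in>block k z. m x * (density k x)\<^sup>2) = mass k z * (density k z)\<^sup>2"
  using mass_eq[of _ k z] by (simp add: density_def mass_def sum_distrib_right)

text \<open>In passing to a child with half of the mass, mass^3 loses at most a factor 8, whereas
  \<open>l_small\<close> gains 16 in the denominator. The remaining gain of 2 gives the factor 1/2
  that makes the last term absorbable after summation over \<open>k\<close>.\<close>

lemma level_lower_bound:
  assumes k: "k < N"
  shows "energy k \<le> 2304 * sqnorm k + 1/2 * energy (Suc k)"
proof -
  have "(\<Sum>x\<in>X. m x * (density k x)\<^sup>2)
     \<le> (\<Sum>x\<in>X. 2304 * (m x * (norm (G k x))\<^sup>2) + 1/2 * (m x * (density (Suc k) x)\<^sup>2))"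
  proof (rule sum_le_blocks[where k = k])
    fix z assume z: "z \<in> X"
    let ?B = "block k z" and ?M = "mass k z"
    let ?g = "\<Sum>x\<in>?B. m x * (norm (G k x))\<^sup>2"
    let ?e = "\<Sum>x\<in>?B. m x * (density (Suc k) x)\<^sup>2"
    have g0: "0 \<le> ?g" "0 \<le> ?e"
      using m_nonneg by (auto intro!: sum_nonneg)
    have "?M * (density k z)\<^sup>2 \<le> 2304 * ?g
       + 1/2 * ?e"
    proof (cases "0 < ?M")
      case False
      then have "?M = 0" using mass_nonneg[of k z] by linarith
      then show ?thesis using g0 by simp
    next
      case True
      show ?thesis
      proof (cases "\<exists>w\<in>?B. ?M / 2 \<le> mass (Suc k) w")
        case False
        then have "?M * (density k z)\<^sup>2 \<le> 2304 * ?g"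
          by (intro level_lower_bound_spread z k True) auto
        then show ?thesis using g0 by linarith
      next
        case True
        then obtain w where w: "w \<in> ?B" "?M / 2 \<le> mass (Suc k) w" by auto
        then have wX: "w \<in> X" by (auto simp: block_def)
        have sub: "block (Suc k) w \<subseteq> ?B"
          using block_Suc[OF wX, of k] block_eq[OF w(1)] by auto
        have ls: "0 < l (Suc k) powr s" "0 < l k powr s" using l_pos[of k] l_pos[of "Suc k"] by simp_all
        have "(l j powr s)\<^sup>2 = l j powr (2 * s)" for j
          using powr_add[of "l j" s s] by (simp add: power2_eq_square)
        then have "16 * (l (Suc k) powr s)\<^sup>2 \<le> (l k powr s)\<^sup>2"
          using l_small[OF k] by simp
        then have "2 / (l k powr s)\<^sup>2 \<le> 1 / 8 / (l (Suc k) powr s)\<^sup>2"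
          using ls by (simp add: field_simps)
        then have "?M ^ 3 * (2 / (l k powr s)\<^sup>2) \<le> ?M ^ 3 * (1 / 8 / (l (Suc k) powr s)\<^sup>2)"
          using mass_nonneg by (intro mult_left_mono) auto
        also have "\<dots> = (?M / 2) ^ 3 / (l (Suc k) powr s)\<^sup>2" by (simp add: power_divide)
        also have "\<dots> \<le> (mass (Suc k) w) ^ 3 / (l (Suc k) powr s)\<^sup>2"
          using w mass_nonneg[of k z] by (intro divide_right_mono power_mono) auto
        also have "\<dots> = mass (Suc k) w * (density (Suc k) w)\<^sup>2"
          by (simp add: density_def power2_eq_square power3_eq_cube)
        also have "\<dots> = (\<Sum>x\<in>block (Suc k) w. m x * (density (Suc k) x)\<^sup>2)"
          by (simp add: sum_density_block)
        also have "\<dots> \<le> ?e"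
          using sub finite_block m_nonneg by (intro sum_mono2) auto
        finally have "?M ^ 3 * (2 / (l k powr s)\<^sup>2) \<le> ?e" .
        moreover have "?M ^ 3 * (2 / (l k powr s)\<^sup>2) = 2 * (?M * (density k z)\<^sup>2)"
          by (simp add: density_def power2_eq_square power3_eq_cube)
        ultimately have "2 * (?M * (density k z)\<^sup>2) \<le> ?e"
          by simp
        then show ?thesis using g0 by linarith
      qed
    qed
    then show "(\<Sum>x\<in>?B. m x * (density k x)\<^sup>2)
      \<le> (\<Sum>x\<in>?B. 2304 * (m x * (norm (G k x))\<^sup>2) + 1/2 * (m x * (density (Suc k) x)\<^sup>2))"
      unfolding sum_density_block by (simp add: sum.distrib sum_distrib_left)
  qed
  then show ?thesis by (simp add: energy_def sqnorm_def sum.distrib sum_distrib_left)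
qed

end

section \<open>Summation over the generations\<close>

lemma sum_half_powers_le: "(\<Sum>i<n. (1/2::real) ^ i) \<le> 2"
  by (simp add: sum_gp_strict)

lemma sum_half_powers_below: "(\<Sum>k<j. (1/2::real) ^ (j - Suc k)) \<le> 2"
  using sum_half_powers_le[of j] sum.nat_diff_reindex[of "\<lambda>i. (1/2::real) ^ i" j] by simp

lemma sum_half_powers_above: "(\<Sum>j\<in>{k<..<n}. (1/2::real) ^ (j - Suc k)) \<le> 2"
proof -
  have "{k<..<n} = {Suc k..<n}" by auto
  then have "(\<Sum>j\<in>{k<..<n}. (1/2::real) ^ (j - Suc k)) = (\<Sum>i<n - Suc k. (1/2) ^ i)"
    by (simp add: sum.atLeastLessThan_shift_0[of _ "Suc k"] atLeast0LessThan del: power_one_over)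
  then show ?thesis using sum_half_powers_le[of "n - Suc k"] by simp
qed

context separated_tree
begin

text \<open>The error at \<open>x\<close>, at the size \<open>l N\<close> of the leaves, of
  replacing a measure by point masses; it is the quantity \<open>D\<close> of
  \<open>discretize_riesz\<close>.\<close>

definition slope_sum :: "'x \<Rightarrow> real" where
  "slope_sum x = l N * (\<Sum>y\<in>X - {x}. m y * norm (c y - c x) powr (- s - 1))"

definition total_energy :: real where
  "total_energy = (\<Sum>k\<le>N. energy k)"

lemma slope_sum_nonneg: "0 \<le> slope_sum x"
  unfolding slope_sum_def using m_nonneg l_pos[of N] by (intro mult_nonneg_nonneg sum_nonneg) auto

lemma shifted_energy_sum: "(\<Sum>k<N. energy (Suc k)) \<le> total_energy"
  unfolding total_energy_def lessThan_Suc_atMost[symmetric]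
  by (subst sum.lessThan_Suc_shift) (simp add: energy_nonneg)

text \<open>Generation k enters with weight \<open>l N / l (Suc k)\<close>, which is at most a power
  of 1/2, so Cauchy-Schwarz with geometric weights costs a factor 2. The other 2 is that of
  \<open>slope_L2\<close>.\<close>

lemma slope_sum_L2: "(\<Sum>x\<in>X. m x * (slope_sum x)\<^sup>2) \<le> 4 * \<omega>\<^sup>2 * total_energy"
proof -
  define a where "a k x = l (Suc k) * slope k x" for k x
  define q where "q k = (1/2::real) ^ (N - Suc k)" for k
  have a0: "0 \<le> a k x" for k x
    unfolding a_def using slope_nonneg l_pos[of "Suc k"] by simp
  have q0: "0 \<le> q k" "q k \<le> 1" for k by (auto simp: q_def power_le_one)
  have pt: "(slope_sum x)\<^sup>2 \<le> 2 * (\<Sum>k<N. (a k x)\<^sup>2)" if x: "x \<in> X" for x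
  proof -
    have "slope_sum x = (\<Sum>k<N. l N * slope k x)"
      unfolding slope_sum_def sum_sib[OF x] slope_def by (simp add: sum_distrib_left)
    also have "\<dots> \<le> (\<Sum>k<N. q k * a k x)"
    proof (rule sum_mono)
      fix k assume "k \<in> {..<N}"
      then have "l N \<le> l (Suc k) * q k" unfolding q_def by (intro l_antimono) auto
      then show "l N * slope k x \<le> q k * a k x"
        unfolding a_def using mult_right_mono[OF _ slope_nonneg] by (fastforce simp: mult_ac)
    qed
    also have "\<dots> = (\<Sum>k<N. sqrt (q k) * (sqrt (q k) * a k x))"
      using q0 by (simp flip: mult.assoc)
    finally have "slope_sum x \<le> (\<Sum>k<N. sqrt (q k) * (sqrt (q k) * a k x))" .
    then have "(slope_sum x)\<^sup>2 \<le> (\<Sum>k<N. sqrt (q k) * (sqrt (q k) * a k x))\<^sup>2"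
      using slope_sum_nonneg by (intro power_mono)
    also have "\<dots> \<le> (\<Sum>k<N. (sqrt (q k))\<^sup>2) * (\<Sum>k<N. (sqrt (q k) * a k x)\<^sup>2)"
      by (rule Cauchy_Schwarz_ineq_sum)
    also have "\<dots> = (\<Sum>k<N. q k) * (\<Sum>k<N. q k * (a k x)\<^sup>2)"
      using q0 by (simp add: power_mult_distrib)
    also have "\<dots> \<le> 2 * (\<Sum>k<N. 1 * (a k x)\<^sup>2)"
      unfolding q_def using q0(2)
      by (intro mult_mono sum_half_powers_below sum_mono mult_right_mono sum_nonneg) (auto simp: power_le_one)
    finally show ?thesis by simp
  qed
  have "(\<Sum>x\<in>X. m x * (slope_sum x)\<^sup>2) \<le> (\<Sum>x\<in>X. m x * (2 * (\<Sum>k<N. (a k x)\<^sup>2)))"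
    using pt m_nonneg by (intro sum_mono mult_left_mono) auto
  also have "\<dots> = (\<Sum>x\<in>X. \<Sum>k<N. 2 * (m x * (a k x)\<^sup>2))"
    by (simp add: sum_distrib_left mult_ac)
  also have "\<dots> = (\<Sum>k<N. \<Sum>x\<in>X. 2 * (m x * (a k x)\<^sup>2))" by (rule sum.swap)
  also have "\<dots> \<le> (\<Sum>k<N. 4 * \<omega>\<^sup>2 * energy (Suc k))"
  proof (rule sum_mono)
    fix k assume "k \<in> {..<N}"
    then show "(\<Sum>x\<in>X. 2 * (m x * (a k x)\<^sup>2)) \<le> 4 * \<omega>\<^sup>2 * energy (Suc k)"
      using slope_L2[of k] unfolding a_def by (simp flip: sum_distrib_left)
  qed
  also have "\<dots> = 4 * \<omega>\<^sup>2 * (\<Sum>k<N. energy (Suc k))" by (simp add: sum_distrib_left)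
  also have "\<dots> \<le> 4 * \<omega>\<^sup>2 * total_energy"
    using shifted_energy_sum by (intro mult_left_mono) auto
  finally show ?thesis .
qed

text \<open>The arithmetic-geometric inequality is balanced by \<open>\<omega>\<close>: as
  \<open>slope_L2\<close> supplies the square of \<open>\<omega>\<close>, both resulting terms carry
  one factor \<open>\<omega>\<close>.\<close>

lemma cross_term_energy:
  assumes k: "k < j" "j < N" and \<omega>: "0 < \<omega>"
  shows "2 * \<bar>\<Sum>x\<in>X. m x * (G k x \<bullet> G j x)\<bar>
    \<le> (1/2) ^ (j - Suc k) * (lip_const s * \<omega> * (2 * energy (Suc k) + sqnorm j))"
proof -
  let ?q = "(1/2::real) ^ (j - Suc k)" and ?K = "lip_const s"
  have K0: "0 \<le> ?K" using lip_const_ge_1[OF s_pos] by linarith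
  have lj: "l j \<le> l (Suc k) * ?q" using k by (intro l_antimono) auto
  have t0: "0 \<le> (\<Sum>x\<in>X. m x * slope k x * norm (G j x))"
    using m_nonneg slope_nonneg by (intro sum_nonneg) auto
  have "\<bar>\<Sum>x\<in>X. m x * (G k x \<bullet> G j x)\<bar> \<le> ?K * l j * (\<Sum>x\<in>X. m x * slope k x * norm (G j x))"
    by (rule cross_term[OF k])
  also have "\<dots> \<le> ?K * (l (Suc k) * ?q) * (\<Sum>x\<in>X. m x * slope k x * norm (G j x))"
    using lj K0 t0 by (intro mult_right_mono mult_left_mono)
  also have "\<dots> = ?q * ?K * (\<Sum>x\<in>X. m x * ((l (Suc k) * slope k x) * norm (G j x)))"
    by (simp add: sum_distrib_left mult_ac)
  finally have 1: "2 * \<bar>\<Sum>x\<in>X. m x * (G k x \<bullet> G j x)\<bar>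
      \<le> ?q * ?K * (2 * (\<Sum>x\<in>X. m x * ((l (Suc k) * slope k x) * norm (G j x))))" by linarith
  have "2 * (\<Sum>x\<in>X. m x * ((l (Suc k) * slope k x) * norm (G j x)))
      \<le> (\<Sum>x\<in>X. m x * ((l (Suc k) * slope k x)\<^sup>2 / \<omega> + \<omega> * (norm (G j x))\<^sup>2))"
    unfolding sum_distrib_left
  proof (rule sum_mono)
    fix x
    let ?a = "l (Suc k) * slope k x" and ?b = "norm (G j x)"
    have "0 \<le> (?a - \<omega> * ?b)\<^sup>2 / \<omega>" using \<omega> by simp
    also have "\<dots> = ?a\<^sup>2 / \<omega> + \<omega> * ?b\<^sup>2 - 2 * (?a * ?b)"
      using \<omega> by (simp add: power2_eq_square field_simps)
    finally have "2 * (?a * ?b) \<le> ?a\<^sup>2 / \<omega> + \<omega> * ?b\<^sup>2" by linarith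
    from mult_left_mono[OF this m_nonneg[of x]]
    show "2 * (m x * (?a * ?b)) \<le> m x * (?a\<^sup>2 / \<omega> + \<omega> * ?b\<^sup>2)" by simp
  qed
  also have "\<dots> = (\<Sum>x\<in>X. m x * (l (Suc k) * slope k x)\<^sup>2) / \<omega> + \<omega> * sqnorm j"
    by (simp add: sqnorm_def distrib_left sum.distrib sum_divide_distrib sum_distrib_left mult_ac)
  also have "\<dots> \<le> (2 * \<omega>\<^sup>2 * energy (Suc k)) / \<omega> + \<omega> * sqnorm j"
    using slope_L2[of k] k \<omega> by (intro add_right_mono divide_right_mono) auto
  also have "\<dots> = \<omega> * (2 * energy (Suc k) + sqnorm j)"
    using \<omega> by (simp add: power2_eq_square algebra_simps)
  finally have 2: "2 * (\<Sum>x\<in>X. m x * ((l (Suc k) * slope k x) * norm (G j x)))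
     \<le> \<omega> * (2 * energy (Suc k) + sqnorm j)" .
  have "0 \<le> ?q * ?K" using K0 by simp
  from order_trans[OF 1 mult_left_mono[OF 2 this]] show ?thesis
    by (simp only: mult.assoc)
qed

text \<open>The diagonal of the expanded square is \<open>g\<close>. Off the diagonal, the weights
  (1/2)^(j-k-1) are summable both in j and in k.\<close>

lemma transform_L2_lower:
  assumes \<omega>: "0 < \<omega>"
  defines "g \<equiv> \<Sum>j<N. sqnorm j"
  shows "g - lip_const s * \<omega> * (4 * total_energy + 2 * g)
    \<le> (\<Sum>x\<in>X. m x * (norm (\<Sum>k<N. G k x))\<^sup>2)"
proof -
  let ?K = "lip_const s"
  define I where "I k j = (\<Sum>x\<in>X. m x * (G k x \<bullet> G j x))" for k j
  define q where "q k j = (1/2::real) ^ (j - Suc k)" for k j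
  have K0: "0 \<le> ?K" using lip_const_ge_1[OF s_pos] by linarith
  have Isym: "I k j = I j k" for k j by (simp add: I_def inner_commute)
  have Idiag: "I j j = sqnorm j" for j by (simp add: I_def sqnorm_def power2_norm_eq_inner)
  have square: "(\<Sum>j<n. \<Sum>k<n. I k j) = (\<Sum>j<n. sqnorm j) + (\<Sum>j<n. \<Sum>k<j. 2 * I k j)" for n
  proof (induction n)
    case (Suc n)
    have "(\<Sum>j<Suc n. \<Sum>k<Suc n. I k j) = (\<Sum>j<n. \<Sum>k<n. I k j) + (\<Sum>j<n. I n j) + (\<Sum>k<n. I k n) + I n n"
      by (simp add: sum.distrib)
    then show ?case using Suc Isym by (simp add: Idiag sum_distrib_left[symmetric])
  qed simp
  have "(\<Sum>x\<in>X. m x * (norm (\<Sum>k<N. G k x))\<^sup>2) = (\<Sum>x\<in>X. \<Sum>j<N. \<Sum>k<N. m x * (G k x \<bullet> G j x))"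
    by (simp add: power2_norm_eq_inner inner_sum_left inner_sum_right sum_distrib_left)
  also have "\<dots> = (\<Sum>j<N. \<Sum>x\<in>X. \<Sum>k<N. m x * (G k x \<bullet> G j x))" by (rule sum.swap)
  also have "\<dots> = (\<Sum>j<N. \<Sum>k<N. I k j)"
    unfolding I_def by (intro sum.cong refl sum.swap)
  finally have eq: "(\<Sum>x\<in>X. m x * (norm (\<Sum>k<N. G k x))\<^sup>2) = g + (\<Sum>j<N. \<Sum>k<j. 2 * I k j)"
    unfolding square g_def .
  have "\<bar>\<Sum>j<N. \<Sum>k<j. 2 * I k j\<bar> \<le> (\<Sum>j<N. \<Sum>k<j. 2 * \<bar>I k j\<bar>)"
    by (intro order_trans[OF sum_abs] sum_mono) (simp add: abs_mult)
  also have "\<dots> \<le> (\<Sum>j<N. \<Sum>k<j. q k j * (?K * \<omega> * (2 * energy (Suc k) + sqnorm j)))"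
    unfolding I_def q_def by (intro sum_mono cross_term_energy \<omega>) auto
  also have "\<dots> = ?K * \<omega> * (2 * (\<Sum>j<N. \<Sum>k<j. q k j * energy (Suc k)) + (\<Sum>j<N. \<Sum>k<j. q k j * sqnorm j))"
    by (simp add: sum_distrib_left sum.distrib algebra_simps)
  also have "\<dots> \<le> ?K * \<omega> * (2 * (2 * total_energy) + 2 * g)"
  proof (intro mult_left_mono add_mono)
    have "(\<Sum>j<N. \<Sum>k<j. q k j * energy (Suc k)) = (\<Sum>k<N. \<Sum>j\<in>{k<..<N}. q k j * energy (Suc k))"
      by (subst sum.Sigma, simp, simp, subst sum.Sigma, simp, simp,
          rule sum.reindex_bij_witness[of _ "\<lambda>(a, b). (b, a)" "\<lambda>(a, b). (b, a)"]) auto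
    also have "\<dots> = (\<Sum>k<N. (\<Sum>j\<in>{k<..<N}. q k j) * energy (Suc k))" by (simp add: sum_distrib_right)
    also have "\<dots> \<le> (\<Sum>k<N. 2 * energy (Suc k))"
      unfolding q_def using energy_nonneg by (intro sum_mono mult_right_mono sum_half_powers_above)
    also have "\<dots> \<le> 2 * total_energy" using shifted_energy_sum by (simp flip: sum_distrib_left)
    finally show "(\<Sum>j<N. \<Sum>k<j. q k j * energy (Suc k)) \<le> 2 * total_energy" .
    have "(\<Sum>j<N. \<Sum>k<j. q k j * sqnorm j) = (\<Sum>j<N. (\<Sum>k<j. q k j) * sqnorm j)" by (simp add: sum_distrib_right)
    also have "\<dots> \<le> (\<Sum>j<N. 2 * sqnorm j)"
      unfolding q_def using sqnorm_nonneg by (intro sum_mono mult_right_mono sum_half_powers_below)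
    also have "\<dots> = 2 * g" by (simp add: g_def sum_distrib_left)
    finally show "(\<Sum>j<N. \<Sum>k<j. q k j * sqnorm j) \<le> 2 * g" .
  qed (use K0 \<omega> in auto)
  finally have "\<bar>\<Sum>j<N. \<Sum>k<j. 2 * I k j\<bar> \<le> ?K * \<omega> * (4 * total_energy + 2 * g)" by simp
  then show ?thesis unfolding eq by linarith
qed

text \<open>Half of the total is absorbed on the left. The leaves have no \<open>G\<close> below
  them, so \<open>energy N\<close> remains and has to come from a density bound.\<close>

lemma total_energy_le:
  "total_energy \<le> 4608 * (\<Sum>j<N. sqnorm j) + 2 * energy N"
proof -
  have "total_energy = (\<Sum>k<N. energy k) + energy N"
    by (simp add: total_energy_def lessThan_Suc_atMost[symmetric])
  also have "\<dots> \<le> (\<Sum>k<N. 2304 * sqnorm k + 1/2 * energy (Suc k)) + energy N"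
    by (intro add_right_mono sum_mono level_lower_bound) auto
  also have "\<dots> = 2304 * (\<Sum>k<N. sqnorm k) + 1/2 * (\<Sum>k<N. energy (Suc k)) + energy N"
    by (simp only: sum.distrib sum_distrib_left)
  also have "\<dots> \<le> 2304 * (\<Sum>k<N. sqnorm k) + 1/2 * total_energy + energy N"
    using shifted_energy_sum by simp
  finally show ?thesis by linarith
qed

text \<open>The constant is \<open>18436 = 2 * (2 * 4608) + 2 * 2\<close>.\<close>

lemma total_energy_bound:
  assumes \<omega>: "0 < \<omega>" "\<omega> \<le> 1" "lip_const s * \<omega> \<le> 1/4"
    and small: "(4 * (18436 * A\<^sup>2) + 36864 * lip_const s) * \<omega> \<le> 1/2"
    and R: "\<And>x. x \<in> X \<Longrightarrow> norm (\<Sum>y\<in>X - {x}. m y *\<^sub>R riesz_kernel s (c y - c x)) \<le> A * (1 + slope_sum x)"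
    and dens: "\<And>x. x \<in> X \<Longrightarrow> density N x \<le> A * (1 + slope_sum x)"
  shows "total_energy \<le> 36872 * A\<^sup>2 * sum m X"
proof -
  define S where "S = total_energy"
  define K where "K = lip_const s"
  define g where "g = (\<Sum>j<N. sqnorm j)"
  define T where "T = (\<Sum>x\<in>X. m x * (norm (\<Sum>k<N. G k x))\<^sup>2)"
  have S0: "0 \<le> S" unfolding S_def total_energy_def by (intro sum_nonneg energy_nonneg)
  have g0: "0 \<le> g" unfolding g_def by (intro sum_nonneg sqnorm_nonneg)
  have K1: "1 \<le> K" using lip_const_ge_1[OF s_pos] by (simp add: K_def)
  have \<omega>2: "\<omega>\<^sup>2 * S \<le> \<omega> * S"
    using \<omega> S0 by (intro mult_right_mono) (auto simp: power2_eq_square mult_left_le)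
  \<comment> \<open>Used twice: for the full transform and for the density of the leaves.\<close>
  have sq: "(\<Sum>x\<in>X. m x * (f x)\<^sup>2) \<le> 2 * A\<^sup>2 * (sum m X + 4 * (\<omega> * S))"
    if "\<And>x. x \<in> X \<Longrightarrow> 0 \<le> f x \<and> f x \<le> A * (1 + slope_sum x)" for f
  proof -
    have "(\<Sum>x\<in>X. m x * (f x)\<^sup>2) \<le> (\<Sum>x\<in>X. m x * (2 * A\<^sup>2 * (1 + (slope_sum x)\<^sup>2)))"
    proof (intro sum_mono mult_left_mono m_nonneg)
      fix x assume "x \<in> X"
      then have "(f x)\<^sup>2 \<le> (A * (1 + slope_sum x))\<^sup>2" using that by (intro power_mono) auto
      also have "\<dots> = A\<^sup>2 * (1 + slope_sum x)\<^sup>2" by (simp add: power_mult_distrib)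
      also have "\<dots> \<le> A\<^sup>2 * (2 * (1 + (slope_sum x)\<^sup>2))"
        using zero_le_power2[of "1 - slope_sum x"]
        by (intro mult_left_mono) (simp_all add: power2_eq_square algebra_simps)
      finally show "(f x)\<^sup>2 \<le> 2 * A\<^sup>2 * (1 + (slope_sum x)\<^sup>2)" by (simp add: algebra_simps)
    qed
    also have "\<dots> = 2 * A\<^sup>2 * (sum m X + (\<Sum>x\<in>X. m x * (slope_sum x)\<^sup>2))"
      by (simp add: sum.distrib sum_distrib_left sum_distrib_right algebra_simps)
    also have "\<dots> \<le> 2 * A\<^sup>2 * (sum m X + 4 * \<omega>\<^sup>2 * S)"
      using slope_sum_L2 by (intro mult_left_mono) (auto simp: S_def)
    also have "\<dots> \<le> 2 * A\<^sup>2 * (sum m X + 4 * (\<omega> * S))"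
      using \<omega>2 by (intro mult_left_mono) auto
    finally show ?thesis .
  qed
  have T: "T \<le> 2 * A\<^sup>2 * (sum m X + 4 * (\<omega> * S))"
    unfolding T_def using R by (intro sq) (auto simp: G_def sum_sib[symmetric])
  have EN: "energy N \<le> 2 * A\<^sup>2 * (sum m X + 4 * (\<omega> * S))"
    unfolding energy_def using dens density_nonneg by (intro sq) auto
  have "g - K * \<omega> * (4 * S + 2 * g) \<le> T"
    unfolding g_def K_def S_def T_def by (rule transform_L2_lower[OF \<omega>(1)])
  moreover have "(K * \<omega>) * g \<le> 1/4 * g" using \<omega> g0 by (intro mult_right_mono) (auto simp: K_def)
  \<comment> \<open>Here 2 K \<open>\<omega>\<close> g <= g/2 has been absorbed. The later 36864 is
    8 * 4608.\<close>
  ultimately have "g \<le> 2 * T + 8 * K * (\<omega> * S)" by (simp add: algebra_simps)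
  moreover have "S \<le> 4608 * g + 2 * energy N" unfolding S_def g_def by (rule total_energy_le)
  ultimately have "S \<le> 18436 * A\<^sup>2 * (sum m X + 4 * (\<omega> * S)) + 36864 * K * (\<omega> * S)"
    using T EN by argo
  also have "\<dots> = 18436 * A\<^sup>2 * sum m X + ((4 * (18436 * A\<^sup>2) + 36864 * K) * \<omega>) * S"
    by (simp add: algebra_simps)
  \<comment> \<open>The assumption \<open>small\<close> is made for this absorption of
    \<open>S\<close>, which doubles the constant to 36872.\<close>
  also have "\<dots> \<le> 18436 * A\<^sup>2 * sum m X + 1/2 * S"
    using small S0 by (intro add_left_mono mult_right_mono) (auto simp: K_def)
  finally show ?thesis by (simp add: S_def)
qed

lemma energy_ge_power_mean:
  assumes "X \<noteq> {}"
  shows "(sum m X) ^ 3 / (real (card (pre k ` X)) * l k powr s)\<^sup>2 \<le> energy k"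
proof -
  define n where "n = real (card (pre k ` X))"
  define t where "t b = sum m {x\<in>X. pre k x = b}" for b
  define a where "a = sum m X / n"
  have n: "0 < n" using assms fin by (simp add: n_def card_gt_0_iff)
  have t0: "0 \<le> t b" for b unfolding t_def by (intro sum_nonneg m_nonneg)
  have a0: "0 \<le> a" unfolding a_def using n m_nonneg by (intro divide_nonneg_nonneg sum_nonneg) auto
  have tot: "sum m X = (\<Sum>b\<in>pre k ` X. t b)" unfolding t_def by (rule sum_blocks)
  have "(sum m X) ^ 3 / n\<^sup>2 = (\<Sum>b\<in>pre k ` X. 3 * a\<^sup>2 * t b - 2 * a ^ 3)"
    using n unfolding sum_subtractf
    by (simp add: flip: sum_distrib_left tot n_def) (simp add: a_def power3_eq_cube power2_eq_square field_simps)
  also have "\<dots> \<le> (\<Sum>b\<in>pre k ` X. t b ^ 3)"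
  proof (rule sum_mono)
    fix b
    \<comment> \<open>The tangent to the cube function at the average \<open>a\<close>; summed over
      the cubes it gives the power mean inequality.\<close>
    have "0 \<le> (t b - a)\<^sup>2 * (t b + 2 * a)" using t0 a0 by simp
    then show "3 * a\<^sup>2 * t b - 2 * a ^ 3 \<le> t b ^ 3"
      by (simp add: power2_eq_square power3_eq_cube algebra_simps)
  qed
  finally have 1: "(sum m X) ^ 3 / n\<^sup>2 \<le> (\<Sum>b\<in>pre k ` X. t b ^ 3)" .
  have "energy k = (\<Sum>b\<in>pre k ` X. t b ^ 3 / (l k powr s)\<^sup>2)"
    unfolding energy_def sum_blocks[of _ k]
  proof (rule sum.cong)
    fix b assume "b \<in> pre k ` X"
    then obtain z where z: "z \<in> X" "b = pre k z" by auto
    have "{x\<in>X. pre k x = b} = block k z" using z by (auto simp: block_def)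
    moreover have "t b = mass k z" using z by (simp add: t_def mass_def block_def)
    ultimately show "(\<Sum>x\<in>{x\<in>X. pre k x = b}. m x * (density k x)\<^sup>2) = t b ^ 3 / (l k powr s)\<^sup>2"
      unfolding sum_density_block[of k z, symmetric] using sum_density_block[of k z]
      by (simp add: density_def power_divide power2_eq_square[of "mass k z"] power3_eq_cube mult.assoc)
  qed simp
  also have "\<dots> = (\<Sum>b\<in>pre k ` X. t b ^ 3) / (l k powr s)\<^sup>2" by (simp add: sum_divide_distrib)
  also have "\<dots> \<ge> ((sum m X) ^ 3 / n\<^sup>2) / (l k powr s)\<^sup>2"
    using 1 by (intro divide_right_mono) auto
  finally show ?thesis by (simp add: n_def power_mult_distrib)
qed

text \<open>The energy is at least cubic and at most linear in the total mass; one factor of the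
  mass cancels.\<close>

theorem mass_bound:
  assumes \<omega>: "0 < \<omega>" "\<omega> \<le> 1" "lip_const s * \<omega> \<le> 1/4"
    and small: "(4 * (18436 * A\<^sup>2) + 36864 * lip_const s) * \<omega> \<le> 1/2"
    and R: "\<And>x. x \<in> X \<Longrightarrow> norm (\<Sum>y\<in>X - {x}. m y *\<^sub>R riesz_kernel s (c y - c x)) \<le> A * (1 + slope_sum x)"
    and dens: "\<And>x. x \<in> X \<Longrightarrow> density N x \<le> A * (1 + slope_sum x)"
  shows "(sum m X)\<^sup>2 * (\<Sum>k\<le>N. 1 / (real (card (pre k ` X)) * l k powr s)\<^sup>2) \<le> 36872 * A\<^sup>2"
proof (cases "sum m X = 0")
  case False
  then have pos: "0 < sum m X" using m_nonneg sum_nonneg[of X m] by (simp add: less_le)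
  then have ne: "X \<noteq> {}" by auto
  define M where "M = sum m X"
  have "M * M\<^sup>2 = M ^ 3" by (simp add: power2_eq_square power3_eq_cube)
  then have "(sum m X) * ((sum m X)\<^sup>2 * (\<Sum>k\<le>N. 1 / (real (card (pre k ` X)) * l k powr s)\<^sup>2))
    = (\<Sum>k\<le>N. (sum m X) ^ 3 / (real (card (pre k ` X)) * l k powr s)\<^sup>2)"
    unfolding M_def[symmetric] by (simp add: sum_distrib_left)
  also have "\<dots> \<le> total_energy"
    unfolding total_energy_def by (intro sum_mono energy_ge_power_mean ne)
  also have "\<dots> \<le> (sum m X) * (36872 * A\<^sup>2)"
    using total_energy_bound[OF assms] by (simp add: mult_ac)
  finally show ?thesis using pos by (simp only: mult_le_cancel_left_pos)
qed simp

end

subsection \<open>From measures to point masses\<close>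

lemma norm_set_integral_diff_le:
  fixes f :: "'b \<Rightarrow> 'a::{banach, second_countable_topology}"
  assumes "finite_measure M" and A: "A \<in> sets M" and f: "set_integrable M A f"
    and B: "\<And>w. w \<in> A \<Longrightarrow> norm (f w - v) \<le> B"
  shows "norm ((LINT w:A|M. f w) - measure M A *\<^sub>R v) \<le> measure M A * B"
proof -
  interpret finite_measure M by fact
  have cst: "set_integrable M A (\<lambda>_. a)" for a :: "'c::{banach, second_countable_topology}"
    using A unfolding set_integrable_def by (intro integrable_scaleR_left) (simp add: emeasure_eq_measure)
  have "(LINT w:A|M. f w) - measure M A *\<^sub>R v = (LINT w:A|M. f w - v)"
  proof -
    have "(LINT w:A|M. v) = measure M A *\<^sub>R v"
      using A integral_scaleR_left[of v M "indicat_real A"]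
      by (simp add: set_lebesgue_integral_def emeasure_eq_measure)
    then show ?thesis using set_integral_diff(2)[OF f cst[of v]] by simp
  qed
  also have "norm \<dots> \<le> (LINT w:A|M. norm (f w - v))"
    by (rule set_integral_norm_bound) (intro set_integral_diff f cst)
  also have "\<dots> \<le> (LINT w:A|M. B)"
    using B by (intro set_integral_mono set_integrable_norm set_integral_diff f cst) auto
  also have "\<dots> = measure M A * B"
    using A by (simp add: set_lebesgue_integral_def)
  finally show ?thesis .
qed

lemma riesz_kernel_measurable [measurable]:
  "(\<lambda>y::'a::euclidean_space. riesz_kernel s (y - z)) \<in> borel_measurable borel"
  unfolding riesz_kernel_def by measurable

lemma AE_lebesgue_ball_point:
  fixes z :: "'a::euclidean_space"
  assumes "AE x in lebesgue. P x" and "0 < r"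
  obtains x where "x \<in> ball z r" "P x"
proof -
  have "\<exists>x\<in>ball z r. P x"
  proof (rule ccontr)
    assume no: "\<not> ?thesis"
    obtain N where N: "{x \<in> space lebesgue. \<not> P x} \<subseteq> N" "N \<in> null_sets lebesgue"
      using assms(1) by (auto elim: AE_E3 simp: eventually_ae_filter)
    then have "ball z r \<subseteq> N" using no by auto
    then have "negligible (ball z r)"
      using N(2) negligible_iff_null_sets negligible_subset by blast
    then show False using open_not_negligible[of "ball z r"] \<open>0 < r\<close> by auto
  qed
  then show thesis using that by auto
qed

lemma radon_measures_on_finite:
  assumes \<nu>: "\<nu> \<in> radon_measures_on E" and E: "compact (E :: 'a::euclidean_space set)"
  shows "finite_measure \<nu>" "sets \<nu> = sets borel" "space \<nu> = UNIV" "AE y in \<nu>. y \<in> E"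
proof -
  show s: "sets \<nu> = sets borel" using \<nu> by (simp add: radon_measures_on_def)
  show sp: "space \<nu> = UNIV" using sets_eq_imp_space_eq[OF s] by simp
  have mE: "E \<in> sets \<nu>" "- E \<in> sets \<nu>" using E s by (auto simp: borel_compact borel_closed compact_imp_closed)
  have 0: "emeasure \<nu> (- E) = 0" and f: "emeasure \<nu> E < \<infinity>" using \<nu> E by (auto simp: radon_measures_on_def)
  have "emeasure \<nu> UNIV \<le> emeasure \<nu> E + emeasure \<nu> (- E)"
    using mE emeasure_subadditive[of E \<nu> "- E"] by (simp add: Compl_partition)
  then show "finite_measure \<nu>" using 0 f sp by (intro finite_measureI) (auto simp: top_unique)
  show "AE y in \<nu>. y \<in> E"
    by (rule AE_I[of _ _ "- E"]) (use 0 mE in auto)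
qed

lemma kernel_integrable:
  fixes E :: "'a::euclidean_space set"
  assumes \<nu>: "\<nu> \<in> radon_measures_on E" and E: "compact E"
    and \<delta>: "0 < \<delta>" "\<And>y. y \<in> E \<Longrightarrow> \<delta> \<le> norm (y - z)" and s: "0 < s"
  shows "integrable \<nu> (\<lambda>y. riesz_kernel s (y - z))"
proof -
  note R = radon_measures_on_finite[OF \<nu> E]
  interpret finite_measure \<nu> by (rule R)
  show ?thesis
  proof (rule integrable_const_bound[of _ "\<delta> powr (- s)"])
    show "AE y in \<nu>. norm (riesz_kernel s (y - z)) \<le> \<delta> powr - s"
      using R(4)
    proof eventually_elim
      case (elim y)
      then have "\<delta> \<le> norm (y - z)" by (rule \<delta>)
      moreover from this have "y - z \<noteq> 0" using \<delta>(1) by auto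
      ultimately show ?case using \<delta>(1) s by (auto simp: norm_riesz_kernel intro!: powr_mono2')
    qed
    show "(\<lambda>y. riesz_kernel s (y - z)) \<in> borel_measurable \<nu>"
      using R(2) by (simp cong: measurable_cong_sets)
  qed
qed

text \<open>The truncated integrals do not change once \<open>\<epsilon>\<close> is below the
  distance to the support.\<close>

lemma riesz_transform_off_support:
  fixes E :: "'a::euclidean_space set"
  assumes \<nu>: "\<nu> \<in> radon_measures_on E" and E: "compact E" and z: "z \<notin> E" and s: "0 < s"
  shows "riesz_transform s \<nu> z = (LINT y|\<nu>. riesz_kernel s (y - z))"
proof -
  note R = radon_measures_on_finite[OF \<nu> E]
  have "open (- E)" using E by (simp add: compact_imp_closed open_Compl)
  then obtain \<delta> where \<delta>: "0 < \<delta>" "ball z \<delta> \<subseteq> - E" using z open_contains_ball by blast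
  have far: "\<delta> \<le> norm (y - z)" if "y \<in> E" for y
    using \<delta> that by (force simp: dist_norm norm_minus_commute)
  have eq: "(LINT y:{y. norm (y - z) > \<epsilon>}|\<nu>. (1 / norm (y - z) powr (s + 1)) *\<^sub>R (y - z)) =
      (LINT y|\<nu>. riesz_kernel s (y - z))" if "\<epsilon> < \<delta>" for \<epsilon>
    unfolding set_lebesgue_integral_def riesz_kernel_def[symmetric]
  proof (rule integral_cong_AE)
    show "AE y in \<nu>. indicat_real {y. norm (y - z) > \<epsilon>} y *\<^sub>R riesz_kernel s (y - z) = riesz_kernel s (y - z)"
      using R(4)
    proof eventually_elim
      case (elim y)
      then show ?case using far[of y] that by (simp add: indicator_def)
    qed
    show "(\<lambda>y. riesz_kernel s (y - z)) \<in> borel_measurable \<nu>"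
      using R(2) by (simp cong: measurable_cong_sets)
    show "(\<lambda>y. indicat_real {y. norm (y - z) > \<epsilon>} y *\<^sub>R riesz_kernel s (y - z)) \<in> borel_measurable \<nu>"
      using R(2) by (simp cong: measurable_cong_sets)
  qed
  have "eventually (\<lambda>\<epsilon>. (LINT y:{y. norm (y - z) > \<epsilon>}|\<nu>. (1 / norm (y - z) powr (s + 1)) *\<^sub>R (y - z)) =
      (LINT y|\<nu>. riesz_kernel s (y - z))) (at_right 0)"
    using eventually_at_right_less[of 0] \<delta>(1) eq by (intro eventually_at_rightI[of 0 \<delta>]) auto
  then show ?thesis unfolding riesz_transform_def
    by (intro tendsto_Lim tendsto_eventually) auto
qed

text \<open>Off the compact support the transform is continuous, and a set of full Lebesgue measure
  is dense, so the essential bound holds at every such point.\<close>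

lemma kernel_integral_le_1:
  fixes E :: "'a::euclidean_space set"
  assumes \<nu>: "\<nu> \<in> radon_measures_on E" and E: "compact E" and z: "z \<notin> E" and s: "0 < s"
    and bd: "esssup lebesgue (\<lambda>x. ereal (norm (riesz_transform s \<nu> x))) \<le> 1"
  shows "norm (LINT y|\<nu>. riesz_kernel s (y - z)) \<le> 1"
proof -
  note R = radon_measures_on_finite[OF \<nu> E]
  interpret finite_measure \<nu> by (rule R)
  have "open (- E)" using E by (simp add: compact_imp_closed open_Compl)
  then obtain \<delta> where \<delta>: "0 < \<delta>" "ball z \<delta> \<subseteq> - E" using z open_contains_ball by blast
  have far: "\<delta> \<le> norm (y - z)" if "y \<in> E" for y
    using \<delta> that by (force simp: dist_norm norm_minus_commute)
  have ae: "AE x in lebesgue. norm (riesz_transform s \<nu> x) \<le> 1"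
    using esssup_AE[of "\<lambda>x. ereal (norm (riesz_transform s \<nu> x))" lebesgue]
    by eventually_elim (use bd order_trans in fastforce)
  let ?I = "\<lambda>z. LINT y|\<nu>. riesz_kernel s (y - z)"
  define C where "C = lip_const s * \<delta> powr (- s - 1) * measure \<nu> UNIV"
  have C0: "0 \<le> C" unfolding C_def using lip_const_ge_1[OF s] by simp
  show ?thesis
  proof (rule field_le_epsilon)
    fix e :: real assume e: "0 < e"
    \<comment> \<open>The first bound keeps \<open>x\<close> off \<open>E\<close> and within the
      range of the Lipschitz estimate, the second makes the change at most \<open>e\<close>; C + 1
      allows for C = 0.\<close>
    define r where "r = min (\<delta> / 2) (e / (C + 1))"
    have r: "0 < r" using \<delta> e C0 by (simp add: r_def)
    obtain x where x: "x \<in> ball z r" "norm (riesz_transform s \<nu> x) \<le> 1"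
      using AE_lebesgue_ball_point[OF ae r] by blast
    have zx: "norm (z - x) < \<delta> / 2" "norm (z - x) \<le> e / (C + 1)"
      using x by (auto simp: r_def dist_norm)
    have farx: "\<delta> / 2 \<le> norm (y - x)" if "y \<in> E" for y
      using far[OF that] zx norm_triangle_ineq[of "y - x" "x - z"] by (simp add: norm_minus_commute)
    have xE: "x \<notin> E" using farx[of x] \<delta> by auto
    have i1: "integrable \<nu> (\<lambda>y. riesz_kernel s (y - z))"
      using kernel_integrable[OF \<nu> E \<delta>(1) far s] .
    have i2: "integrable \<nu> (\<lambda>y. riesz_kernel s (y - x))"
      using kernel_integrable[OF \<nu> E _ farx s] \<delta>(1) by simp
    have "norm (?I z - ?I x)
       = norm (LINT y|\<nu>. riesz_kernel s (y - z) - riesz_kernel s (y - x))"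
      using i1 i2 by simp
    also have "\<dots> \<le> (LINT y|\<nu>. lip_const s * norm (z - x) * \<delta> powr (- s - 1))"
    proof (rule order_trans[OF integral_norm_bound integral_mono_AE])
      show "integrable \<nu> (\<lambda>y. norm (riesz_kernel s (y - z) - riesz_kernel s (y - x)))" using i1 i2 by simp
      show "AE y in \<nu>. norm (riesz_kernel s (y - z) - riesz_kernel s (y - x))
          \<le> lip_const s * norm (z - x) * \<delta> powr (- s - 1)"
        using R(4)
      proof eventually_elim
        case (elim y)
        have f: "\<delta> \<le> norm (y - z)" by (rule far[OF elim])
        then have nz: "y - z \<noteq> 0" using \<delta>(1) by auto
        have d: "(y - z) - (y - x) = x - z" by simp
        have "norm (riesz_kernel s (y - z) - riesz_kernel s (y - x))
          \<le> lip_const s * norm ((y - z) - (y - x)) * norm (y - z) powr (- s - 1)"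
          by (rule riesz_lip_const[OF s nz]) (use zx f in \<open>unfold d, simp add: norm_minus_commute\<close>)
        also have "\<dots> \<le> lip_const s * norm (z - x) * \<delta> powr (- s - 1)"
          unfolding d using f \<delta>(1) lip_const_ge_1[OF s] s
          by (intro mult_mono powr_mono2') (auto simp: norm_minus_commute)
        finally show ?case .
      qed
    qed auto
    also have "\<dots> = C * norm (z - x)" by (simp add: C_def R(3) mult_ac)
    also have "\<dots> \<le> C * (e / (C + 1))" using zx C0 by (intro mult_left_mono)
    also have "\<dots> \<le> e" using C0 e by (simp add: field_simps)
    finally have "norm (?I z - ?I x) \<le> e" .
    moreover have "norm (?I x) \<le> 1"
      using x riesz_transform_off_support[OF \<nu> E xE s] by simp
    ultimately show "norm (?I z) \<le> 1 + e"
      using norm_triangle_ineq2[of "?I z" "?I x"]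
      by linarith
  qed
qed

text \<open>Equal to 3 * \<open>lip_const s\<close> * 2^s / \<open>\<eta>\<close> with the
  \<open>\<eta>\<close> of \<open>discretize_riesz\<close>; 2^s comes from the distance
  \<open>\<rho> / 2\<close> between the evaluation points and the support.\<close>

definition transfer_const :: "real \<Rightarrow> real" where
  "transfer_const s = 3 * lip_const s * 2 powr s * (2 * (3/2) powr (s + 1))"

lemma transfer_const_pos: "0 < s \<Longrightarrow> 0 < transfer_const s"
  using lip_const_ge_1[of s] by (simp add: transfer_const_def)

lemma disjoint_cballs:
  fixes c :: "'x \<Rightarrow> 'a::real_normed_vector"
  assumes "\<And>x y. x \<in> X \<Longrightarrow> y \<in> X \<Longrightarrow> x \<noteq> y \<Longrightarrow> r < norm (c x - c y)"
  shows "disjoint_family_on (\<lambda>x. cball (c x) (r / 2)) X"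
  unfolding disjoint_family_on_def
proof safe
  fix x y w assume xy: "x \<in> X" "y \<in> X" "x \<noteq> y" and "w \<in> cball (c x) (r / 2)" "w \<in> cball (c y) (r / 2)"
  then have "norm (c x - w) \<le> r / 2" "norm (w - c y) \<le> r / 2"
    by (auto simp: dist_norm norm_minus_commute)
  then have "norm (c x - c y) \<le> r" using norm_triangle_ineq[of "c x - w" "w - c y"] by simp
  then show "w \<in> {}" using assms[OF xy] by simp
qed

text \<open>Off the support the transform is bounded by 1 at every point; it is evaluated at the points
  \<open>c x \<plusminus> \<rho> e\<close>, whose difference isolates the mass of the ball around \<open>c x\<close>.\<close>

lemma discretize_riesz:
  fixes c :: "'x \<Rightarrow> 'a::euclidean_space" and \<rho> s :: real
  assumes s: "0 < s" and X: "finite X" and \<rho>: "0 < \<rho>"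
    and sep: "\<And>x y. x \<in> X \<Longrightarrow> y \<in> X \<Longrightarrow> x \<noteq> y \<Longrightarrow> 4 * \<rho> \<le> norm (c x - c y)"
    and \<nu>: "\<nu> \<in> radon_measures_on E" and E: "E = (\<Union>x\<in>X. cball (c x) (\<rho> / 2))"
    and bd: "esssup lebesgue (\<lambda>x. ereal (norm (riesz_transform s \<nu> x))) \<le> 1"
  defines "m \<equiv> \<lambda>x. measure \<nu> (cball (c x) (\<rho> / 2))"
  defines "D \<equiv> \<lambda>x. \<rho> * (\<Sum>y\<in>X - {x}. m y * norm (c y - c x) powr (- s - 1))"
  shows "measure \<nu> UNIV = sum m X"
    and "x \<in> X \<Longrightarrow> norm (\<Sum>y\<in>X - {x}. m y *\<^sub>R riesz_kernel s (c y - c x)) \<le> transfer_const s * (1 + D x)"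
    and "x \<in> X \<Longrightarrow> m x / \<rho> powr s \<le> transfer_const s * (1 + D x)"
proof -
  let ?K = "riesz_kernel s"
  define B where "B x = cball (c x) (\<rho> / 2)" for x
  have cE: "compact E" unfolding E using X by (intro compact_UN) auto
  note R = radon_measures_on_finite[OF \<nu> cE]
  interpret finite_measure \<nu> by (rule R)
  have mB: "B x \<in> sets \<nu>" for x unfolding B_def R(2) by simp
  have disj: "disjoint_family_on B X"
    unfolding B_def by (rule disjoint_cballs) (use sep \<rho> in force)
  have "measure \<nu> UNIV = measure \<nu> E"
    by (rule measure_eq_AE) (use R(4) cE in \<open>auto simp: R(2) borel_compact\<close>)
  also have "\<dots> = sum m X"
    unfolding E m_def B_def[symmetric] using X mB disj
    by (intro finite_measure_finite_Union) auto
  finally show "measure \<nu> UNIV = sum m X" .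
  define CK where "CK = lip_const s"
  have CK1: "1 \<le> CK" unfolding CK_def by (rule lip_const_ge_1[OF s])
  define I where "I z = (LINT w|\<nu>. ?K (w - z))" for z
  define self where "self x z = (LINT w:B x|\<nu>. ?K (w - z))" for x z
  define Rd where "Rd x = (\<Sum>y\<in>X - {x}. m y *\<^sub>R ?K (c y - c x))" for x
  have m0: "0 \<le> m x" for x by (simp add: m_def)
  have D0: "0 \<le> D x" for x unfolding D_def using \<rho> m0 by (intro mult_nonneg_nonneg sum_nonneg) auto
  \<comment> \<open>For the other balls the distance is at least 4 \<open>\<rho>\<close> -
    \<open>\<rho>\<close> - \<open>\<rho>\<close>/2.\<close>
  have off: "\<rho> / 2 \<le> norm (w - z)" if x: "x \<in> X" and z: "norm (z - c x) = \<rho>" and w: "w \<in> E" for x z w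
  proof -
    obtain y where y: "y \<in> X" "norm (w - c y) \<le> \<rho> / 2"
      using w unfolding E by (auto simp: dist_norm norm_minus_commute)
    show ?thesis
    proof (cases "y = x")
      case True
      have "norm (z - c x) \<le> norm (w - z) + norm (w - c x)"
        using norm_triangle_ineq[of "z - w" "w - c x"] by (simp add: norm_minus_commute)
      then show ?thesis using True y z by simp
    next
      case False
      have "norm (c x - c y) \<le> norm (z - c x) + norm (w - z) + norm (w - c y)"
        using norm_triangle_ineq[of "c x - z" "z - w"] norm_triangle_ineq[of "c x - w" "w - c y"]
        by (simp add: norm_minus_commute)
      then show ?thesis using sep[OF x y(1)] False y z \<rho> by simp
    qed
  qed
  have int: "integrable \<nu> (\<lambda>w. ?K (w - z))" if "x \<in> X" "norm (z - c x) = \<rho>" for x z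
    using kernel_integrable[OF \<nu> cE _ off[OF that] s] \<rho> by simp
  have sint: "set_integrable \<nu> A (\<lambda>w. ?K (w - z))"
    if "x \<in> X" "norm (z - c x) = \<rho>" "A \<in> sets \<nu>" for x z A
    unfolding set_integrable_def by (rule integrable_mult_indicator[OF that(3) int[OF that(1,2)]])
  have I1: "norm (I z) \<le> 1" if "x \<in> X" "norm (z - c x) = \<rho>" for x z
  proof -
    have "z \<notin> E" using off[OF that, of z] \<rho> by auto
    then show ?thesis unfolding I_def by (rule kernel_integral_le_1[OF \<nu> cE _ s bd])
  qed
  \<comment> \<open>Moving w to its center costs \<open>\<rho>\<close>/2 and moving z to
    \<open>c x\<close> costs \<open>\<rho>\<close>. The sum 3/2 \<open>\<rho>\<close> is below half
    of the separation 4 \<open>\<rho>\<close>, as the Lipschitz bound requires.\<close>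
  have far: "norm (I z - self x z - Rd x) \<le> 3/2 * CK * D x" if x: "x \<in> X" and z: "norm (z - c x) = \<rho>" for x z
  proof -
    have "I z = (LINT w:E|\<nu>. ?K (w - z))"
      unfolding I_def set_lebesgue_integral_def
    proof (rule integral_cong_AE)
      show "AE w in \<nu>. ?K (w - z) = indicat_real E w *\<^sub>R ?K (w - z)"
        using R(4) by eventually_elim simp
      have "E \<in> sets \<nu>" using cE by (simp add: R(2) borel_compact)
      then show "(\<lambda>w. indicat_real E w *\<^sub>R ?K (w - z)) \<in> borel_measurable \<nu>"
        using sint[OF x z] by (simp add: set_integrable_def borel_measurable_integrable)
    qed (use int[OF x z] in auto)
    also have "\<dots> = (\<Sum>y\<in>X. self y z)"
      unfolding E self_def B_def[symmetric]
      using X disj mB sint[OF x z] by (intro set_integral_finite_Union) auto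
    also have "\<dots> = self x z + (\<Sum>y\<in>X - {x}. self y z)" using X x by (simp add: sum.remove)
    finally have "I z - self x z - Rd x = (\<Sum>y\<in>X - {x}. self y z - m y *\<^sub>R ?K (c y - c x))"
      by (simp add: Rd_def sum_subtractf)
    also have "norm \<dots> \<le> (\<Sum>y\<in>X - {x}. m y * (CK * (3/2 * \<rho>) * norm (c y - c x) powr (- s - 1)))"
    proof (rule sum_norm_le)
      fix y assume y: "y \<in> X - {x}"
      then have d: "4 * \<rho> \<le> norm (c y - c x)" using sep x by auto
      then have nz: "c y - c x \<noteq> 0" using \<rho> by auto
      show "norm (self y z - m y *\<^sub>R ?K (c y - c x))
         \<le> m y * (CK * (3/2 * \<rho>) * norm (c y - c x) powr (- s - 1))"
        unfolding self_def m_def B_def[symmetric]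
      proof (rule norm_set_integral_diff_le[OF R(1) mB sint[OF x z mB]])
        fix w assume "w \<in> B y"
        then have "norm (w - c y) \<le> \<rho> / 2" by (simp add: B_def dist_norm norm_minus_commute)
        moreover have "norm ((c y - c x) - (w - z)) \<le> norm (w - c y) + norm (z - c x)"
          using norm_triangle_ineq[of "c y - w" "z - c x"] by (simp add: norm_minus_commute algebra_simps)
        ultimately have n: "norm ((c y - c x) - (w - z)) \<le> 3/2 * \<rho>" using z by simp
        have "norm (?K (c y - c x) - ?K (w - z))
          \<le> lip_const s * norm ((c y - c x) - (w - z)) * norm (c y - c x) powr (- s - 1)"
          by (rule riesz_lip_const[OF s nz]) (use n d \<rho> in linarith)
        also have "\<dots> \<le> CK * (3/2 * \<rho>) * norm (c y - c x) powr (- s - 1)"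
          unfolding CK_def[symmetric] using n CK1 by (intro mult_right_mono mult_left_mono) auto
        finally show "norm (?K (w - z) - ?K (c y - c x))
          \<le> CK * (3/2 * \<rho>) * norm (c y - c x) powr (- s - 1)" by (simp add: norm_minus_commute)
      qed
    qed
    also have "\<dots> = 3/2 * CK * D x" by (simp add: D_def sum_distrib_left mult_ac)
    finally show ?thesis .
  qed
  \<comment> \<open>Seen from an evaluation point, every w in the ball has component at least
    \<open>\<rho>\<close>/2 along the axis and distance at most 3/2 \<open>\<rho>\<close>; hence the
    kernel has axial component at least \<open>\<eta> / \<rho> powr s\<close>.\<close>
  define \<eta> where "\<eta> = 1 / (2 * (3/2) powr (s + 1))"
  have \<eta>: "0 < \<eta>" by (simp add: \<eta>_def)
  have dens: "m x / \<rho> powr s \<le> (3/2 * CK / \<eta>) * (1 + D x)" if x: "x \<in> X" for x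
  proof -
    obtain e :: 'a where e: "e \<in> Basis" using nonempty_Basis by blast
    then have ne: "norm e = 1" by simp
    have low: "m x * (\<eta> / \<rho> powr s) \<le> t * (e \<bullet> self x (c x - (t * \<rho>) *\<^sub>R e))" if t: "\<bar>t\<bar> = 1" for t
    proof -
      let ?z = "c x - (t * \<rho>) *\<^sub>R e"
      have z: "norm (?z - c x) = \<rho>" using ne t \<rho> by (simp add: abs_mult)
      have pt: "\<eta> / \<rho> powr s \<le> (t *\<^sub>R e) \<bullet> ?K (w - ?z)" if w: "w \<in> B x" for w
      proof -
        have n: "norm (w - c x) \<le> \<rho> / 2" using w by (simp add: B_def dist_norm norm_minus_commute)
        have tt: "t * t = 1" using t by (metis abs_mult_self_eq mult_1)
        have "\<bar>(t *\<^sub>R e) \<bullet> (w - c x)\<bar> \<le> norm (t *\<^sub>R e) * norm (w - c x)" by (rule Cauchy_Schwarz_ineq2)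
        then have "- (\<rho> / 2) \<le> (t *\<^sub>R e) \<bullet> (w - c x)" using n ne t by simp
        moreover have "(t *\<^sub>R e) \<bullet> (w - ?z) = (t *\<^sub>R e) \<bullet> (w - c x) + \<rho>"
          using e tt by (simp add: inner_diff_right inner_add_right algebra_simps)
        ultimately have 1: "\<rho> / 2 \<le> (t *\<^sub>R e) \<bullet> (w - ?z)" by simp
        have 2: "norm (w - ?z) \<le> 3/2 * \<rho>"
        proof -
          have "w - ?z = (w - c x) + (c x - ?z)" by simp
          then have "norm (w - ?z) \<le> norm (w - c x) + norm (c x - ?z)" by (metis norm_triangle_ineq)
          then show ?thesis using n z by (simp only: norm_minus_commute[of "c x" ?z])
        qed
        have 3: "0 < norm (w - ?z)" using 1 \<rho> by (intro notI zero_less_norm_iff[THEN iffD2]) auto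
        have "\<eta> / \<rho> powr s = (\<rho> / 2) / (3/2 * \<rho>) powr (s + 1)"
          using \<rho> powr_mult[of "3/2" \<rho> "s + 1"] by (simp add: \<eta>_def powr_add)
        also have "\<dots> \<le> (\<rho> / 2) / norm (w - ?z) powr (s + 1)"
          using 2 3 s \<rho> by (intro divide_left_mono powr_mono2) auto
        also have "\<dots> \<le> ((t *\<^sub>R e) \<bullet> (w - ?z)) / norm (w - ?z) powr (s + 1)"
          using 1 by (intro divide_right_mono) auto
        finally show ?thesis by (simp add: riesz_kernel_def)
      qed
      have "m x * (\<eta> / \<rho> powr s) = (LINT w:B x|\<nu>. \<eta> / \<rho> powr s)"
        using mB[of x] by (simp add: set_lebesgue_integral_def m_def B_def)
      also have "\<dots> \<le> (LINT w:B x|\<nu>. (t *\<^sub>R e) \<bullet> ?K (w - ?z))"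
      proof (rule set_integral_mono[OF _ _ pt])
        show "set_integrable \<nu> (B x) (\<lambda>_. \<eta> / \<rho> powr s)"
          using mB[of x] unfolding set_integrable_def
          by (intro integrable_scaleR_left) (simp add: emeasure_eq_measure)
        show "set_integrable \<nu> (B x) (\<lambda>w. (t *\<^sub>R e) \<bullet> ?K (w - ?z))"
          using integrable_inner_right[OF sint[OF x z mB, unfolded set_integrable_def], of "t *\<^sub>R e"]
          by (simp add: set_integrable_def)
      qed
      also have "\<dots> = (t *\<^sub>R e) \<bullet> self x ?z"
        unfolding self_def set_lebesgue_integral_def real_scaleR_def inner_scaleR_right[symmetric]
        by (rule integral_inner_right[OF sint[OF x z mB, unfolded set_integrable_def]])
      finally show ?thesis by simp
    qed
    let ?p = "c x - \<rho> *\<^sub>R e" and ?q = "c x + \<rho> *\<^sub>R e"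
    have zp: "norm (?p - c x) = \<rho>" and zq: "norm (?q - c x) = \<rho>" using ne \<rho> by auto
    have "m x * (\<eta> / \<rho> powr s) \<le> e \<bullet> self x ?p" "m x * (\<eta> / \<rho> powr s) \<le> - (e \<bullet> self x ?q)"
      using low[of 1] low[of "- 1"] by simp_all
    moreover have "a \<le> p \<Longrightarrow> a \<le> - q \<Longrightarrow> 2 * a \<le> p - q" for a p q :: real by simp
    \<comment> \<open>In the difference the self terms add up and the common far field
      \<open>Rd x\<close> cancels, although it is not yet under control.\<close>
    ultimately have "2 * (m x * (\<eta> / \<rho> powr s)) \<le> e \<bullet> (self x ?p - self x ?q)"
      unfolding inner_diff_right by blast
    also have "\<dots> = e \<bullet> (I ?p - I ?q - ((I ?p - self x ?p - Rd x) - (I ?q - self x ?q - Rd x)))"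
      by simp
    also have "\<dots> \<le> norm e * norm (I ?p - I ?q - ((I ?p - self x ?p - Rd x) - (I ?q - self x ?q - Rd x)))"
      by (rule norm_cauchy_schwarz)
    also have "\<dots> \<le> 1 + 1 + (3/2 * CK * D x + 3/2 * CK * D x)"
      unfolding ne mult_1
      by (intro order_trans[OF norm_triangle_ineq4] add_mono I1[OF x zp] I1[OF x zq] far[OF x zp] far[OF x zq])
    finally have "m x * \<eta> / \<rho> powr s \<le> 1 + 3/2 * CK * D x" by simp
    also have "\<dots> \<le> 3/2 * CK * (1 + D x)" using CK1 by (simp add: algebra_simps)
    finally have "m x / \<rho> powr s * \<eta> \<le> 3/2 * CK * (1 + D x)" by simp
    then have "m x / \<rho> powr s \<le> 3/2 * CK * (1 + D x) / \<eta>"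
      unfolding pos_le_divide_eq[OF \<eta>] .
    then show ?thesis by simp
  qed
  have tc: "transfer_const s = 3 * CK * 2 powr s / \<eta>" by (simp add: transfer_const_def CK_def \<eta>_def)
  have k2: "1 \<le> 2 powr s" using s by (simp add: ge_one_powr_ge_zero)
  show "m x / \<rho> powr s \<le> transfer_const s * (1 + D x)" if x: "x \<in> X"
  proof -
    have "3/2 * CK / \<eta> \<le> transfer_const s"
      unfolding tc using CK1 \<eta> k2 mult_mono[of "3/2" 3 1 "2 powr s"]
      by (intro divide_right_mono) (auto simp: mult_ac)
    from mult_right_mono[OF this, of "1 + D x"] dens[OF x] D0[of x] show ?thesis by linarith
  qed
  show "norm (\<Sum>y\<in>X - {x}. m y *\<^sub>R ?K (c y - c x)) \<le> transfer_const s * (1 + D x)" if x: "x \<in> X"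
  proof -
    obtain e :: 'a where e: "e \<in> Basis" using nonempty_Basis by blast
    let ?q = "c x + \<rho> *\<^sub>R e"
    have zq: "norm (?q - c x) = \<rho>" using e \<rho> by auto
    have "norm (self x ?q - measure \<nu> (B x) *\<^sub>R 0) \<le> measure \<nu> (B x) * (2 powr s / \<rho> powr s)"
      unfolding self_def
    proof (rule norm_set_integral_diff_le[OF R(1) mB sint[OF x zq mB]])
      fix w assume w: "w \<in> B x"
      then have wE: "w \<in> E" using x by (auto simp: E B_def)
      have o: "\<rho> / 2 \<le> norm (w - ?q)" by (rule off[OF x zq wE])
      then have "w - ?q \<noteq> 0" using \<rho> by auto
      then have "norm (?K (w - ?q)) = norm (w - ?q) powr (- s)" by (rule norm_riesz_kernel)
      also have "\<dots> \<le> (\<rho> / 2) powr (- s)" using o \<rho> s by (intro powr_mono2') auto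
      also have "\<dots> = 2 powr s / \<rho> powr s" using \<rho> by (simp add: powr_minus powr_divide)
      finally show "norm (?K (w - ?q) - 0) \<le> 2 powr s / \<rho> powr s" by simp
    qed
    then have sf: "norm (self x ?q) \<le> 2 powr s * (m x / \<rho> powr s)"
      by (simp add: m_def B_def mult_ac)
    have "norm (Rd x) = norm (I ?q - self x ?q - (I ?q - self x ?q - Rd x))" by simp
    \<comment> \<open>With the density bound at hand, one evaluation point is enough for the far
      field.\<close>
    also have "\<dots> \<le> 1 + 2 powr s * (m x / \<rho> powr s) + 3/2 * CK * D x"
      by (intro order_trans[OF norm_triangle_ineq4] add_mono I1[OF x zq] far[OF x zq] sf)
    also have "\<dots> \<le> 1 + 2 powr s * ((3/2 * CK / \<eta>) * (1 + D x)) + 3/2 * CK * D x"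
      using dens[OF x] CK1 by (intro add_mono mult_left_mono) auto
    also have "\<dots> \<le> 2 powr s * ((3/2 * CK / \<eta>) * (1 + D x)) + 3/2 * CK * (1 + D x)"
      using CK1 by (simp add: algebra_simps)
    also have "\<dots> \<le> 2 powr s * ((3/2 * CK / \<eta>) * (1 + D x)) + 2 powr s * ((3/2 * CK / \<eta>) * (1 + D x))"
    proof (intro add_left_mono)
      have "\<eta> \<le> 1" unfolding \<eta>_def using ge_one_powr_ge_zero[of "3/2" "s + 1"] s by simp
      then have "1 \<le> 1 / \<eta>" using \<eta> by simp
      then have "1 \<le> 2 powr s * (1 / \<eta>)" using k2 mult_mono[of 1 "2 powr s" 1 "1 / \<eta>"] by simp
      then have "1 * (3/2 * CK * (1 + D x)) \<le> 2 powr s * (1 / \<eta>) * (3/2 * CK * (1 + D x))"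
        using CK1 D0[of x] by (intro mult_right_mono) auto
      then show "3/2 * CK * (1 + D x) \<le> 2 powr s * ((3/2 * CK / \<eta>) * (1 + D x))" by (simp add: mult_ac)
    qed
    also have "\<dots> = transfer_const s * (1 + D x)" unfolding tc by simp
    finally show ?thesis by (simp add: Rd_def)
  qed
qed

subsection \<open>Cantor sets with grid digits\<close>

definition digits :: "nat \<Rightarrow> ('n \<Rightarrow> nat) set" where
  "digits M = {i. \<forall>a. i a < M}"

definition grid_pt :: "('n \<Rightarrow> nat) \<Rightarrow> real ^ 'n" where
  "grid_pt i = (\<chi> a. real (i a))"

lemma digits_eq_PiE: "digits M = PiE UNIV (\<lambda>_. {..<M})"
  by (auto simp: digits_def PiE_def Pi_def)

lemma finite_digits: "finite (digits M :: ('n::finite \<Rightarrow> nat) set)"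
  unfolding digits_eq_PiE by (intro finite_PiE) auto

lemma card_digits: "card (digits M :: ('n::finite \<Rightarrow> nat) set) = M ^ CARD('n)"
  unfolding digits_eq_PiE by (simp add: card_PiE)

lemma infnorm_cart_less:
  fixes v :: "real ^ 'n::finite"
  assumes "\<And>a. \<bar>v $ a\<bar> < B"
  shows "infnorm v < B"
proof -
  have "infnorm v \<in> (\<lambda>i. \<bar>v \<bullet> i\<bar>) ` Basis"
    unfolding infnorm_Max by (rule Max_in) auto
  then show ?thesis using assms by (auto simp: Basis_vec_def inner_axis)
qed

lemma infnorm_grid_less:
  "i \<in> digits M \<Longrightarrow> j \<in> digits M \<Longrightarrow> infnorm (grid_pt i - grid_pt j :: real ^ 'n::finite) < real M"
  by (rule infnorm_cart_less) (auto simp: digits_def grid_pt_def abs_less_iff; smt (verit) of_nat_0_le_iff of_nat_less_iff)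

lemma infnorm_grid_ge_1:
  assumes "i \<noteq> (j :: 'n::finite \<Rightarrow> nat)"
  shows "1 \<le> infnorm (grid_pt i - grid_pt j)"
proof -
  obtain a where a: "i a \<noteq> j a" using assms by auto
  then have "1 \<le> \<bar>real (i a) - real (j a)\<bar>" by linarith
  also have "\<dots> \<le> infnorm (grid_pt i - grid_pt j)"
    using component_le_infnorm_cart[of "grid_pt i - grid_pt j" a] by (simp add: grid_pt_def)
  finally show ?thesis .
qed

lemma card_infnorm_ball:
  fixes j :: "'n::finite \<Rightarrow> nat"
  shows "finite {i. infnorm (grid_pt i - grid_pt j) < real q}"
    and "card {i. infnorm (grid_pt i - grid_pt j) < real q} \<le> (2 * q) ^ CARD('n)"
proof -
  \<comment> \<open>Subtraction truncated at 0 only shrinks the box and loses no digit.\<close>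
  let ?P = "PiE UNIV (\<lambda>a. {j a - q..<j a + q})"
  have sub: "{i. infnorm (grid_pt i - grid_pt j) < real q} \<subseteq> ?P"
  proof
    fix i assume i: "i \<in> {i. infnorm (grid_pt i - grid_pt j) < real q}"
    have "\<bar>real (i a) - real (j a)\<bar> < real q" for a
      using component_le_infnorm_cart[of "grid_pt i - grid_pt j" a] i by (simp add: grid_pt_def)
    then show "i \<in> ?P" by (auto simp: PiE_def Pi_def abs_less_iff) (smt (verit) of_nat_less_iff of_nat_add le_diff_conv not_le)+
  qed
  have fP: "finite ?P" by (intro finite_PiE) auto
  show "finite {i. infnorm (grid_pt i - grid_pt j) < real q}" using sub fP by (rule finite_subset)
  have "card {i. infnorm (grid_pt i - grid_pt j) < real q} \<le> card ?P" using sub fP by (rule card_mono[rotated])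
  also have "\<dots> = (\<Prod>a\<in>(UNIV::'n set). card {j a - q..<j a + q})" by (simp add: card_PiE)
  also have "\<dots> \<le> (\<Prod>a\<in>(UNIV::'n set). 2 * q)" by (intro prod_mono) auto
  finally show "card {i. infnorm (grid_pt i - grid_pt j) < real q} \<le> (2 * q) ^ CARD('n)" by simp
qed

definition grid_const :: "nat \<Rightarrow> real \<Rightarrow> real" where
  "grid_const d p = 4 ^ d / (2 powr (real d - p) - 1)"

text \<open>Split into dyadic shells of the sup norm: the shell at radius 2^u has at most 4^d 2^(ud)
  points. The resulting geometric series has ratio 2^(d-p) > 1, so the outermost shell dominates;
  this is the origin of \<open>grid_const\<close>.\<close>

lemma grid_sum_bound:
  fixes j :: "'n::finite \<Rightarrow> nat" and p :: real
  assumes j: "j \<in> digits (2 ^ t)" and p: "0 < p" "p < real CARD('n)"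
  shows "(\<Sum>i\<in>digits (2 ^ t) - {j}. infnorm (grid_pt i - grid_pt j) powr (- p))
    \<le> grid_const CARD('n) p * (2 ^ t) powr (real CARD('n) - p)"
proof -
  let ?d = "CARD('n)"
  define D where "D i = infnorm (grid_pt i - grid_pt j)" for i
  define \<rho> where "\<rho> = (2::real) powr (real ?d - p)"
  have \<rho>1: "1 < \<rho>" unfolding \<rho>_def using p by (intro gr_one_powr) auto
  have pt: "D i powr (- p) \<le> (\<Sum>u<t. if D i < 2 ^ Suc u then (2 ^ u) powr (- p) else 0)"
    if i: "i \<in> digits (2 ^ t) - {j}" for i
  proof -
    have D1: "1 \<le> D i" unfolding D_def using i by (intro infnorm_grid_ge_1) auto
    have Dt: "D i < 2 ^ t" unfolding D_def using infnorm_grid_less[of i "2 ^ t" j] i j by simp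
    have "\<exists>u<t. 2 ^ u \<le> D i \<and> D i < 2 ^ Suc u"
    proof -
      define v where "v = (LEAST v. D i < 2 ^ v)"
      have v: "D i < 2 ^ v" unfolding v_def using Dt by (rule LeastI)
      have vt: "v \<le> t" unfolding v_def using Dt by (rule Least_le)
      have "v \<noteq> 0" using v D1 by (intro notI) simp
      then obtain u where u: "v = Suc u" by (cases v) auto
      have "\<not> D i < 2 ^ u" using not_less_Least[of u "\<lambda>v. D i < 2 ^ v"] u by (simp add: v_def)
      then show ?thesis using u v vt by (intro exI[of _ u]) auto
    qed
    then obtain u where u: "u < t" "2 ^ u \<le> D i" "D i < 2 ^ Suc u" by auto
    have "D i powr (- p) \<le> (2 ^ u) powr (- p)" using u(2) p by (intro powr_mono2') auto
    also have "\<dots> = (if D i < 2 ^ Suc u then (2 ^ u) powr (- p) else 0)" using u by simp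
    also have "\<dots> \<le> (\<Sum>u<t. if D i < 2 ^ Suc u then (2 ^ u) powr (- p) else 0)"
      using u(1) by (intro member_le_sum) auto
    finally show ?thesis .
  qed
  have "(\<Sum>i\<in>digits (2 ^ t) - {j}. D i powr (- p))
     \<le> (\<Sum>i\<in>digits (2 ^ t) - {j}. \<Sum>u<t. if D i < 2 ^ Suc u then (2 ^ u) powr (- p) else 0)"
    by (intro sum_mono pt)
  also have "\<dots> = (\<Sum>u<t. \<Sum>i\<in>digits (2 ^ t) - {j}. if D i < 2 ^ Suc u then (2 ^ u) powr (- p) else 0)"
    by (rule sum.swap)
  also have "\<dots> \<le> (\<Sum>u<t. 4 ^ ?d * \<rho> ^ u)"
  proof (rule sum_mono)
    fix u
    let ?S = "{i. infnorm (grid_pt i - grid_pt j) < real (2 ^ Suc u)}"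
    have "(\<Sum>i\<in>digits (2 ^ t) - {j}. if D i < 2 ^ Suc u then (2 ^ u) powr (- p) else 0)
       = (\<Sum>i\<in>{i\<in>digits (2 ^ t) - {j}. D i < 2 ^ Suc u}. (2 ^ u) powr (- p))"
      by (rule sum.inter_filter[symmetric]) (simp add: finite_digits)
    also have "\<dots> \<le> (\<Sum>i\<in>?S. (2 ^ u) powr (- p))"
      by (rule sum_mono2[OF card_infnorm_ball(1)]) (auto simp: D_def)
    also have "\<dots> \<le> real ((2 * 2 ^ Suc u) ^ ?d) * (2 ^ u) powr (- p)"
      using card_infnorm_ball(2)[of j "2 ^ Suc u"] by (simp only: sum_constant) (intro mult_right_mono, simp_all only: of_nat_le_iff powr_ge_zero)
    also have "real ((2 * 2 ^ Suc u) ^ ?d) = 4 ^ ?d * (2 ^ u) ^ ?d"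
    proof -
      have "2 * 2 ^ Suc u = 4 * (2::nat) ^ u" by simp
      then show ?thesis by (simp only: of_nat_power of_nat_mult power_mult_distrib) simp
    qed
    also have "4 ^ ?d * (2 ^ u) ^ ?d * (2 ^ u) powr (- p) = 4 ^ ?d * \<rho> ^ u"
    proof -
      have "(2 ^ u) ^ ?d * (2 ^ u) powr (- p) = (2 ^ u) powr (real ?d - p)"
        by (simp add: powr_diff powr_minus powr_realpow field_simps)
      also have "\<dots> = \<rho> ^ u"
        by (simp add: \<rho>_def powr_powr mult.commute flip: powr_realpow)
      finally show ?thesis by simp
    qed
    finally show "(\<Sum>i\<in>digits (2 ^ t) - {j}. if D i < 2 ^ Suc u then (2 ^ u) powr (- p) else 0) \<le> 4 ^ ?d * \<rho> ^ u" .
  qed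
  also have "\<dots> = 4 ^ ?d * ((\<rho> ^ t - 1) / (\<rho> - 1))"
    using \<rho>1 by (simp add: sum_distrib_left[symmetric] geometric_sum)
  also have "\<dots> \<le> 4 ^ ?d * (\<rho> ^ t / (\<rho> - 1))"
    using \<rho>1 by (intro mult_left_mono divide_right_mono) auto
  also have "\<rho> ^ t = (2 ^ t) powr (real ?d - p)"
    by (simp add: \<rho>_def powr_powr mult.commute flip: powr_realpow)
  finally show ?thesis by (simp add: D_def \<rho>_def grid_const_def)
qed

section \<open>Words, cube centers and stages\<close>

definition words :: "(nat \<Rightarrow> nat) \<Rightarrow> nat \<Rightarrow> (nat \<Rightarrow> 'n \<Rightarrow> nat) set" where
  "words t N = PiE {..<N} (\<lambda>k. digits (2 ^ t k))"

text \<open>With 2^t points per axis the grid has side at most l/4 divided by the dimension, hence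
  Euclidean diameter at most l/4; the rest of the cube is left to later generations.\<close>

definition spacing :: "nat \<Rightarrow> (nat \<Rightarrow> real) \<Rightarrow> (nat \<Rightarrow> nat) \<Rightarrow> nat \<Rightarrow> real" where
  "spacing d l t k = l k / (4 * real d * 2 ^ t k)"

definition center :: "(nat \<Rightarrow> real) \<Rightarrow> (nat \<Rightarrow> nat) \<Rightarrow> nat \<Rightarrow> (nat \<Rightarrow> 'n \<Rightarrow> nat) \<Rightarrow> real ^ 'n::finite" where
  "center l t N x = (\<Sum>k<N. spacing CARD('n) l t k *\<^sub>R grid_pt (x k))"

definition stage :: "(nat \<Rightarrow> real) \<Rightarrow> (nat \<Rightarrow> nat) \<Rightarrow> nat \<Rightarrow> (real ^ 'n::finite) set" where
  "stage l t N = (\<Union>x\<in>words t N. cball (center l t N x) (l N / 2))"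

lemma finite_words: "finite (words t N :: (nat \<Rightarrow> 'n::finite \<Rightarrow> nat) set)"
  unfolding words_def by (intro finite_PiE finite_digits) auto

lemma card_words: "card (words t N :: (nat \<Rightarrow> 'n::finite \<Rightarrow> nat) set) = (\<Prod>k<N. (2 ^ t k) ^ CARD('n))"
  unfolding words_def by (simp add: card_PiE card_digits)

lemma words_nonempty: "words t N \<noteq> ({} :: (nat \<Rightarrow> 'n::finite \<Rightarrow> nat) set)"
  using card_words[of t N, where 'n = 'n] by (intro notI) simp

lemma words_digit: "x \<in> words t N \<Longrightarrow> k < N \<Longrightarrow> x k \<in> digits (2 ^ t k)"
  by (auto simp: words_def PiE_def Pi_def)

lemma restrict_eq_iff: "restrict x {..<k} = restrict y {..<k} \<longleftrightarrow> (\<forall>i<k. x i = y i)"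
  by (auto simp: fun_eq_iff restrict_def)

lemma words_eqI: "x \<in> words t N \<Longrightarrow> y \<in> words t N \<Longrightarrow> (\<And>k. k < N \<Longrightarrow> x k = y k) \<Longrightarrow> x = y"
  unfolding words_def by (rule PiE_ext) auto

lemma compact_stage: "compact (stage l t N)"
  unfolding stage_def by (intro compact_UN finite_words) auto

locale cantor_scales =
  fixes l :: "nat \<Rightarrow> real" and t :: "nat \<Rightarrow> nat" and N :: nat
    and \<sigma> :: "nat \<Rightarrow> real" and W :: "(nat \<Rightarrow> 'n::finite \<Rightarrow> nat) set"
    and c :: "(nat \<Rightarrow> 'n \<Rightarrow> nat) \<Rightarrow> real ^ 'n"
  assumes l_pos: "0 < l k"
    and l_half: "k < N \<Longrightarrow> l (Suc k) \<le> l k / 2"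
    and l_spacing: "k < N \<Longrightarrow> 8 * l (Suc k) \<le> \<sigma> k"
    and \<sigma>_eq: "\<sigma> = spacing CARD('n) l t" and W_eq: "W = words t N" and c_eq: "c = center l t N"
begin

lemmas W_digit = words_digit[of _ t N, where 'a = 'n, folded W_eq]
lemmas W_eqI = words_eqI[of _ t N, where 'a = 'n, folded W_eq]
lemmas finite_W = finite_words[of t N, where 'n = 'n, folded W_eq]
lemmas W_nonempty = words_nonempty[of t N, where 'n = 'n, folded W_eq]

lemma \<sigma>_pos: "0 < \<sigma> k"
  using l_pos by (simp add: \<sigma>_eq spacing_def)

lemma l_mono: "j \<le> k \<Longrightarrow> k \<le> N \<Longrightarrow> l k \<le> l j"
proof (induction k)
  case (Suc k)
  then show ?case using l_half[of k] l_pos[of k] by (cases "j = Suc k") auto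
qed simp

lemma norm_grid_diff:
  assumes "i \<in> digits (2 ^ t k)" "j \<in> digits (2 ^ t k)"
  shows "norm (\<sigma> k *\<^sub>R (grid_pt i - grid_pt j :: real ^ 'n)) \<le> l k / 4"
proof -
  have "norm (grid_pt i - grid_pt j :: real ^ 'n) \<le> (\<Sum>a\<in>UNIV. \<bar>(grid_pt i - grid_pt j) $ a\<bar>)"
    by (rule norm_le_l1_cart)
  also have "\<dots> \<le> (\<Sum>a\<in>(UNIV::'n set). 2 ^ t k)"
  proof (rule sum_mono)
    fix a
    have "\<bar>(grid_pt i - grid_pt j) $ a\<bar> \<le> infnorm (grid_pt i - grid_pt j)" by (rule component_le_infnorm_cart)
    then show "\<bar>(grid_pt i - grid_pt j) $ a\<bar> \<le> 2 ^ t k"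
      using infnorm_grid_less[OF assms] by simp
  qed
  also have "\<dots> = real CARD('n) * 2 ^ t k" by simp
  finally have "norm (\<sigma> k *\<^sub>R (grid_pt i - grid_pt j :: real ^ 'n)) \<le> \<sigma> k * (real CARD('n) * 2 ^ t k)"
    using \<sigma>_pos[of k] by (simp add: mult_left_mono)
  also have "\<dots> = l k / 4" by (simp add: \<sigma>_eq spacing_def)
  finally show ?thesis .
qed

lemma tail_bound:
  assumes x: "x \<in> W" and y: "y \<in> W" and k: "k \<le> N"
  shows "norm (\<Sum>i\<in>{k..<N}. \<sigma> i *\<^sub>R (grid_pt (x i) - grid_pt (y i))) \<le> l k / 2"
proof -
  \<comment> \<open>Subtracting \<open>l N\<close> makes the bound inductive: l(n)/4 + (l(n+1) -
    l(N))/2 is at most (l(n) - l(N))/2 when l(n+1) <= l(n)/2.\<close>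
  have "norm (\<Sum>i\<in>{k..<N}. \<sigma> i *\<^sub>R (grid_pt (x i) - grid_pt (y i))) \<le> (l k - l N) / 2"
    using k
  proof (induction k rule: inc_induct)
    case (step n)
    have eq: "(\<Sum>i\<in>{n..<N}. \<sigma> i *\<^sub>R (grid_pt (x i) - grid_pt (y i)))
      = \<sigma> n *\<^sub>R (grid_pt (x n) - grid_pt (y n)) + (\<Sum>i\<in>{Suc n..<N}. \<sigma> i *\<^sub>R (grid_pt (x i) - grid_pt (y i)))"
      using step by (intro sum.atLeast_Suc_lessThan) auto
    have "norm (\<sigma> n *\<^sub>R (grid_pt (x n) - grid_pt (y n))) \<le> l n / 4"
      using step x y by (intro norm_grid_diff W_digit) auto
    then have "norm (\<Sum>i\<in>{n..<N}. \<sigma> i *\<^sub>R (grid_pt (x i) - grid_pt (y i))) \<le> l n / 4 + (l (Suc n) - l N) / 2"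
      unfolding eq using step.IH by (intro order_trans[OF norm_triangle_ineq] add_mono)
    also have "\<dots> \<le> (l n - l N) / 2" using l_half[of n] step by (simp add: field_simps)
    finally show ?case .
  qed simp
  then show ?thesis using l_pos[of N] by simp
qed

lemma center_diff:
  assumes "k \<le> N" and "\<And>i. i < k \<Longrightarrow> x i = y i"
  shows "c x - c y = (\<Sum>i\<in>{k..<N}. \<sigma> i *\<^sub>R (grid_pt (x i) - grid_pt (y i)))"
proof -
  have "c x - c y = (\<Sum>i<N. \<sigma> i *\<^sub>R (grid_pt (x i) - grid_pt (y i)))"
    by (simp add: c_eq \<sigma>_eq center_def sum_subtractf scaleR_diff_right)
  also have "\<dots> = (\<Sum>i\<in>{k..<N}. \<sigma> i *\<^sub>R (grid_pt (x i) - grid_pt (y i)))"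
    using assms by (intro sum.mono_neutral_right) auto
  finally show ?thesis .
qed

lemma center_close:
  assumes "x \<in> W" "y \<in> W" "k \<le> N" "\<And>i. i < k \<Longrightarrow> x i = y i"
  shows "norm (c x - c y) \<le> l k"
  using center_diff[OF assms(3,4)] tail_bound[OF assms(1-3)] l_pos[of k] by simp

text \<open>The shift at the first differing digit dominates: all later digits together move the
  center by at most half of it.\<close>

lemma center_apart:
  assumes "x \<in> W" "y \<in> W" "k < N" "\<And>i. i < k \<Longrightarrow> x i = y i" "x k \<noteq> y k"
  shows "\<sigma> k / 2 * infnorm (grid_pt (x k) - grid_pt (y k)) \<le> norm (c x - c y)"
proof -
  let ?v = "grid_pt (x k) - grid_pt (y k)" and ?r = "\<Sum>i\<in>{Suc k..<N}. \<sigma> i *\<^sub>R (grid_pt (x i) - grid_pt (y i))"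
  have eq: "c x - c y = \<sigma> k *\<^sub>R ?v + ?r"
    using center_diff[of k x y] assms by (simp add: sum.atLeast_Suc_lessThan)
  have "norm (\<sigma> k *\<^sub>R ?v) - norm ?r \<le> norm (c x - c y)" unfolding eq by (rule norm_diff_ineq)
  moreover have "norm ?r \<le> l (Suc k) / 2" using assms by (intro tail_bound) auto
  moreover have "\<sigma> k * infnorm ?v \<le> norm (\<sigma> k *\<^sub>R ?v)"
    using infnorm_le_norm[of ?v] \<sigma>_pos[of k] by simp
  moreover have "l (Suc k) \<le> \<sigma> k * infnorm ?v"
  proof -
    have "l (Suc k) \<le> \<sigma> k" using l_spacing[OF assms(3)] l_pos[of "Suc k"] by simp
    also have "\<dots> \<le> \<sigma> k * infnorm ?v" using infnorm_grid_ge_1[OF assms(5)] \<sigma>_pos[of k] by simp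
    finally show ?thesis .
  qed
  ultimately show ?thesis by (simp add: field_simps)
qed

lemma center_separated:
  assumes "x \<in> W" "y \<in> W" "k < N" "\<And>i. i < k \<Longrightarrow> x i = y i" "x k \<noteq> y k"
  shows "4 * l (Suc k) \<le> norm (c x - c y)"
proof -
  have "4 * l (Suc k) \<le> \<sigma> k / 2 * 1" using l_spacing[OF assms(3)] by simp
  also have "\<dots> \<le> \<sigma> k / 2 * infnorm (grid_pt (x k) - grid_pt (y k))"
    using infnorm_grid_ge_1[OF assms(5)] \<sigma>_pos[of k] by (intro mult_left_mono) auto
  also have "\<dots> \<le> norm (c x - c y)" by (rule center_apart[OF assms])
  finally show ?thesis .
qed

lemma first_difference:
  assumes "x \<in> W" "y \<in> W" "x \<noteq> y"
  obtains k where "k < N" "\<And>i. i < k \<Longrightarrow> x i = y i" "x k \<noteq> y k"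
proof -
  define k where "k = (LEAST k. k < N \<and> x k \<noteq> y k)"
  have "\<exists>k. k < N \<and> x k \<noteq> y k" using assms W_eqI by blast
  then have k: "k < N \<and> x k \<noteq> y k" unfolding k_def by (rule LeastI_ex)
  have "x i = y i" if "i < k" for i
  proof -
    have "\<not> (i < N \<and> x i \<noteq> y i)" using that unfolding k_def by (rule not_less_Least)
    then show ?thesis using that k by simp
  qed
  then show thesis using that[of k] k by blast
qed

lemma leaves_separated:
  assumes "x \<in> W" "y \<in> W" "x \<noteq> y"
  shows "4 * l N \<le> norm (c x - c y)"
proof -
  obtain k where k: "k < N" "\<And>i. i < k \<Longrightarrow> x i = y i" "x k \<noteq> y k" using first_difference[OF assms] by blast
  have "4 * l N \<le> 4 * l (Suc k)" using l_mono[of "Suc k" N] k by simp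
  also have "\<dots> \<le> norm (c x - c y)" using center_separated assms k by blast
  finally show ?thesis .
qed

text \<open>The kernel is bounded by a function of the digit \<open>y k\<close> alone, and within
  one child the normalised weights add up to at most 1. So the bound depends only on the grid and
  holds for arbitrary masses. Lowering the exponent s + 1 to p is allowed because the ratio
  \<open>r\<close> of lengths is at most 1.\<close>

lemma row_bound:
  fixes m :: "(nat \<Rightarrow> 'n \<Rightarrow> nat) \<Rightarrow> real" and p s :: real
  assumes s: "0 < s" and p: "0 < p" "p < real CARD('n)" "p \<le> s + 1" and m: "\<And>x. 0 \<le> m x"
    and k: "k < N" and x: "x \<in> W"
  defines "pre \<equiv> \<lambda>k (x :: nat \<Rightarrow> 'n \<Rightarrow> nat). restrict x {..<k}"
  shows "(\<Sum>y\<in>{y\<in>W. pre k y = pre k x \<and> pre (Suc k) y \<noteq> pre (Suc k) x}.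
           m y / sum m {z\<in>W. pre (Suc k) z = pre (Suc k) y} * norm (c y - c x) powr (- s - 1))
     \<le> (2 * l (Suc k) / \<sigma> k) powr p * (grid_const CARD('n) p * (2 ^ t k) powr (real CARD('n) - p))
       * l (Suc k) powr (- s - 1)"
proof -
  let ?d = "CARD('n)" and ?S = "{y\<in>W. pre k y = pre k x \<and> pre (Suc k) y \<noteq> pre (Suc k) x}"
  let ?L = "l (Suc k)"
  define D where "D i = infnorm (grid_pt i - grid_pt (x k))" for i
  define M where "M y = sum m {z\<in>W. pre (Suc k) z = pre (Suc k) y}" for y
  define b where "b i = (2 * ?L / \<sigma> k) powr p * D i powr (- p) * ?L powr (- s - 1)" for i
  have L: "0 < ?L" by (rule l_pos)
  have M0: "0 \<le> M y" for y unfolding M_def by (intro sum_nonneg m)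
  have b0: "0 \<le> b i" for i by (simp add: b_def)
  have S: "y \<in> ?S \<longleftrightarrow> y \<in> W \<and> (\<forall>i<k. y i = x i) \<and> y k \<noteq> x k" for y
    unfolding pre_def restrict_eq_iff by (auto simp: less_Suc_eq)
  have kb: "norm (c y - c x) powr (- s - 1) \<le> b (y k)" if y: "y \<in> ?S" for y
  proof -
    have y': "y \<in> W" "\<And>i. i < k \<Longrightarrow> y i = x i" "y k \<noteq> x k" using y S by auto
    have D1: "1 \<le> D (y k)" unfolding D_def by (rule infnorm_grid_ge_1[OF y'(3)])
    have ap: "\<sigma> k / 2 * D (y k) \<le> norm (c y - c x)"
      unfolding D_def using center_apart[OF y'(1) x k y'(2,3)] .
    define r where "r = 2 * ?L / (\<sigma> k * D (y k))"
    have sD: "\<sigma> k \<le> \<sigma> k * D (y k)" using D1 \<sigma>_pos[of k] by simp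
    have "2 * ?L \<le> \<sigma> k * D (y k)" using L sD l_spacing[OF k] by linarith
    then have r: "0 < r" "r \<le> 1" unfolding r_def using L by auto
    have "norm (c y - c x) powr (- s - 1) \<le> (\<sigma> k / 2 * D (y k)) powr (- s - 1)"
      using ap \<sigma>_pos[of k] D1 s by (intro powr_mono2') auto
    also have "\<sigma> k / 2 * D (y k) = ?L / r" using L \<sigma>_pos[of k] D1 by (simp add: r_def)
    also have "(?L / r) powr (- s - 1) = ?L powr (- s - 1) * r powr (s + 1)"
    proof -
      have "r powr (- s - 1) = inverse (r powr (s + 1))" by (metis minus_add_distrib powr_minus diff_conv_add_uminus)
      then show ?thesis using L r by (simp add: powr_divide field_simps)
    qed
    also have "\<dots> \<le> ?L powr (- s - 1) * r powr p"
      using r p by (intro mult_left_mono powr_mono') auto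
    also have "\<dots> = b (y k)"
      unfolding r_def b_def using D1 \<sigma>_pos[of k] L by (simp add: powr_divide powr_mult powr_minus field_simps)
    finally show ?thesis .
  qed
  have fS: "finite ?S" using finite_W by simp
  have "(\<Sum>y\<in>?S. m y / M y * norm (c y - c x) powr (- s - 1)) \<le> (\<Sum>y\<in>?S. m y / M y * b (y k))"
    using kb m M0 by (intro sum_mono mult_left_mono) auto
  also have "\<dots> = (\<Sum>i\<in>(\<lambda>y. y k) ` ?S. \<Sum>y\<in>{y\<in>?S. y k = i}. m y / M y * b (y k))"
    by (rule sum.image_gen[OF fS])
  also have "\<dots> \<le> (\<Sum>i\<in>(\<lambda>y. y k) ` ?S. b i)"
  proof (rule sum_mono)
    fix i assume "i \<in> (\<lambda>y. y k) ` ?S"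
    then obtain z where z: "z \<in> ?S" "z k = i" by auto
    have MS: "{y\<in>?S. y k = i} = {y\<in>W. pre (Suc k) y = pre (Suc k) z}"
      using z unfolding S pre_def restrict_eq_iff by (auto simp: less_Suc_eq)
    have "(\<Sum>y\<in>{y\<in>?S. y k = i}. m y / M y * b (y k)) = (\<Sum>y\<in>{y\<in>?S. y k = i}. m y / M z * b i)"
    proof (rule sum.cong)
      fix y assume y: "y \<in> {y\<in>?S. y k = i}"
      then have "pre (Suc k) y = pre (Suc k) z" unfolding MS by simp
      then show "m y / M y * b (y k) = m y / M z * b i" using y by (simp add: M_def)
    qed simp
    also have "\<dots> = sum m {y\<in>?S. y k = i} / M z * b i" by (simp add: sum_divide_distrib sum_distrib_right)
    also have "\<dots> = M z / M z * b i" unfolding MS M_def ..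
    \<comment> \<open>The quotient is 1, or 0 for a child of mass zero.\<close>
    also have "\<dots> \<le> 1 * b i" using b0 by (intro mult_right_mono) auto
    finally show "(\<Sum>y\<in>{y\<in>?S. y k = i}. m y / M y * b (y k)) \<le> b i" by simp
  qed
  also have "\<dots> \<le> (\<Sum>i\<in>digits (2 ^ t k) - {x k}. b i)"
  proof (rule sum_mono2)
    show "(\<lambda>y. y k) ` ?S \<subseteq> digits (2 ^ t k) - {x k}"
      using S W_digit[OF _ k] by auto
  qed (use finite_digits b0 in auto)
  also have "\<dots> = (2 * ?L / \<sigma> k) powr p * (\<Sum>i\<in>digits (2 ^ t k) - {x k}. D i powr (- p)) * ?L powr (- s - 1)"
    by (simp add: b_def sum_distrib_left sum_distrib_right)
  also have "\<dots> \<le> (2 * ?L / \<sigma> k) powr p * (grid_const ?d p * (2 ^ t k) powr (real ?d - p)) * ?L powr (- s - 1)"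
    unfolding D_def by (intro mult_right_mono mult_left_mono grid_sum_bound W_digit[OF x k] p) auto
  finally show ?thesis unfolding M_def .
qed

theorem stage_mass_bound:
  fixes \<nu> :: "(real ^ 'n) measure" and p s \<omega> :: real
  defines "A \<equiv> transfer_const s"
  assumes s: "0 < s" and p: "0 < p" "p < real CARD('n)" "p \<le> s + 1"
    and l_small: "\<And>k. k < N \<Longrightarrow> 16 * l (Suc k) powr (2 * s) \<le> l k powr (2 * s)"
    and l_row: "\<And>k. k < N \<Longrightarrow> (2 * l (Suc k) / \<sigma> k) powr p *
        (grid_const CARD('n) p * (2 ^ t k) powr (real CARD('n) - p)) \<le> \<omega>"
    and \<omega>: "0 < \<omega>" "\<omega> \<le> 1" "lip_const s * \<omega> \<le> 1/4"
      "(4 * (18436 * A\<^sup>2) + 36864 * lip_const s) * \<omega> \<le> 1/2"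
    and \<nu>: "\<nu> \<in> radon_measures_on (stage l t N)"
    and bd: "esssup lebesgue (\<lambda>x. ereal (norm (riesz_transform s \<nu> x))) \<le> 1"
  shows "(measure \<nu> UNIV)\<^sup>2 * (\<Sum>k\<le>N. 1 / ((\<Prod>i<k. (2 ^ t i) ^ CARD('n)) * l k powr s)\<^sup>2) \<le> 36872 * A\<^sup>2"
proof -
  define pre where "pre k x = restrict x {..<k}" for k and x :: "nat \<Rightarrow> 'n \<Rightarrow> nat"
  define m where "m x = measure \<nu> (cball (c x) (l N / 2))" for x
  have m0: "0 \<le> m x" for x by (simp add: m_def)
  have pre_eq: "pre k x = pre k y \<longleftrightarrow> (\<forall>i<k. x i = y i)" for k x y
    unfolding pre_def by (rule restrict_eq_iff)
  interpret tr: separated_tree W pre c l N s \<omega> m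
  proof
    fix x y k assume "x \<in> W" "y \<in> W" "k < N" "pre k x = pre k y" "pre (Suc k) x \<noteq> pre (Suc k) y"
    then show "4 * l (Suc k) \<le> norm (c x - c y)"
      unfolding pre_eq by (intro center_separated) (auto simp: less_Suc_eq)
  next
    fix k x assume kx: "k < N" "x \<in> W"
    have "(\<Sum>y\<in>{y\<in>W. pre k y = pre k x \<and> pre (Suc k) y \<noteq> pre (Suc k) x}.
           m y / sum m {z\<in>W. pre (Suc k) z = pre (Suc k) y} * norm (c y - c x) powr (- s - 1))
       \<le> (2 * l (Suc k) / \<sigma> k) powr p * (grid_const CARD('n) p * (2 ^ t k) powr (real CARD('n) - p))
       * l (Suc k) powr (- s - 1)"
      unfolding pre_def by (rule row_bound[OF s p m0 kx])
    also have "\<dots> \<le> \<omega> * l (Suc k) powr (- s - 1)" by (intro mult_right_mono l_row kx) auto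
    finally show "(\<Sum>y\<in>{y\<in>W. pre k y = pre k x \<and> pre (Suc k) y \<noteq> pre (Suc k) x}.
           m y / sum m {z\<in>W. pre (Suc k) z = pre (Suc k) y} * norm (c y - c x) powr (- s - 1))
       \<le> \<omega> * l (Suc k) powr (- s - 1)" .
  qed (use s finite_W l_pos l_half l_small m0 center_close W_eqI in \<open>auto simp: pre_eq\<close>)
  have st: "stage l t N = (\<Union>x\<in>W. cball (c x) (l N / 2))" by (simp add: stage_def W_eq c_eq)
  \<comment> \<open>The leaves are balls of radius \<open>l N / 2\<close> at mutual distance at
    least \<open>4 * l N\<close>, so \<open>\<rho>\<close> is \<open>l N\<close> and
    \<open>D\<close> becomes \<open>slope_sum\<close>.\<close>
  note ds = discretize_riesz[OF s finite_W l_pos _ \<nu> st bd, folded m_def A_def]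
  have "(sum m W)\<^sup>2 * (\<Sum>k\<le>N. 1 / (real (card (pre k ` W)) * l k powr s)\<^sup>2) \<le> 36872 * A\<^sup>2"
  proof (rule tr.mass_bound[OF \<omega>])
    fix x assume x: "x \<in> W"
    show "norm (\<Sum>y\<in>W - {x}. m y *\<^sub>R riesz_kernel s (c y - c x)) \<le> A * (1 + tr.slope_sum x)"
      unfolding tr.slope_sum_def by (rule ds(2)[OF leaves_separated x])
    have "tr.density N x = m x / l N powr s"
      unfolding tr.density_def tr.mass_def tr.block_N[OF x] by simp
    then show "tr.density N x \<le> A * (1 + tr.slope_sum x)"
      unfolding tr.slope_sum_def using ds(3)[OF leaves_separated x] by simp
  qed
  moreover have le: "(\<Sum>k\<le>N. 1 / ((\<Prod>i<k. (2 ^ t i) ^ CARD('n)) * l k powr s)\<^sup>2)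
      \<le> (\<Sum>k\<le>N. 1 / (real (card (pre k ` W)) * l k powr s)\<^sup>2)"
  proof (rule sum_mono)
    fix k assume "k \<in> {..N}"
    then have k: "k \<le> N" by simp
    have "pre k x \<in> words t k" if "x \<in> W" for x
      unfolding pre_def words_def restrict_PiE_iff using W_digit[OF that] k by simp
    then have "pre k ` W \<subseteq> words t k" by blast
    then have "card (pre k ` W) \<le> card (words t k :: (nat \<Rightarrow> 'n \<Rightarrow> nat) set)" by (intro card_mono finite_words)
    from of_nat_mono[OF this, where 'a = real]
    have le: "real (card (pre k ` W)) \<le> (\<Prod>i<k. (2 ^ t i) ^ CARD('n))"
      unfolding card_words by simp
    have pos: "0 < card (pre k ` W)" using W_nonempty finite_W by (simp add: card_gt_0_iff)
    have lk: "0 < l k powr s" using l_pos[of k] by simp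
    show "1 / ((\<Prod>i<k. (2 ^ t i) ^ CARD('n)) * l k powr s)\<^sup>2 \<le> 1 / (real (card (pre k ` W)) * l k powr s)\<^sup>2"
      using le pos lk by (intro divide_left_mono power_mono mult_right_mono) (auto intro!: mult_pos_pos prod_pos)
  qed
  moreover have mW: "measure \<nu> UNIV = sum m W" by (rule ds(1)[OF leaves_separated])
  ultimately show ?thesis
    unfolding mW using order_trans[OF mult_left_mono[OF le zero_le_power2]] by blast
qed

end

lemma stage_0: "stage l t 0 = cball (0 :: real ^ 'n::finite) (l 0 / 2)"
  by (simp add: stage_def words_def center_def)

text \<open>Dropping the last digit moves the center by at most l(N)/4, and the smaller ball has
  radius at most l(N)/4.\<close>

lemma stage_Suc_subset:
  assumes lN: "0 < l N" and half: "l (Suc N) \<le> l N / 2"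
  shows "stage l t (Suc N) \<subseteq> (stage l t N :: (real ^ 'n::finite) set)"
proof
  fix w :: "real ^ 'n" assume "w \<in> stage l t (Suc N)"
  then obtain x where x: "x \<in> words t (Suc N)" and w: "norm (w - center l t (Suc N) x) \<le> l (Suc N) / 2"
    by (auto simp: stage_def dist_norm norm_minus_commute)
  let ?y = "restrict x {..<N}" and ?v = "grid_pt (x N) :: real ^ 'n"
  have y: "?y \<in> words t N"
    unfolding words_def restrict_PiE_iff using words_digit[OF x] by simp
  have c: "center l t (Suc N) x = center l t N ?y + spacing CARD('n) l t N *\<^sub>R ?v"
    unfolding center_def by simp
  have dig: "x N \<in> digits (2 ^ t N)" by (rule words_digit[OF x]) simp
  have "norm ?v \<le> (\<Sum>a\<in>UNIV. \<bar>?v $ a\<bar>)" by (rule norm_le_l1_cart)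
  also have "\<dots> \<le> (\<Sum>a\<in>(UNIV::'n set). 2 ^ t N)"
  proof (rule sum_mono)
    fix a
    have "x N a \<le> 2 ^ t N" using dig by (simp add: digits_def less_imp_le)
    from of_nat_mono[OF this, where 'a = real]
    show "\<bar>?v $ a\<bar> \<le> 2 ^ t N" by (simp add: grid_pt_def)
  qed
  also have "\<dots> = real CARD('n) * 2 ^ t N" by simp
  finally have "spacing CARD('n) l t N * norm ?v \<le> spacing CARD('n) l t N * (real CARD('n) * 2 ^ t N)"
    using lN by (intro mult_left_mono) (auto simp: spacing_def)
  also have "\<dots> = l N / 4" by (simp add: spacing_def)
  finally have v: "norm (spacing CARD('n) l t N *\<^sub>R ?v) \<le> l N / 4"
    using lN by (simp add: spacing_def)
  have "w - center l t N ?y = (w - center l t (Suc N) x) + spacing CARD('n) l t N *\<^sub>R ?v"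
    by (simp add: c)
  then have "norm (w - center l t N ?y) \<le> l (Suc N) / 2 + l N / 4"
    using w v norm_triangle_mono by metis
  also have "\<dots> \<le> l N / 2" using half by simp
  finally show "w \<in> stage l t N"
    unfolding stage_def using y by (force simp: dist_norm norm_minus_commute)
qed

text \<open>Counts the grid positions met by a ball: in \<open>cover_bound\<close>, 2 q is at most
  (48 d + 2) \<open>max 1 z\<close>, where 48 d = 12 * 4 d collects the normalisation of
  \<open>spacing\<close>.\<close>

definition cover_const :: "nat \<Rightarrow> real" where
  "cover_const d = (48 * real d + 2) ^ d"

section \<open>Mass distribution on a stage and coverings\<close>

context cantor_scales
begin

definition P :: "nat \<Rightarrow> real" where
  "P k = (\<Prod>i<k. (2 ^ t i) ^ CARD('n))"

lemma P_pos: "0 < P k"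
  unfolding P_def by (intro prod_pos) auto

lemma leaf_count:
  assumes x0: "x0 \<in> W" and k: "k < N" and fD: "finite D"
    and S: "\<And>x. x \<in> S \<Longrightarrow> x \<in> W \<and> (\<forall>i<k. x i = x0 i) \<and> x k \<in> D"
  shows "real (card S) * P (Suc k) \<le> real (card D) * P N"
proof -
  define F where "F i = (if i < k then {x0 i} else if i = k then D else digits (2 ^ t i))" for i
  have "S \<subseteq> PiE {..<N} F"
  proof
    fix x assume "x \<in> S"
    then have x: "x \<in> W" "\<forall>i<k. x i = x0 i" "x k \<in> D" using S by auto
    show "x \<in> PiE {..<N} F"
    proof (rule PiE_I)
      fix i assume "i \<in> {..<N}"
      then show "x i \<in> F i" using x(2,3) W_digit[OF x(1), of i] by (simp add: F_def)
    next
      fix i assume "i \<notin> {..<N}"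
      then show "x i = undefined" using x(1) unfolding W_eq words_def by (rule PiE_arb[rotated])
    qed
  qed
  moreover have fF: "finite (PiE {..<N} F)" using fD by (intro finite_PiE) (auto simp: F_def finite_digits)
  ultimately have "card S \<le> (\<Prod>i<N. card (F i))" by (simp add: card_mono card_PiE[symmetric])
  from of_nat_mono[OF this, where 'a = real]
  have "real (card S) \<le> (\<Prod>i<N. real (card (F i)))" by simp
  then have le: "real (card S) * P (Suc k) \<le> (\<Prod>i<N. real (card (F i))) * P (Suc k)"
    using P_pos[of "Suc k"] by simp
  have PS: "P (Suc k) = (\<Prod>i<N. if i \<le> k then (2 ^ t i) ^ CARD('n) else 1)"
  proof -
    have "{..<Suc k} = {i\<in>{..<N}. i \<le> k}" using k by auto
    then show ?thesis unfolding P_def by (simp only: prod.inter_filter[OF finite_lessThan])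
  qed
  have "(\<Prod>i<N. real (card (F i))) * (\<Prod>i<N. if i \<le> k then (2 ^ t i) ^ CARD('n) else 1)
     = (\<Prod>i<N. (if i = k then real (card D) else 1) * (2 ^ t i) ^ CARD('n))"
    unfolding prod.distrib[symmetric] by (intro prod.cong) (auto simp: F_def card_digits)
  also have "\<dots> = real (card D) * P N"
    unfolding prod.distrib P_def using k by simp
  finally show ?thesis using le unfolding PS[symmetric] by simp
qed

text \<open>Mass distribution principle for Lebesgue measure restricted to the stage: a ball of
  radius u carries at most the fraction \<open>cover_const\<close> * h(u) / h(l 0) of the volume,
  and the fractions of a covering add up to at least 1.\<close>

lemma cover_bound:
  fixes h :: "real \<Rightarrow> real" and b :: "'j \<Rightarrow> real ^ 'n" and r :: "'j \<Rightarrow> real"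
  assumes h_mono: "\<And>u v. 0 < u \<Longrightarrow> u \<le> v \<Longrightarrow> h u \<le> h v" and h_pos: "\<And>u. 0 < u \<Longrightarrow> 0 < h u"
    and h_anti: "\<And>u v. 0 < u \<Longrightarrow> u \<le> v \<Longrightarrow> h v / v ^ CARD('n) \<le> h u / u ^ CARD('n)"
    and h_l: "\<And>k. k \<le> N \<Longrightarrow> h (l k) * P k = h (l 0)"
    and J: "finite J" and r: "\<And>j. j \<in> J \<Longrightarrow> 0 < r j"
    and cov: "stage l t N \<subseteq> (\<Union>j\<in>J. ball (b j) (r j))"
  shows "h (l 0) \<le> cover_const CARD('n) * (\<Sum>j\<in>J. h (r j))"
proof -
  let ?d = "CARD('n)" and ?C = "cover_const CARD('n)"
  define B where "B x = cball (c x) (l N / 2)" for x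
  let ?U = "\<Union>x\<in>W. B x"
  define V where "V = unit_ball_vol (real ?d)"
  define vol where "vol = V * (l N / 2) ^ ?d"
  have V0: "0 < V" by (simp add: V_def)
  have vol0: "0 < vol" using V0 l_pos[of N] by (simp add: vol_def)
  have volB: "measure lborel (B x) = vol" for x
    using content_cball[of "l N / 2" "c x"] l_pos[of N] by (simp add: B_def vol_def V_def)
  have fmB: "B x \<in> fmeasurable lborel" for x unfolding B_def by (intro fmeasurableI emeasure_lborel_cball_finite) simp
  have E: "stage l t N = ?U" by (simp add: stage_def B_def W_eq c_eq)
  have hl0: "0 < h (l 0)" by (rule h_pos[OF l_pos])
  have C2: "2 ^ ?d \<le> ?C" unfolding cover_const_def by (intro power_mono) auto
  have C1: "1 \<le> ?C" using C2 order_trans[OF one_le_power[of 2 ?d] C2] by simp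
  have cardW: "real (card W) = P N" unfolding W_eq card_words P_def by simp
  have measE: "measure lborel ?U = P N * vol"
  proof -
    have "disjoint_family_on B W"
      unfolding B_def by (rule disjoint_cballs) (use leaves_separated l_pos[of N] in force)
    then have "measure lborel ?U = (\<Sum>x\<in>W. measure lborel (B x))"
      using fmB finite_W by (intro measure_finite_Union) (auto simp: fmeasurable_def less_top)
    also have "\<dots> = P N * vol" using cardW by (simp add: volB)
    finally show ?thesis .
  qed
  have few: "measure lborel (?U \<inter> ball a u) \<le> ?C * (h u / h (l 0)) * (P N * vol)"
    if u: "0 < u" for a :: "real ^ 'n" and u
  proof -
    have hu: "0 < h u" by (rule h_pos[OF u])
    have mE: "?U \<in> fmeasurable lborel"
      using finite_W fmB by (intro fmeasurable.finite_UN) auto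
    consider "u < l N" | "l 0 \<le> u" | "l N \<le> u" "u < l 0" by linarith
    then show ?thesis
    proof cases
      \<comment> \<open>Below the size of a leaf the volume of the ball itself suffices, as h(r) /
        r^d is nonincreasing.\<close>
      case 1
      have "measure lborel (?U \<inter> ball a u) \<le> measure lborel (ball a u)"
        using mE by (intro measure_mono_fmeasurable) (auto intro!: fmeasurableI emeasure_lborel_ball_finite simp: fmeasurableD)
      also have "\<dots> = V * u ^ ?d" using content_ball[of u a] u by (simp add: V_def)
      also have "\<dots> \<le> V * (2 ^ ?d * (h u / h (l 0)) * P N * (l N / 2) ^ ?d)"
      proof (intro mult_left_mono)
        have "h (l N) / l N ^ ?d \<le> h u / u ^ ?d" using h_anti[OF u, of "l N"] 1 by simp
        then have "u ^ ?d \<le> h u * l N ^ ?d / h (l N)"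
          using u l_pos[of N] h_pos[OF l_pos, of N] by (simp add: field_simps)
        also have "h (l N) = h (l 0) / P N" using h_l[of N] P_pos[of N] by (simp add: field_simps)
        also have "h u * l N ^ ?d / (h (l 0) / P N) = 2 ^ ?d * (h u / h (l 0)) * P N * (l N / 2) ^ ?d"
          by (simp add: power_divide)
        finally show "u ^ ?d \<le> 2 ^ ?d * (h u / h (l 0)) * P N * (l N / 2) ^ ?d" .
      qed (use V0 in auto)
      also have "\<dots> = 2 ^ ?d * ((h u / h (l 0)) * (P N * vol))" by (simp add: vol_def mult_ac)
      also have "\<dots> \<le> ?C * ((h u / h (l 0)) * (P N * vol))"
        using C2 hu hl0 P_pos[of N] vol0 by (intro mult_right_mono) auto
      finally show ?thesis by (simp add: mult_ac)
    next
      case 2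
      have "measure lborel (?U \<inter> ball a u) \<le> 1 * 1 * (P N * vol)"
        using mE measE measure_mono_fmeasurable[of "?U \<inter> ball a u" ?U lborel]
        by (auto simp: fmeasurable_def)
      also have "\<dots> \<le> ?C * (h u / h (l 0)) * (P N * vol)"
        using C1 h_mono[OF l_pos 2] hl0 P_pos[of N] vol0
        by (intro mult_right_mono mult_mono) auto
      finally show ?thesis .
    next
      case 3
      have "\<exists>k<N. l (Suc k) \<le> u \<and> u < l k"
      proof -
        define v where "v = (LEAST v. l v \<le> u)"
        have v: "l v \<le> u" unfolding v_def using 3(1) by (rule LeastI)
        have vN: "v \<le> N" unfolding v_def using 3(1) by (rule Least_le)
        have "v \<noteq> 0" using v 3(2) by (intro notI) simp
        then obtain k where k: "v = Suc k" by (cases v) auto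
        have "\<not> l k \<le> u" using not_less_Least[of k "\<lambda>v. l v \<le> u"] k by (simp add: v_def)
        then show ?thesis using k v vN by (intro exI[of _ k]) auto
      qed
      then obtain k where k: "k < N" "l (Suc k) \<le> u" "u < l k" by blast
      define S where "S = {x\<in>W. B x \<inter> ball a u \<noteq> {}}"
      \<comment> \<open>The integer part plus one lies strictly above
        \<open>6 * u / \<sigma> k\<close>, as the open sup norm ball of digits needs.\<close>
      define q where "q = nat \<lfloor>6 * u / \<sigma> k\<rfloor> + 1"
      have q: "6 * u / \<sigma> k < real q" "real q \<le> 6 * u / \<sigma> k + 1"
        using u \<sigma>_pos[of k] unfolding q_def by (auto simp: of_nat_nat) linarith+
      have near: "norm (c x - c y) \<le> 3 * u" if xy: "x \<in> S" "y \<in> S" for x y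
      proof -
        have d: "norm (c z - a) \<le> l N / 2 + u" if zS: "z \<in> S" for z
        proof -
          obtain w where "w \<in> B z" "w \<in> ball a u" using zS unfolding S_def by blast
          then have "norm (c z - w) \<le> l N / 2" "norm (w - a) < u"
            by (simp_all add: B_def dist_norm norm_minus_commute)
          then show ?thesis using norm_triangle_ineq[of "c z - w" "w - a"] by simp
        qed
        have "norm (c x - c y) \<le> norm (c x - a) + norm (c y - a)"
          using norm_triangle_ineq4[of "c x - a" "c y - a"] by simp
        then show ?thesis using d[OF xy(1)] d[OF xy(2)] 3(1) by linarith
      qed
      have cS: "real (card S) * P (Suc k) \<le> (2 * real q) ^ ?d * P N"
      proof (cases "S = {}")
        case False
        then obtain x0 where x0: "x0 \<in> S" by auto
        then have x0W: "x0 \<in> W" by (simp add: S_def)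
        let ?D = "{i. infnorm (grid_pt i - grid_pt (x0 k)) < real q}"
        have "x \<in> W \<and> (\<forall>i<k. x i = x0 i) \<and> x k \<in> ?D" if x: "x \<in> S" for x
        proof -
          have xW: "x \<in> W" using x by (simp add: S_def)
          have agree: "x i = x0 i" if i: "i < k" for i
          proof (rule ccontr)
            assume ne: "x i \<noteq> x0 i"
            then have "x \<noteq> x0" by auto
            then obtain j where j: "j < N" "\<And>i. i < j \<Longrightarrow> x i = x0 i" "x j \<noteq> x0 j"
              using first_difference[OF xW x0W] by blast
            have "j < k" using j(2)[of i] ne i by (cases "i < j") auto
            \<comment> \<open>Leaves separating before generation k are at least 4 l(k) apart, but
              both meet a ball of radius u < l(k).\<close>
            then have "l k \<le> l (Suc j)" using k(1) by (intro l_mono) auto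
            moreover have "4 * l (Suc j) \<le> norm (c x - c x0)"
              using center_separated[OF xW x0W j] .
            ultimately show False using near[OF x x0] k(3) u by linarith
          qed
          have "infnorm (grid_pt (x k) - grid_pt (x0 k)) < real q"
          proof (cases "x k = x0 k")
            case True
            then show ?thesis by (simp add: infnorm_0 q_def)
          next
            case False
            have "\<sigma> k / 2 * infnorm (grid_pt (x k) - grid_pt (x0 k)) \<le> 3 * u"
              using center_apart[OF xW x0W k(1) agree False] near[OF x x0] by linarith
            then have "infnorm (grid_pt (x k) - grid_pt (x0 k)) \<le> 6 * u / \<sigma> k"
              using \<sigma>_pos[of k] by (simp add: field_simps)
            then show ?thesis using q(1) by linarith
          qed
          then show ?thesis using xW agree by simp
        qed
        from leaf_count[OF x0W k(1) card_infnorm_ball(1) this]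
        have "real (card S) * P (Suc k) \<le> real (card ?D) * P N" .
        also have "\<dots> \<le> real ((2 * q) ^ ?d) * P N"
          using card_infnorm_ball(2)[of "x0 k" q] P_pos[of N] by (intro mult_right_mono of_nat_mono) auto
        finally show ?thesis by simp
      qed (use P_pos[of N] in simp)
      define H where "H = h u * P (Suc k) / h (l 0)"
      have "h (l (Suc k)) * P (Suc k) \<le> h u * P (Suc k)"
        using h_mono[OF l_pos k(2)] P_pos[of "Suc k"] by simp
      then have H1: "1 \<le> H" using h_l[of "Suc k"] k(1) hl0 by (simp add: H_def)
      \<comment> \<open>z is u divided by the side of the grid cells at generation k, up to the
        factor 4 d. Both 1 and z^d are at most \<open>H\<close>: the former since h increases, the
        latter since h(r) / r^d does not.\<close>
      define z where "z = u / (4 * real ?d * \<sigma> k)"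
      have z0: "0 < z" using u \<sigma>_pos[of k] by (simp add: z_def)
      have zH: "z ^ ?d \<le> H"
      proof -
        have zu: "z = u * 2 ^ t k / l k" unfolding z_def \<sigma>_eq spacing_def using l_pos[of k] by simp
        have "h (l k) / l k ^ ?d \<le> h u / u ^ ?d" using h_anti[OF u, of "l k"] k by simp
        then have "h (l k) * u ^ ?d / l k ^ ?d \<le> h u" using u by (simp add: field_simps)
        then have "(h (l k) * u ^ ?d / l k ^ ?d) * P (Suc k) / h (l 0) \<le> H"
          unfolding H_def using hl0 P_pos[of "Suc k"] by (intro divide_right_mono mult_right_mono) auto
        moreover have "(h (l k) * u ^ ?d / l k ^ ?d) * P (Suc k) / h (l 0)
           = (h (l k) * P k / h (l 0)) * z ^ ?d"
          unfolding zu by (simp add: P_def power_divide power_mult_distrib mult_ac)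
        moreover have "h (l k) * P k / h (l 0) = 1" using h_l[of k] k hl0 by simp
        ultimately show ?thesis by simp
      qed
      have "2 * real q \<le> (48 * real ?d + 2) * max 1 z"
      proof -
        have "2 * real q \<le> 12 * u / \<sigma> k + 2" using q(2) by simp
        also have "12 * u / \<sigma> k = 48 * real ?d * z" using \<sigma>_pos[of k] by (simp add: z_def)
        also have "48 * real ?d * z + 2 \<le> 48 * real ?d * max 1 z + 2 * max 1 z"
          by (intro add_mono mult_left_mono) auto
        finally show ?thesis by (simp add: algebra_simps)
      qed
      then have "(2 * real q) ^ ?d \<le> ((48 * real ?d + 2) * max 1 z) ^ ?d" by (intro power_mono) auto
      also have "\<dots> = ?C * max 1 z ^ ?d" by (simp add: cover_const_def power_mult_distrib)
      also have "\<dots> \<le> ?C * H" using H1 zH C1 by (intro mult_left_mono) (auto simp: max_def)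
      finally have "(2 * real q) ^ ?d * P N \<le> ?C * H * P N" using P_pos[of N] by (intro mult_right_mono) auto
      with cS have "real (card S) * P (Suc k) \<le> (?C * (h u / h (l 0)) * P N) * P (Suc k)"
        by (simp add: H_def mult_ac)
      then have cS': "real (card S) \<le> ?C * (h u / h (l 0)) * P N"
        using P_pos[of "Suc k"] by (simp only: mult_le_cancel_right_pos)
      have fS: "finite S" using finite_W by (simp add: S_def)
      have "measure lborel (?U \<inter> ball a u) \<le> measure lborel (\<Union>x\<in>S. B x)"
        using mE fmB fS
        by (intro measure_mono_fmeasurable fmeasurable.finite_UN) (auto simp: S_def fmeasurable_def)
      also have "\<dots> \<le> (\<Sum>x\<in>S. measure lborel (B x))"
        using fS fmB by (intro measure_UNION_le) (auto simp: fmeasurable_def)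
      also have "\<dots> = real (card S) * vol" by (simp add: volB)
      also have "\<dots> \<le> ?C * (h u / h (l 0)) * P N * vol" using cS' vol0 by (intro mult_right_mono) auto
      finally show ?thesis by (simp add: mult_ac)
    qed
  qed
  have mE: "?U \<in> fmeasurable lborel"
    using finite_W fmB by (intro fmeasurable.finite_UN) auto
  have "P N * vol = measure lborel (\<Union>j\<in>J. ?U \<inter> ball (b j) (r j))"
  proof -
    have "?U = (\<Union>j\<in>J. ?U \<inter> ball (b j) (r j))" using cov unfolding E by blast
    then show ?thesis using measE by simp
  qed
  also have "\<dots> \<le> (\<Sum>j\<in>J. measure lborel (?U \<inter> ball (b j) (r j)))"
    using J mE by (intro measure_UNION_le) (auto simp: fmeasurable_def)
  also have "\<dots> \<le> (\<Sum>j\<in>J. ?C * (h (r j) / h (l 0)) * (P N * vol))" by (intro sum_mono few r)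
  also have "\<dots> = (?C * (\<Sum>j\<in>J. h (r j)) / h (l 0)) * (P N * vol)"
    by (simp add: sum_distrib_left sum_distrib_right sum_divide_distrib)
  finally have "1 * (P N * vol) \<le> (?C * (\<Sum>j\<in>J. h (r j)) / h (l 0)) * (P N * vol)" by simp
  then have "1 \<le> ?C * (\<Sum>j\<in>J. h (r j)) / h (l 0)"
    using P_pos[of N] vol0 by (simp only: mult_le_cancel_right_pos[OF mult_pos_pos])
  then show ?thesis using hl0 by (simp add: field_simps)
qed

end

subsection \<open>Selection of the scales\<close>

locale gauge =
  fixes h :: "real \<Rightarrow> real" and d :: nat
  assumes gauge: "measure_function h" and anti: "antimono_on {0<..} (\<lambda>r. h r / r ^ d)" and d_pos: "0 < d"
begin

lemma h_strict: "0 \<le> u \<Longrightarrow> u < v \<Longrightarrow> h u < h v"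
  using gauge by (auto simp: measure_function_def strict_mono_on_def)

lemma h_mono: "0 \<le> u \<Longrightarrow> u \<le> v \<Longrightarrow> h u \<le> h v"
  using h_strict[of u v] by (cases "u = v") auto

lemma h_pos: "0 < u \<Longrightarrow> 0 < h u"
  using h_strict[of 0 u] gauge by (simp add: measure_function_def)

lemma h_anti: "0 < u \<Longrightarrow> u \<le> v \<Longrightarrow> h v / v ^ d \<le> h u / u ^ d"
  using anti by (auto simp: monotone_on_def)

definition lam :: "nat \<Rightarrow> real" where
  "lam j = (SOME r. 0 < r \<and> h r = h 1 / 2 ^ (d * j))"

lemma h_attains:
  assumes "0 < y" "y \<le> h b" "0 \<le> b"
  obtains r where "0 < r" "r \<le> b" "h r = y"
proof -
  have h0: "h 0 = 0" and c: "continuous_on {0..} h" using gauge by (auto simp: measure_function_def)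
  have "continuous_on {0..b} h" using c by (rule continuous_on_subset) auto
  then obtain r where "0 \<le> r" "r \<le> b" "h r = y" using IVT'[of h 0 y b] assms h0 by auto
  then show thesis using that[of r] h0 assms by (cases "r = 0") auto
qed

lemma lam: "0 < lam j" "h (lam j) = h 1 / 2 ^ (d * j)"
proof -
  have "h 1 / 2 ^ (d * j) \<le> h 1" using h_pos[of 1] by (simp add: field_simps)
  then obtain r where "0 < r \<and> h r = h 1 / 2 ^ (d * j)"
    using h_attains[of "h 1 / 2 ^ (d * j)" 1] h_pos[of 1] by auto
  then have "0 < lam j \<and> h (lam j) = h 1 / 2 ^ (d * j)" unfolding lam_def by (rule someI)
  then show "0 < lam j" "h (lam j) = h 1 / 2 ^ (d * j)" by auto
qed

lemma lam_0: "lam 0 = 1"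
proof -
  have "h (lam 0) = h 1" using lam(2)[of 0] by simp
  then show ?thesis using h_strict[of "lam 0" 1] h_strict[of 1 "lam 0"] lam(1)[of 0]
    by (cases "lam 0" "1::real" rule: linorder_cases) auto
qed

text \<open>Halving r divides h by at most 2^d because h(r) / r^d is nonincreasing; so h cannot drop
  by 2^d before r has halved.\<close>

lemma lam_half: "lam (Suc j) \<le> lam j / 2"
proof (rule ccontr)
  let ?u = "lam j / 2"
  assume "\<not> lam (Suc j) \<le> ?u"
  then have "h ?u < h (lam (Suc j))" using lam(1)[of j] by (intro h_strict) auto
  also have "\<dots> = h (lam j) / 2 ^ d" by (simp add: lam(2) power_add)
  also have "\<dots> \<le> h ?u"
    using h_anti[of ?u "lam j"] lam(1)[of j] by (simp add: power_divide field_simps)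
  finally show False by simp
qed

lemma lam_add: "lam (j + i) \<le> lam j / 2 ^ i"
proof (induction i)
  case (Suc i)
  then show ?case using lam_half[of "j + i"] by simp
qed simp

lemma lam_antimono: "j \<le> i \<Longrightarrow> lam i \<le> lam j"
proof -
  assume "j \<le> i"
  then have "lam i \<le> lam j / 2 ^ (i - j)" using lam_add[of j "i - j"] by simp
  also have "\<dots> \<le> lam j / 1" using lam(1)[of j] by (intro divide_left_mono) auto
  finally show ?thesis by simp
qed

end

text \<open>All conditions on \<open>J\<close> involve only d, s, \<open>\<beta>\<close>, p and
  \<open>\<omega>\<close>, so a single \<open>J\<close> serves every gauge function.\<close>

locale selection = gauge +
  fixes s \<beta> p \<omega> :: real and J :: nat
  assumes s_pos: "0 < s" and s_less: "s < \<beta>" and \<beta>_less: "\<beta> < p" and p_less: "p < real d"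
    and J_pos: "0 < J"
    and J_spacing: "32 * real d * 2 powr (- (real J * (real d / \<beta> - 1))) \<le> 1"
    and J_small: "16 * 2 powr (- (2 * s * real J)) \<le> 1"
    and J_row: "(8 * real d) powr p * grid_const d p
        * 2 powr (- (real J * (real d * (p / \<beta> - 1)))) \<le> \<omega>"
begin

text \<open>Up to a constant this is lam(j) / h(lam j)^(1/\<open>\<beta>\<close>), so
  \<open>a j \<le> a i\<close> says that h(lam j) / h(lam i) is at least (lam j / lam
  i)^\<open>\<beta>\<close>.\<close>

definition a :: "nat \<Rightarrow> real" where
  "a j = lam j * 2 powr (real j * real d / \<beta>)"

definition admissible :: "nat \<Rightarrow> nat \<Rightarrow> bool" where
  "admissible i j \<longleftrightarrow> i + J \<le> j \<and> a j \<le> a i"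

text \<open>The selection may stop: then \<open>LEAST\<close> is unspecified, and only the first \<open>N\<close> steps with
  \<open>valid N\<close> are meaningful.\<close>

primrec js :: "nat \<Rightarrow> nat" where
  "js 0 = 0"
| "js (Suc k) = (LEAST j. admissible (js k) j)"

declare js.simps(2) [simp del]

definition valid :: "nat \<Rightarrow> bool" where
  "valid N \<longleftrightarrow> (\<forall>k<N. \<exists>j. admissible (js k) j)"

definition l :: "nat \<Rightarrow> real" where "l k = lam (js k)"
definition t :: "nat \<Rightarrow> nat" where "t k = js (Suc k) - js k"

lemma \<beta>_pos: "0 < \<beta>" and p_pos: "0 < p"
  using s_pos s_less \<beta>_less by auto

lemma js_admissible:
  assumes "valid N" "k < N"
  shows "admissible (js k) (js (Suc k))"
proof -
  have "\<exists>j. admissible (js k) j" using assms by (simp add: valid_def)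
  then show ?thesis unfolding js.simps by (rule LeastI_ex)
qed

lemma js_Suc: "valid N \<Longrightarrow> k < N \<Longrightarrow> js (Suc k) = js k + t k \<and> J \<le> t k"
  using js_admissible[of N k] unfolding admissible_def t_def by arith

lemma l_pos: "0 < l k"
  by (simp add: l_def lam)

lemma l_0: "l 0 = 1"
  by (simp add: l_def lam_0)

lemma l_ratio:
  assumes "valid N" "k < N"
  shows "l (Suc k) \<le> l k * 2 powr (- (real (t k) * real d / \<beta>))"
proof -
  let ?i = "js k" and ?q = "t k"
  have eq: "a (?i + ?q) = (lam (?i + ?q) * 2 powr (real ?q * real d / \<beta>)) * 2 powr (real ?i * real d / \<beta>)"
    by (simp add: a_def distrib_right add_divide_distrib powr_add)
  have "a (?i + ?q) \<le> a ?i" using js_admissible[OF assms] js_Suc[OF assms] by (simp add: admissible_def)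
  then have "(lam (?i + ?q) * 2 powr (real ?q * real d / \<beta>)) * 2 powr (real ?i * real d / \<beta>)
      \<le> lam ?i * 2 powr (real ?i * real d / \<beta>)"
    unfolding eq a_def[of ?i] .
  then have "lam (?i + ?q) * 2 powr (real ?q * real d / \<beta>) \<le> lam ?i"
    by (rule mult_right_le_imp_le) simp
  then have "lam (?i + ?q) \<le> lam ?i / 2 powr (real ?q * real d / \<beta>)" by (simp add: pos_le_divide_eq)
  then show ?thesis using js_Suc[OF assms] by (simp add: l_def powr_minus divide_inverse)
qed

lemma exponent_mono:
  assumes "valid N" "k < N" "0 \<le> x"
  shows "2 powr (- (real (t k) * x)) \<le> 2 powr (- (real J * x))"
  using js_Suc[OF assms(1,2)] assms(3) by (intro powr_mono) (auto intro: mult_right_mono)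

lemma l_ratio_half_power:
  assumes "valid N" "k < N"
  shows "l (Suc k) \<le> l k * 2 powr (- real (t k))"
proof -
  have "real (t k) * 1 \<le> real (t k) * (real d / \<beta>)"
    using \<beta>_less p_less \<beta>_pos by (intro mult_left_mono) auto
  then have "2 powr (- (real (t k) * real d / \<beta>)) \<le> 2 powr (- real (t k))" by simp
  then have "l k * 2 powr (- (real (t k) * real d / \<beta>)) \<le> l k * 2 powr (- real (t k))"
    using l_pos[of k] by (intro mult_left_mono) auto
  then show ?thesis using l_ratio[OF assms] by linarith
qed

lemma l_half:
  assumes "valid N" "k < N"
  shows "l (Suc k) \<le> l k / 2"
proof -
  have "2 powr (- real (t k)) \<le> 2 powr (- 1)" using js_Suc[OF assms] J_pos by (intro powr_mono) auto
  then have "l k * 2 powr (- real (t k)) \<le> l k * (1 / 2)"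
    using l_pos[of k] by (intro mult_left_mono) (auto simp: powr_minus)
  then show ?thesis using l_ratio_half_power[OF assms] by simp
qed

lemma l_spacing:
  assumes "valid N" "k < N"
  shows "8 * l (Suc k) \<le> spacing d l t k"
proof -
  let ?q = "real (t k)" and ?x = "real d / \<beta> - 1"
  have x: "0 \<le> ?x" using \<beta>_less p_less \<beta>_pos by simp
  have "32 * real d * 2 powr (- (?q * ?x)) \<le> 32 * real d * 2 powr (- (real J * ?x))"
    by (intro mult_left_mono exponent_mono[OF assms x]) auto
  then have e: "32 * real d * 2 powr (- (?q * ?x)) \<le> 1" using J_spacing by linarith
  have "8 * l (Suc k) * (4 * real d * 2 ^ t k) = 32 * real d * (2 powr ?q * l (Suc k))"
    by (simp add: powr_realpow)
  also have "\<dots> \<le> 32 * real d * (2 powr ?q * (l k * 2 powr (- (?q * real d / \<beta>))))"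
    using l_ratio[OF assms] by (intro mult_left_mono) auto
  also have "\<dots> = 32 * real d * (2 powr ?q * 2 powr (- (?q * real d / \<beta>))) * l k" by simp
  also have "2 powr ?q * 2 powr (- (?q * real d / \<beta>)) = 2 powr (- (?q * ?x))"
    by (simp add: algebra_simps flip: powr_add)
  also have "32 * real d * 2 powr (- (?q * ?x)) * l k \<le> 1 * l k"
    using e l_pos[of k] by (intro mult_right_mono) auto
  finally show ?thesis unfolding spacing_def using d_pos by (simp add: pos_le_divide_eq)
qed

lemma l_small:
  assumes "valid N" "k < N"
  shows "16 * l (Suc k) powr (2 * s) \<le> l k powr (2 * s)"
proof -
  have "l (Suc k) powr (2 * s) \<le> (l k * 2 powr (- real (t k))) powr (2 * s)"
    using l_ratio_half_power[OF assms] l_pos[of "Suc k"] s_pos by (intro powr_mono2) auto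
  also have "\<dots> = l k powr (2 * s) * 2 powr (- (real (t k) * (2 * s)))"
    using l_pos[of k] by (simp add: powr_mult powr_powr)
  also have "\<dots> \<le> l k powr (2 * s) * 2 powr (- (real J * (2 * s)))"
    using s_pos by (intro mult_left_mono exponent_mono[OF assms]) auto
  finally have "16 * l (Suc k) powr (2 * s) \<le> l k powr (2 * s) * (16 * 2 powr (- (2 * s * real J)))"
    by (simp add: mult_ac)
  also have "\<dots> \<le> l k powr (2 * s) * 1" using J_small by (intro mult_left_mono) auto
  finally show ?thesis by simp
qed

text \<open>A step of length t has size ratio at most 2^(-td/\<open>\<beta>\<close>), so the
  exponents combine to pt(1 - d/\<open>\<beta>\<close>) + t(d - p) = -td(p/\<open>\<beta>\<close> -
  1), negative because p > \<open>\<beta>\<close>.\<close>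

lemma l_row:
  assumes "valid N" "k < N"
  shows "(2 * l (Suc k) / spacing d l t k) powr p *
        (grid_const d p * (2 ^ t k) powr (real d - p)) \<le> \<omega>"
proof -
  let ?q = "real (t k)" and ?g = "grid_const d p" and ?x = "real d * (p / \<beta> - 1)"
  have "1 < 2 powr (real d - p)" using p_less by (intro gr_one_powr) auto
  then have g0: "0 \<le> ?g" by (simp add: grid_const_def)
  have x: "0 \<le> ?x" using \<beta>_less \<beta>_pos by simp
  have "2 * l (Suc k) / spacing d l t k = 8 * real d * (2 powr ?q * (l (Suc k) / l k))"
    using l_pos[of k] by (simp add: spacing_def powr_realpow)
  also have "\<dots> \<le> 8 * real d * (2 powr ?q * 2 powr (- (?q * real d / \<beta>)))"
    using l_ratio[OF assms] l_pos[of k] by (intro mult_left_mono) (auto simp: field_simps)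
  finally have "(2 * l (Suc k) / spacing d l t k) powr p
      \<le> (8 * real d * (2 powr ?q * 2 powr (- (?q * real d / \<beta>)))) powr p"
    using l_pos[of "Suc k"] l_pos[of k] p_pos by (intro powr_mono2) (auto simp: spacing_def)
  also have "\<dots> = (8 * real d) powr p * 2 powr ((?q - ?q * real d / \<beta>) * p)"
    by (simp add: powr_mult powr_powr flip: powr_add)
  finally have "(2 * l (Suc k) / spacing d l t k) powr p * (?g * (2 ^ t k) powr (real d - p))
      \<le> (8 * real d) powr p * 2 powr ((?q - ?q * real d / \<beta>) * p) * (?g * (2 ^ t k) powr (real d - p))"
    by (rule mult_right_mono) (intro mult_nonneg_nonneg g0, simp)
  also have pw: "(2 ^ t k) powr (real d - p) = 2 powr (?q * (real d - p))"
    by (simp add: powr_powr flip: powr_realpow)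
  also have "(8 * real d) powr p * 2 powr ((?q - ?q * real d / \<beta>) * p) * (?g * 2 powr (?q * (real d - p)))
     = (8 * real d) powr p * ?g * (2 powr ((?q - ?q * real d / \<beta>) * p) * 2 powr (?q * (real d - p)))"
    by simp
  also have "2 powr ((?q - ?q * real d / \<beta>) * p) * 2 powr (?q * (real d - p)) = 2 powr (- (?q * ?x))"
  proof -
    have "(?q - ?q * real d / \<beta>) * p + ?q * (real d - p) = - (?q * ?x)" by (simp add: algebra_simps)
    then show ?thesis by (simp flip: powr_add)
  qed
  also have "(8 * real d) powr p * ?g * 2 powr (- (?q * ?x)) \<le> (8 * real d) powr p * ?g * 2 powr (- (real J * ?x))"
    by (intro mult_left_mono exponent_mono[OF assms x] mult_nonneg_nonneg g0) simp
  also have "\<dots> \<le> \<omega>" by (rule J_row)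
  finally show ?thesis unfolding pw .
qed

section \<open>Numbers of cubes, and comparison with the sum over all scales\<close>

lemma prod_counts:
  assumes "valid N" "k \<le> N"
  shows "(\<Prod>i<k. (2 ^ t i) ^ d) = (2::real) ^ (d * js k)"
  using assms(2)
proof (induction k)
  case (Suc k)
  have "js (Suc k) = js k + t k" using js_Suc[OF assms(1)] Suc.prems by simp
  then show ?case using Suc by (simp add: power_add distrib_left mult.commute[of d "t k"] power_mult[symmetric])
qed simp

lemma h_l:
  assumes "valid N" "k \<le> N"
  shows "h (l k) * (\<Prod>i<k. (2 ^ t i) ^ d) = h (l 0)"
  unfolding prod_counts[OF assms] by (simp add: l_def lam(2))

text \<open>Equals (h(lam j) / (lam j)^s)^2 / h(1)^2. At a selected scale it is also the term of
  \<open>stage_mass_bound\<close>, where 2^(dj) is the number of cubes.\<close>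

definition v :: "nat \<Rightarrow> real" where
  "v j = 1 / (2 ^ (d * j) * lam j powr s)\<^sup>2"

lemma v_pos: "0 < v j"
  using lam(1)[of j] by (simp add: v_def)

definition \<rho> :: real where "\<rho> = 2 powr (- (2 * real d * (1 - s / \<beta>)))"

lemma \<rho>: "0 < \<rho>" "\<rho> < 1"
proof -
  show "0 < \<rho>" by (simp add: \<rho>_def)
  have "0 < 2 * real d * (1 - s / \<beta>)" using d_pos s_less \<beta>_pos by (intro mult_pos_pos) auto
  then show "\<rho> < 1" unfolding \<rho>_def using powr_less_mono[of _ 0 "2::real"] by simp
qed

text \<open>A blocked scale satisfies lam(i+q) > lam(i) 2^(-qd/\<open>\<beta>\<close>). So lam^(-2s)
  grows at most by 2^(2sqd/\<open>\<beta>\<close>), while the count contributes 2^(-2dq); the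
  product is \<open>\<rho> ^ q\<close>.\<close>

lemma v_blocked:
  assumes "a i < a (i + q)"
  shows "v (i + q) \<le> v i * \<rho> ^ q"
proof -
  let ?e = "2 powr (real q * real d / \<beta>)"
  have "lam i * 2 powr (real i * real d / \<beta>) < lam (i + q) * (2 powr (real i * real d / \<beta>) * ?e)"
    using assms by (simp add: a_def distrib_right add_divide_distrib powr_add)
  then have "lam i * 2 powr (real i * real d / \<beta>) < (lam (i + q) * ?e) * 2 powr (real i * real d / \<beta>)"
    by (simp add: mult_ac)
  then have "lam i < lam (i + q) * ?e" by simp
  then have "lam i powr (2 * s) \<le> (lam (i + q) * ?e) powr (2 * s)"
    using lam(1)[of i] s_pos by (intro powr_mono2) auto
  also have "\<dots> = lam (i + q) powr (2 * s) * 2 powr (real q * real d / \<beta> * (2 * s))"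
    using lam(1)[of "i + q"] by (simp add: powr_mult powr_powr)
  finally have 1: "lam i powr (2 * s) \<le> lam (i + q) powr (2 * s) * 2 powr (real q * real d / \<beta> * (2 * s))" .
  have sq: "v j = 1 / (2 ^ (d * j) * 2 ^ (d * j) * lam j powr (2 * s))" for j
    using powr_add[of "lam j" s s] by (simp add: v_def power2_eq_square mult_ac)
  have r: "\<rho> ^ q * (2 ^ (d * q) * 2 ^ (d * q)) = 2 powr (real q * real d / \<beta> * (2 * s))"
  proof -
    have "\<rho> ^ q = 2 powr (- (2 * real d * (1 - s / \<beta>)) * real q)"
      using \<rho>(1) by (simp add: \<rho>_def powr_powr flip: powr_realpow)
    moreover have "2 ^ (d * q) = 2 powr (real d * real q)" by (simp flip: powr_realpow)
    moreover have "- (2 * real d * (1 - s / \<beta>)) * real q + (real d * real q + real d * real q)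
        = real q * real d / \<beta> * (2 * s)" by (simp add: algebra_simps)
    ultimately show ?thesis by (simp only: powr_add[symmetric])
  qed
  have pos: "0 < (2::real) ^ (d * i) * 2 ^ (d * i)" "0 < (2::real) ^ (d * q) * 2 ^ (d * q)"
    "0 < lam i powr (2 * s)" "0 < lam (i + q) powr (2 * s)"
    using lam(1)[of i] lam(1)[of "i + q"] by simp_all
  have "v (i + q) = 1 / ((2 ^ (d * i) * 2 ^ (d * i)) * (2 ^ (d * q) * 2 ^ (d * q)) * lam (i + q) powr (2 * s))"
    unfolding sq by (simp add: distrib_left power_add mult_ac)
  also have "\<dots> \<le> \<rho> ^ q / ((2 ^ (d * i) * 2 ^ (d * i)) * lam i powr (2 * s))"
  proof -
    define A B x y where "A = (2::real) ^ (d * i) * 2 ^ (d * i)" and "B = (2::real) ^ (d * q) * 2 ^ (d * q)"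
      and "x = lam i powr (2 * s)" and "y = lam (i + q) powr (2 * s)"
    have "x \<le> y * (\<rho> ^ q * B)" using 1 r by (simp add: x_def y_def B_def)
    then have "A * x \<le> A * (y * (\<rho> ^ q * B))" using pos by (intro mult_left_mono) (auto simp: A_def)
    then have le: "A * x \<le> \<rho> ^ q * (A * B * y)" by (simp add: mult_ac)
    have AX: "0 < A * x" "0 < A * B * y"
      using pos unfolding A_def B_def x_def y_def by (simp_all only: mult_pos_pos)
    have "1 / (A * B * y) = (A * x) / ((A * x) * (A * B * y))" using AX by auto
    also have "\<dots> \<le> (\<rho> ^ q * (A * B * y)) / ((A * x) * (A * B * y))"
      using le AX by (intro divide_right_mono) auto
    also have "\<dots> = \<rho> ^ q / (A * x)" using AX by auto
    finally have "1 / (A * B * y) \<le> \<rho> ^ q / (A * x)" .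
    then show ?thesis by (simp add: A_def B_def x_def y_def)
  qed
  also have "\<dots> = v i * \<rho> ^ q" unfolding sq by simp
  finally show ?thesis .
qed

text \<open>Comparison is with the end i + J and not with i: \<open>lam\<close> may drop by an
  arbitrarily large factor in one step, so \<open>v\<close> may jump up without bound, but it can
  fall only through the count, by at most 4^d per step.\<close>

lemma v_near:
  assumes "i \<le> j" "j \<le> i + J"
  shows "v j \<le> 4 ^ (d * J) * v (i + J)"
proof -
  have "d * (i + J) \<le> d * j + d * J" using assms by (simp add: distrib_left[symmetric])
  then have "(2::real) ^ (d * (i + J)) \<le> 2 ^ (d * j + d * J)" by (intro power_increasing) auto
  then have 1: "(2::real) ^ (d * (i + J)) \<le> 2 ^ (d * J) * 2 ^ (d * j)" by (simp add: power_add mult_ac)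
  have 2: "lam (i + J) powr s \<le> lam j powr s"
    using lam_antimono[OF assms(2)] lam(1)[of "i + J"] s_pos by (intro powr_mono2) auto
  have pos: "0 < 2 ^ (d * j) * lam j powr s" "0 < 2 ^ (d * (i + J)) * lam (i + J) powr s"
    using lam(1)[of j] lam(1)[of "i + J"] by simp_all
  have "2 ^ (d * (i + J)) * lam (i + J) powr s \<le> (2 ^ (d * J) * 2 ^ (d * j)) * lam j powr s"
    using 1 2 by (intro mult_mono) auto
  then have "(2 ^ (d * (i + J)) * lam (i + J) powr s)\<^sup>2 \<le> ((2 ^ (d * J) * 2 ^ (d * j)) * lam j powr s)\<^sup>2"
    using pos by (intro power_mono) auto
  also have "\<dots> = 4 ^ (d * J) * (2 ^ (d * j) * lam j powr s)\<^sup>2"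
    by (simp add: power_mult_distrib power2_eq_square flip: power_mult_distrib)
  finally have 3: "(2 ^ (d * (i + J)) * lam (i + J) powr s)\<^sup>2 \<le> 4 ^ (d * J) * (2 ^ (d * j) * lam j powr s)\<^sup>2" .
  have pos2: "0 < (2 ^ (d * j) * lam j powr s)\<^sup>2" "0 < (2 ^ (d * (i + J)) * lam (i + J) powr s)\<^sup>2"
    using pos by (simp_all only: zero_less_power)
  have "1 / W \<le> C * (1 / U)" if "U \<le> C * W" "0 < W" "0 < U" for U W C :: real
    using that by (simp add: field_simps)
  then show ?thesis unfolding v_def using 3 pos2 by blast
qed

definition block_const :: real where
  "block_const = real J * 4 ^ (d * J) + 1 / (1 - \<rho>)"

lemma block_const_pos: "0 < block_const"
  unfolding block_const_def using \<rho> by (intro add_nonneg_pos) auto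

lemma block_sum:
  assumes blocked: "\<And>j. i + J \<le> j \<Longrightarrow> j < n \<Longrightarrow> a i < a j"
  shows "(\<Sum>j\<in>{i..<n}. v j) \<le> real J * 4 ^ (d * J) * v (i + J) + v i / (1 - \<rho>)"
proof -
  have v0: "0 \<le> v j" for j using v_pos[of j] by simp
  have "(\<Sum>j\<in>{i..<n}. v j) \<le> (\<Sum>j\<in>{i..<i + J} \<union> {i + J..<n}. v j)"
    using v0 by (intro sum_mono2) auto
  also have "\<dots> = (\<Sum>j\<in>{i..<i + J}. v j) + (\<Sum>j\<in>{i + J..<n}. v j)" by (rule sum.union_disjoint) auto
  also have "(\<Sum>j\<in>{i..<i + J}. v j) \<le> (\<Sum>j\<in>{i..<i + J}. 4 ^ (d * J) * v (i + J))"
    by (intro sum_mono v_near) auto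
  also have "\<dots> = real J * 4 ^ (d * J) * v (i + J)" by simp
  also have "(\<Sum>j\<in>{i + J..<n}. v j) \<le> (\<Sum>j\<in>{i + J..<n}. v i * \<rho> ^ (j - i))"
  proof (rule sum_mono)
    fix j assume j: "j \<in> {i + J..<n}"
    then have "i + (j - i) = j" by simp
    then show "v j \<le> v i * \<rho> ^ (j - i)" using v_blocked[of i "j - i"] blocked[of j] j by simp
  qed
  also have "\<dots> \<le> (\<Sum>j\<in>{i..<n}. v i * \<rho> ^ (j - i))"
    using v0 \<rho> by (intro sum_mono2) auto
  also have "\<dots> = v i * (\<Sum>j\<in>{i..<n}. \<rho> ^ (j - i))" by (simp add: sum_distrib_left)
  also have "(\<Sum>j\<in>{i..<n}. \<rho> ^ (j - i)) = (\<Sum>q<n - i. \<rho> ^ q)"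
    by (simp add: sum.atLeastLessThan_shift_0[of _ i] atLeast0LessThan)
  also have "v i * (\<Sum>q<n - i. \<rho> ^ q) \<le> v i * (1 / (1 - \<rho>))"
    using \<rho> v0 by (intro mult_left_mono) (auto simp: sum_gp_strict divide_right_mono)
  finally show ?thesis by simp
qed

lemma not_admissible: "i + J \<le> j \<Longrightarrow> \<not> admissible i j \<Longrightarrow> a i < a j"
  by (simp add: admissible_def)

lemma sum_up_to_js:
  assumes "valid N"
  shows "(\<Sum>j<js N. v j) \<le> 2 * block_const * (\<Sum>k\<le>N. v (js k))"
proof -
  have v0: "0 \<le> v j" for j using v_pos[of j] by simp
  have "M \<le> N \<Longrightarrow> (\<Sum>j<js M. v j) \<le> block_const * (\<Sum>k<M. v (js k) + v (js (Suc k)))" for M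
  proof (induction M)
    case (Suc M)
    let ?i = "js M" and ?n = "js (Suc M)"
    have i: "?i + J \<le> ?n" using js_Suc[OF assms, of M] Suc.prems by simp
    have blocked: "a ?i < a j" if "?i + J \<le> j" "j < ?n" for j
    proof -
      have "\<not> admissible ?i j" using that(2) unfolding js.simps by (rule not_less_Least)
      then show ?thesis by (rule not_admissible[OF that(1)])
    qed
    \<comment> \<open>Either i + J is the next selected index or it was rejected, and then
      \<open>v\<close> has decayed since i.\<close>
    have vJ: "v (?i + J) \<le> v ?i + v ?n"
    proof (cases "?i + J = ?n")
      case True
      then show ?thesis using v0[of ?i] by (simp only: True)
    next
      case False
      then have "v (?i + J) \<le> v ?i * \<rho> ^ J" using i blocked[of "?i + J"] by (intro v_blocked) simp
      also have "\<dots> \<le> v ?i * 1" using \<rho> v0 by (intro mult_left_mono power_le_one) auto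
      finally show ?thesis using v0[of ?n] by simp
    qed
    have "(\<Sum>j\<in>{?i..<?n}. v j) \<le> real J * 4 ^ (d * J) * v (?i + J) + v ?i / (1 - \<rho>)"
      by (rule block_sum[OF blocked])
    also have "\<dots> \<le> real J * 4 ^ (d * J) * (v ?i + v ?n) + (v ?i + v ?n) / (1 - \<rho>)"
      using vJ v0 \<rho> by (intro add_mono mult_left_mono divide_right_mono) auto
    also have "\<dots> = block_const * (v ?i + v ?n)" by (simp add: block_const_def algebra_simps add_divide_distrib)
    finally have "(\<Sum>j\<in>{?i..<?n}. v j) \<le> block_const * (v ?i + v ?n)" .
    moreover have "(\<Sum>j<?n. v j) = (\<Sum>j<?i. v j) + (\<Sum>j\<in>{?i..<?n}. v j)"
      using i by (simp only: lessThan_atLeast0) (rule sum.atLeastLessThan_concat[symmetric], auto)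
    ultimately show ?case using Suc.IH Suc.prems by (simp add: distrib_left)
  qed simp
  from this[of N] have "(\<Sum>j<js N. v j) \<le> block_const * (\<Sum>k<N. v (js k) + v (js (Suc k)))" by simp
  \<comment> \<open>Each selected scale bounds the gap before it and the gap after it.\<close>
  also have "\<dots> \<le> block_const * (2 * (\<Sum>k\<le>N. v (js k)))"
  proof (intro mult_left_mono)
    have "(\<Sum>k<N. v (js k)) \<le> (\<Sum>k\<le>N. v (js k))" using v0 by (intro sum_mono2) auto
    moreover have "(\<Sum>k<N. v (js (Suc k))) \<le> (\<Sum>k\<le>N. v (js k))"
      unfolding lessThan_Suc_atMost[symmetric] sum.lessThan_Suc_shift using v0[of "js 0"] by simp
    ultimately show "(\<Sum>k<N. v (js k) + v (js (Suc k))) \<le> 2 * (\<Sum>k\<le>N. v (js k))"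
      by (simp add: sum.distrib)
  qed (use block_const_pos in auto)
  finally show ?thesis by simp
qed

text \<open>If the selection never stops, \<open>js n\<close> is at least n. If it stops after K
  steps, every scale from \<open>js K + J\<close> on is blocked and the whole tail is charged to
  \<open>v (js K)\<close>.\<close>

lemma sum_all_scales:
  obtains N where "valid N" "(\<Sum>j<n. v j) \<le> 4 * block_const * (\<Sum>k\<le>N. v (js k))"
proof (cases "\<forall>N. valid N")
  case True
  have v0: "0 \<le> v j" for j using v_pos[of j] by simp
  have "n \<le> js n"
  proof (induction n)
    case (Suc n)
    then show ?case using js_Suc[of "Suc n" n] True J_pos by simp
  qed simp
  then have "(\<Sum>j<n. v j) \<le> (\<Sum>j<js n. v j)" using v0 by (intro sum_mono2) auto
  also have "\<dots> \<le> 2 * block_const * (\<Sum>k\<le>n. v (js k))" using True by (intro sum_up_to_js) simp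
  also have "\<dots> \<le> 4 * block_const * (\<Sum>k\<le>n. v (js k))"
    using block_const_pos v0 by (intro mult_right_mono sum_nonneg) auto
  finally show thesis using that[of n] True by blast
next
  case False
  have v0: "0 \<le> v j" for j using v_pos[of j] by simp
  define M where "M = (LEAST M. \<not> valid M)"
  have "\<exists>M. \<not> valid M" using False by simp
  then have M: "\<not> valid M" unfolding M_def by (rule LeastI_ex)
  have "M \<noteq> 0" using M by (intro notI) (simp add: valid_def)
  then obtain K where K: "M = Suc K" by (cases M) auto
  have vK: "valid K" using not_less_Least[of K "\<lambda>M. \<not> valid M"] K by (simp add: M_def)
  have stop: "\<not> admissible (js K) j" for j
    using M vK unfolding K valid_def by (auto simp: less_Suc_eq)
  have blocked: "a (js K) < a j" if "js K + J \<le> j" for j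
    by (rule not_admissible[OF that stop])
  have vJ: "v (js K + J) \<le> v (js K)"
  proof -
    have "v (js K + J) \<le> v (js K) * \<rho> ^ J" using blocked[of "js K + J"] by (intro v_blocked) simp
    also have "\<dots> \<le> v (js K) * 1" using \<rho> v0 by (intro mult_left_mono power_le_one) auto
    finally show ?thesis by simp
  qed
  have "(\<Sum>j<n. v j) \<le> (\<Sum>j\<in>{..<js K} \<union> {js K..<n}. v j)" using v0 by (intro sum_mono2) auto
  also have "\<dots> = (\<Sum>j<js K. v j) + (\<Sum>j\<in>{js K..<n}. v j)" by (rule sum.union_disjoint) auto
  also have "(\<Sum>j\<in>{js K..<n}. v j) \<le> real J * 4 ^ (d * J) * v (js K + J) + v (js K) / (1 - \<rho>)"
    by (rule block_sum) (rule blocked)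
  also have "\<dots> \<le> real J * 4 ^ (d * J) * v (js K) + v (js K) / (1 - \<rho>)"
    using vJ by (intro add_right_mono mult_left_mono) auto
  also have "\<dots> = block_const * v (js K)" by (simp add: block_const_def algebra_simps add_divide_distrib)
  also have "\<dots> \<le> block_const * (\<Sum>k\<le>K. v (js k))"
    using block_const_pos v0 by (intro mult_left_mono member_le_sum) auto
  also have "(\<Sum>j<js K. v j) \<le> 2 * block_const * (\<Sum>k\<le>K. v (js k))" by (rule sum_up_to_js[OF vK])
  finally have "(\<Sum>j<n. v j) \<le> 3 * block_const * (\<Sum>k\<le>K. v (js k))" by (simp add: algebra_simps)
  also have "\<dots> \<le> 4 * block_const * (\<Sum>k\<le>K. v (js k))"
    using block_const_pos v0 by (intro mult_right_mono sum_nonneg) auto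
  finally show thesis using that[of K] vK by blast
qed

end

subsection \<open>Capacity of the Cantor set\<close>

lemma nn_integral_inverse_power_le:
  fixes a b c q :: real
  assumes "0 < a" "a \<le> b" "0 < q" "0 \<le> c"
  shows "(\<integral>\<^sup>+x. ennreal (c * x powr (- q - 1)) * indicator {a..b} x \<partial>lborel) \<le> ennreal (c * a powr (- q) / q)"
proof -
  let ?F = "\<lambda>x. - (c * x powr (- q) / q)"
  have "(\<integral>\<^sup>+x. ennreal (c * x powr (- q - 1)) * indicator {a..b} x \<partial>lborel) = ennreal (?F b - ?F a)"
  proof (rule nn_integral_FTC_Icc[where F = ?F])
    fix x assume "x \<in> {a..b}"
    then show "DERIV ?F x :> c * x powr (- q - 1)"
      using assms by (auto intro!: derivative_eq_intros)
  qed (use assms in auto)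
  also have "\<dots> \<le> ennreal (c * a powr (- q) / q)" using assms by (intro ennreal_leI) simp
  finally show ?thesis .
qed

lemma eventually_decay_le:
  fixes C x e :: real
  assumes "0 < x" "0 < e"
  shows "eventually (\<lambda>J. C * 2 powr (- (real J * x)) \<le> e) sequentially"
proof -
  have "(\<lambda>J. C * (2 powr (- x)) ^ J) \<longlonglongrightarrow> C * 0"
    using assms powr_less_mono[of "- x" 0 2] by (intro tendsto_intros LIMSEQ_realpow_zero) auto
  moreover have "(2 powr (- x)) ^ J = 2 powr (- (real J * x))" for J
    by (simp add: powr_powr mult.commute flip: powr_realpow)
  ultimately have "(\<lambda>J. C * 2 powr (- (real J * x))) \<longlonglongrightarrow> 0" by simp
  from order_tendstoD(2)[OF this \<open>0 < e\<close>] show ?thesis by eventually_elim simp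
qed

lemma radon_measures_on_mono:
  assumes "\<nu> \<in> radon_measures_on E" "E \<subseteq> F" "closed E"
  shows "\<nu> \<in> radon_measures_on F"
proof -
  have "emeasure \<nu> (- F) \<le> emeasure \<nu> (- E)"
    using assms by (intro emeasure_mono) (auto simp: radon_measures_on_def)
  then show ?thesis using assms(1) by (simp add: radon_measures_on_def)
qed

lemma energy_integral_mono: "S \<le> T \<Longrightarrow> energy_integral s h S \<le> energy_integral s h T"
  unfolding energy_integral_def by (intro nn_integral_mono) (auto split: split_indicator)

section \<open>The energy integral in terms of the scales\<close>

context gauge
begin

text \<open>Guards against \<open>0 powr (- 1 / 2) = 0\<close>, which would turn the final bound
  into 0.\<close>

lemma energy_integral_pos:
  assumes s: "0 < s" and "0 < T"
  shows "0 < energy_integral s h T"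
proof -
  define \<delta> where "\<delta> = (h (T / 2) * T powr (- s))\<^sup>2 / T"
  have hp: "0 < h (T / 2)" using assms by (intro h_pos) simp
  have "0 < T powr (- s)" using assms by simp
  then have \<delta>: "0 < \<delta>"
    unfolding \<delta>_def using hp assms by (intro divide_pos_pos zero_less_power mult_pos_pos)
  have "0 < ennreal \<delta> * emeasure lborel {T / 2..T}"
    using \<delta> assms by (simp add: ennreal_zero_less_mult_iff)
  also have "\<dots> = (\<integral>\<^sup>+t. ennreal \<delta> * indicator {T / 2..T} t \<partial>lborel)"
    by (simp add: nn_integral_cmult_indicator)
  also have "\<dots> \<le> energy_integral s h T"
    unfolding energy_integral_def
  proof (intro nn_integral_mono)
    fix t
    have "\<delta> \<le> (h t / t powr s)\<^sup>2 / t" if t: "T / 2 \<le> t" "t \<le> T"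
    proof -
      have t0: "0 < t" using t assms by linarith
      have "T powr (- s) \<le> t powr (- s)" using t t0 s by (intro powr_mono2') auto
      then have "h (T / 2) * T powr (- s) \<le> h t * t powr (- s)"
        using hp h_mono[of "T / 2" t] t assms by (intro mult_mono) auto
      also have "\<dots> = h t / t powr s" by (simp add: powr_minus divide_inverse)
      finally have "(h (T / 2) * T powr (- s))\<^sup>2 \<le> (h t / t powr s)\<^sup>2"
        using hp by (intro power_mono) auto
      then show ?thesis unfolding \<delta>_def using t t0 by (intro frac_le) auto
    qed
    then show "ennreal \<delta> * indicator {T / 2..T} t \<le> ennreal ((h t / t powr s)\<^sup>2 / t) * indicator {0<..T} t"
      using assms by (auto split: split_indicator intro: ennreal_leI)
  qed
  finally show ?thesis .
qed

lemma lam_bracket: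
  assumes "0 < u" "u \<le> 1"
  obtains j where "lam (Suc j) < u" "u \<le> lam j"
proof -
  have "(\<lambda>j. (1/2::real) ^ j) \<longlonglongrightarrow> 0" by (rule LIMSEQ_realpow_zero) auto
  from order_tendstoD(2)[OF this \<open>0 < u\<close>] obtain i where "(1/2::real) ^ i < u"
    by (auto simp: eventually_sequentially)
  then have ex: "lam i < u" using lam_add[of 0 i] lam_0 by (simp add: power_one_over)
  define M where "M = (LEAST i. lam i < u)"
  have M: "lam M < u" unfolding M_def using ex by (rule LeastI)
  have "M \<noteq> 0" using M assms lam_0 by (intro notI) simp
  then obtain j where j: "M = Suc j" by (cases M) auto
  have "\<not> lam j < u" using not_less_Least[of j "\<lambda>i. lam i < u"] j by (simp add: M_def)
  then show thesis using that[of j] M j by simp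
qed

end

context selection
begin

text \<open>On (lam(j+1), lam(j)] replace h by its value at the right end and let the power
  integrate to at most lam(j+1)^(-2s) / (2s). The right end value is 2^d h(lam(j+1)), whence 4^d and
  a shift of the index by one.\<close>

lemma energy_integral_le:
  assumes B: "\<And>n. (\<Sum>j<n. v j) \<le> B"
  shows "energy_integral s h 1 \<le> ennreal ((h 1)\<^sup>2 * 4 ^ d / (2 * s) * B)"
proof -
  define g where "g j t = ennreal ((h (lam j))\<^sup>2 * t powr (- (2 * s) - 1)) * indicator {lam (Suc j)..lam j} t" for j t
  define K where "K = (h 1)\<^sup>2 * 4 ^ d / (2 * s)"
  have K: "0 \<le> K" using s_pos by (simp add: K_def)
  have "energy_integral s h 1 \<le> (\<integral>\<^sup>+t. (\<Sum>j. g j t) \<partial>lborel)"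
    unfolding energy_integral_def
  proof (rule nn_integral_mono)
    fix t :: real
    show "ennreal ((h t / t powr s)\<^sup>2 / t) * indicator {0<..1} t \<le> (\<Sum>j. g j t)"
    proof (cases "0 < t \<and> t \<le> 1")
      case True
      then obtain j where j: "lam (Suc j) < t" "t \<le> lam j" using lam_bracket[of t] by blast
      have "(h t / t powr s)\<^sup>2 / t = (h t)\<^sup>2 * t powr (- (2 * s) - 1)"
      proof -
        have "t powr (- (2 * s) - 1) = 1 / ((t powr s)\<^sup>2 * t)"
          using True powr_add[of t s s] powr_add[of t "2 * s" 1] powr_minus_divide[of t "2 * s + 1"]
          by (simp add: power2_eq_square)
        then show ?thesis by (simp add: power_divide)
      qed
      also have "\<dots> \<le> (h (lam j))\<^sup>2 * t powr (- (2 * s) - 1)"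
        using h_mono[of t "lam j"] h_pos[of t] True j by (intro mult_right_mono power_mono) auto
      finally have "ennreal ((h t / t powr s)\<^sup>2 / t) * indicator {0<..1} t \<le> g j t"
        using j by (simp add: g_def indicator_def ennreal_leI)
      also have "g j t = (\<Sum>i\<in>{j}. g i t)" by simp
      also have "\<dots> \<le> (\<Sum>j. g j t)" by (rule sum_le_suminf) auto
      finally show ?thesis .
    qed auto
  qed
  also have "\<dots> = (\<Sum>j. \<integral>\<^sup>+t. g j t \<partial>lborel)"
    by (rule nn_integral_suminf) (simp add: g_def)
  also have "\<dots> \<le> (\<Sum>j. ennreal (K * v (Suc j)))"
  proof (intro suminf_le)
    fix j
    have "(\<integral>\<^sup>+t. g j t \<partial>lborel) \<le> ennreal ((h (lam j))\<^sup>2 * lam (Suc j) powr (- (2 * s)) / (2 * s))"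
      unfolding g_def using lam(1) lam_antimono[of j "Suc j"] s_pos
      by (intro nn_integral_inverse_power_le) auto
    also have "(h (lam j))\<^sup>2 * lam (Suc j) powr (- (2 * s)) / (2 * s) = K * v (Suc j)"
    proof -
      have "lam (Suc j) powr (- (2 * s)) = 1 / (lam (Suc j) powr s)\<^sup>2"
        using powr_add[of "lam (Suc j)" s s] by (simp add: powr_minus_divide power2_eq_square)
      moreover have "(h (lam j))\<^sup>2 = (h 1)\<^sup>2 * 4 ^ d / (2 ^ (d * Suc j))\<^sup>2"
      proof -
        have "(2::real) ^ (d * Suc j) = 2 ^ d * 2 ^ (d * j)" by (simp add: power_add)
        moreover have "((2::real) ^ d)\<^sup>2 = 4 ^ d" by (simp add: power2_eq_square flip: power_mult_distrib)
        ultimately show ?thesis by (simp add: lam(2) power_divide power_mult_distrib)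
      qed
      ultimately show ?thesis by (simp add: K_def v_def power_mult_distrib)
    qed
    finally show "(\<integral>\<^sup>+t. g j t \<partial>lborel) \<le> ennreal (K * v (Suc j))" .
  qed auto
  also have "\<dots> \<le> ennreal (K * B)"
  proof (rule suminf_le_const)
    fix n
    have v0: "0 \<le> v j" for j using v_pos[of j] by simp
    have "(\<Sum>j<n. v (Suc j)) \<le> (\<Sum>j<Suc n. v j)"
      unfolding sum.lessThan_Suc_shift using v0[of 0] by simp
    also have "\<dots> \<le> B" by (rule B)
    finally have "K * (\<Sum>j<n. v (Suc j)) \<le> K * B" using K by (rule mult_left_mono)
    then show "(\<Sum>j<n. ennreal (K * v (Suc j))) \<le> ennreal (K * B)"
      using K v0 by (simp add: sum_ennreal sum_distrib_left ennreal_leI)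
  qed auto
  finally show ?thesis by (simp add: K_def)
qed

section \<open>The Cantor set and its Hausdorff content\<close>

lemma cantor_scales:
  assumes "d = CARD('n::finite)" "valid N"
  shows "cantor_scales l t N (spacing d l t) (words t N) (center l t N :: (nat \<Rightarrow> 'n \<Rightarrow> nat) \<Rightarrow> real ^ 'n)"
proof
  show "0 < l k" for k by (rule l_pos)
  show "l (Suc k) \<le> l k / 2" if "k < N" for k by (rule l_half[OF assms(2) that])
  show "8 * l (Suc k) \<le> spacing d l t k" if "k < N" for k by (rule l_spacing[OF assms(2) that])
  show "spacing d l t = spacing CARD('n) l t" by (simp only: assms(1))
qed (rule refl)+

text \<open>One formula for both cases: the stages decrease, so if the selection stops this is the
  last valid stage.\<close>

definition cantor_set :: "(real ^ 'n::finite) set" where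
  "cantor_set = (\<Inter>N\<in>Collect valid. stage l t N)"

lemma valid_0: "valid 0"
  by (simp add: valid_def)

lemma stage_antimono:
  assumes "valid N" "M \<le> N"
  shows "stage l t N \<subseteq> (stage l t M :: (real ^ 'n::finite) set)"
  using assms(2)
proof (induction rule: inc_induct)
  case (step n)
  have "stage l t (Suc n) \<subseteq> (stage l t n :: (real ^ 'n) set)"
    using l_half[OF assms(1)] step by (intro stage_Suc_subset l_pos) auto
  then show ?case using step.IH by blast
qed simp

lemma compact_cantor_set: "compact (cantor_set :: (real ^ 'n::finite) set)"
  unfolding cantor_set_def using valid_0 by (intro compact_Inter) (auto simp: compact_stage)

lemma cantor_set_subset: "valid N \<Longrightarrow> cantor_set \<subseteq> stage l t N"
  by (auto simp: cantor_set_def)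

lemma stage_in_open:
  assumes U: "open U" and sub: "cantor_set \<subseteq> (U :: (real ^ 'n::finite) set)"
  obtains N where "valid N" "stage l t N \<subseteq> U"
proof -
  have "\<exists>N. valid N \<and> stage l t N \<subseteq> U"
  proof (rule ccontr)
    assume no: "\<not> ?thesis"
    have "(stage l t 0 - U) \<inter> \<Inter>(stage l t ` Collect valid) \<noteq> {}"
    proof (rule compact_imp_fip)
      show "compact (stage l t 0 - U)" using compact_stage U by (rule compact_diff)
      show "closed T" if "T \<in> stage l t ` Collect valid" for T :: "(real ^ 'n) set"
        using that compact_stage compact_imp_closed by auto
      fix F' :: "(real ^ 'n) set set"
      assume F: "finite F'" "F' \<subseteq> stage l t ` Collect valid"
      then obtain V where V: "finite V" "V \<subseteq> Collect valid" "F' = stage l t ` V"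
        using finite_subset_image[OF F] by auto
      define M where "M = Max (insert 0 V)"
      have "M \<in> insert 0 V" unfolding M_def using V(1) by (intro Max_in) auto
      then have M: "valid M" using V(2) valid_0 by auto
      have "N \<le> M" if "N \<in> insert 0 V" for N unfolding M_def using V(1) that by (intro Max_ge) auto
      then have "stage l t M \<subseteq> (stage l t N :: (real ^ 'n) set)" if "N \<in> insert 0 V" for N
        using that by (intro stage_antimono M) auto
      then have "stage l t M - U \<subseteq> (stage l t 0 - U) \<inter> \<Inter>F'" unfolding V(3) by blast
      moreover have "stage l t M - U \<noteq> {}" using no M by blast
      ultimately show "(stage l t 0 - U) \<inter> \<Inter>F' \<noteq> {}" by blast
    qed
    then show False using sub unfolding cantor_set_def by blast
  qed
  then show thesis using that by blast
qed

lemma hausdorff_content_upper: "hausdorff_content h (cantor_set :: (real ^ 'n::finite) set) \<le> ennreal (h 1)"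
proof -
  have "cantor_set \<subseteq> (ball 0 1 :: (real ^ 'n) set)"
    using cantor_set_subset[OF valid_0, where 'a = 'n] by (auto simp: stage_0 l_0)
  then show ?thesis unfolding hausdorff_content_def
    by (intro Inf_lower CollectI exI[of _ "{0}"] exI[of _ "\<lambda>_. 0"] exI[of _ "\<lambda>_. 1"]) auto
qed

text \<open>By compactness a countable covering by open balls has a finite part that already covers
  some stage, and \<open>cover_bound\<close> does not depend on the stage.\<close>

lemma hausdorff_content_lower:
  assumes d: "d = CARD('n::finite)"
  shows "ennreal (h 1 / cover_const d) \<le> hausdorff_content h (cantor_set :: (real ^ 'n) set)"
  unfolding hausdorff_content_def
proof (rule Inf_greatest, clarify)
  fix J :: "nat set" and b :: "nat \<Rightarrow> real ^ 'n" and r :: "nat \<Rightarrow> real"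
  assume r: "\<forall>j\<in>J. 0 < r j" and cov: "cantor_set \<subseteq> (\<Union>j\<in>J. ball (b j) (r j))"
  obtain J' where J': "J' \<subseteq> J" "finite J'" "cantor_set \<subseteq> (\<Union>j\<in>J'. ball (b j) (r j))"
    using compact_cantor_set open_ball cov by (rule compactE_image)
  obtain N where N: "valid N" "stage l t N \<subseteq> (\<Union>j\<in>J'. ball (b j) (r j))"
    by (rule stage_in_open[OF _ J'(3)]) auto
  interpret cs: cantor_scales l t N "spacing d l t" "words t N" "center l t N :: (nat \<Rightarrow> 'n \<Rightarrow> nat) \<Rightarrow> real ^ 'n"
    by (rule cantor_scales[OF d N(1)])
  have "h (l 0) \<le> cover_const CARD('n) * (\<Sum>j\<in>J'. h (r j))"
  proof (rule cs.cover_bound[OF _ _ _ _ J'(2) _ N(2)])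
    show "h (l k) * cs.P k = h (l 0)" if "k \<le> N" for k
      using h_l[OF N(1) that] unfolding cs.P_def d[symmetric] .
  qed (use h_mono h_pos h_anti J'(1) r in \<open>auto simp flip: d\<close>)
  then have "h 1 \<le> cover_const d * (\<Sum>j\<in>J'. h (r j))" by (simp add: l_0 flip: d)
  moreover have "0 < cover_const d" unfolding cover_const_def using d_pos by simp
  ultimately have "h 1 / cover_const d \<le> (\<Sum>j\<in>J'. h (r j))" by (simp add: pos_divide_le_eq mult.commute)
  then have "ennreal (h 1 / cover_const d) \<le> ennreal (\<Sum>j\<in>J'. h (r j))" by (rule ennreal_leI)
  also have "\<dots> = (\<Sum>j\<in>J'. ennreal (h (r j)))"
  proof (rule sum_ennreal[symmetric])
    fix j assume "j \<in> J'"
    then have "0 < r j" using r J'(1) by auto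
    then show "0 \<le> h (r j)" using h_pos[of "r j"] by simp
  qed
  also have "\<dots> \<le> (\<Sum>\<^sub>\<infinity>j\<in>J. ennreal (h (r j)))"
    using J' by (subst nonneg_infsum_complete) (auto intro!: SUP_upper)
  finally show "ennreal (h 1 / cover_const d) \<le> (\<Sum>\<^sub>\<infinity>j\<in>J. ennreal (h (r j)))" .
qed

text \<open>The stage used depends on \<open>n\<close>, but a measure on the Cantor set is a measure
  on every stage and the constants are the same for all of them.\<close>

lemma measure_bound:
  fixes \<nu> :: "(real ^ 'n::finite) measure"
  defines "A \<equiv> transfer_const s"
  assumes d: "d = CARD('n)" and p: "p \<le> s + 1"
    and \<omega>: "0 < \<omega>" "\<omega> \<le> 1" "lip_const s * \<omega> \<le> 1/4"
      "(4 * (18436 * A\<^sup>2) + 36864 * lip_const s) * \<omega> \<le> 1/2"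
    and \<nu>: "\<nu> \<in> radon_measures_on cantor_set"
    and bd: "esssup lebesgue (\<lambda>x. ereal (norm (riesz_transform s \<nu> x))) \<le> 1"
  shows "(measure \<nu> UNIV)\<^sup>2 * (\<Sum>j<n. v j) \<le> 4 * block_const * (36872 * A\<^sup>2)"
proof -
  obtain N where N: "valid N" "(\<Sum>j<n. v j) \<le> 4 * block_const * (\<Sum>k\<le>N. v (js k))"
    using sum_all_scales[of n] by blast
  interpret cs: cantor_scales l t N "spacing d l t" "words t N" "center l t N :: (nat \<Rightarrow> 'n \<Rightarrow> nat) \<Rightarrow> real ^ 'n"
    by (rule cantor_scales[OF d N(1)])
  have \<nu>N: "\<nu> \<in> radon_measures_on (stage l t N)"
    by (rule radon_measures_on_mono[OF \<nu> cantor_set_subset[OF N(1)] compact_imp_closed[OF compact_cantor_set]])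
  have "(measure \<nu> UNIV)\<^sup>2 * (\<Sum>k\<le>N. 1 / ((\<Prod>i<k. (2 ^ t i) ^ CARD('n)) * l k powr s)\<^sup>2) \<le> 36872 * A\<^sup>2"
    unfolding A_def
    using p_less p l_small[OF N(1)] l_row[OF N(1)]
    by (intro cs.stage_mass_bound[OF s_pos p_pos _ p _ _ \<omega>(1,2,3) \<omega>(4)[unfolded A_def] \<nu>N bd]) (auto simp: d)
  also have "(\<Sum>k\<le>N. 1 / ((\<Prod>i<k. (2 ^ t i) ^ CARD('n)) * l k powr s)\<^sup>2) = (\<Sum>k\<le>N. v (js k))"
    by (intro sum.cong refl) (simp add: v_def l_def prod_counts[OF N(1)] flip: d)
  finally have le: "(measure \<nu> UNIV)\<^sup>2 * (\<Sum>k\<le>N. v (js k)) \<le> 36872 * A\<^sup>2" .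
  have "(measure \<nu> UNIV)\<^sup>2 * (\<Sum>j<n. v j) \<le> (measure \<nu> UNIV)\<^sup>2 * (4 * block_const * (\<Sum>k\<le>N. v (js k)))"
    by (intro mult_left_mono N(2)) simp
  also have "\<dots> = 4 * block_const * ((measure \<nu> UNIV)\<^sup>2 * (\<Sum>k\<le>N. v (js k)))" by simp
  also have "\<dots> \<le> 4 * block_const * (36872 * A\<^sup>2)"
    using block_const_pos by (intro mult_left_mono le) auto
  finally show ?thesis .
qed

theorem capacity_bound:
  defines "A \<equiv> transfer_const s"
  defines "K \<equiv> 4 ^ d / (2 * s) * (4 * block_const * (36872 * A\<^sup>2))"
  assumes d: "d = CARD('n::finite)" and p: "p \<le> s + 1"
    and \<omega>: "0 < \<omega>" "\<omega> \<le> 1" "lip_const s * \<omega> \<le> 1/4"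
      "(4 * (18436 * A\<^sup>2) + 36864 * lip_const s) * \<omega> \<le> 1/2"
  shows "\<exists>(E :: (real ^ 'n) set) T. compact E \<and> hausdorff_content h E > 0 \<and> 0 \<le> T \<and>
      ennreal (h T) = hausdorff_content h E \<and>
      gamma_plus s E \<le> (if energy_integral s h T = \<infinity> then 0
        else ennreal (sqrt K * cover_const d) * hausdorff_content h E *
             ennreal (enn2real (energy_integral s h T) powr (- 1 / 2)))"
proof -
  let ?E = "cantor_set :: (real ^ 'n) set"
  define H where "H = enn2real (hausdorff_content h ?E)"
  have cc: "0 < cover_const d" unfolding cover_const_def using d_pos by simp
  have h1: "0 < h 1" by (rule h_pos) simp
  have "hausdorff_content h ?E < \<top>"
    using hausdorff_content_upper[where 'n = 'n] by (rule order.strict_trans1) simp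
  then have H: "hausdorff_content h ?E = ennreal H" by (simp add: H_def)
  have "ennreal (h 1 / cover_const d) \<le> ennreal H" using hausdorff_content_lower[OF d] H by simp
  moreover have q: "0 < h 1 / cover_const d" using h1 cc by simp
  ultimately have Hl: "h 1 / cover_const d \<le> H" unfolding ennreal_le_iff2 by linarith
  have H0: "0 < H" using q Hl by (rule order.strict_trans2)
  have Hu: "H \<le> h 1" using hausdorff_content_upper[where 'n = 'n] H h1 by (simp add: ennreal_le_iff)
  \<comment> \<open>The content is at most h(1), so T <= 1 and the energy up to T is at most that up
    to 1.\<close>
  obtain T where T: "0 < T" "T \<le> 1" "h T = H" using h_attains[OF H0 Hu] by auto
  define I where "I = energy_integral s h T"
  have I0: "0 < I" unfolding I_def by (rule energy_integral_pos[OF s_pos T(1)])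
  have K0: "0 \<le> K" unfolding K_def using s_pos block_const_pos by simp
  \<comment> \<open>A single admissible measure of positive mass forces a finite integral, so a
    divergent integral leaves capacity 0.\<close>
  have bound: "I \<noteq> \<infinity> \<and> (measure \<nu> UNIV)\<^sup>2 * enn2real I \<le> (h 1)\<^sup>2 * K"
    if \<nu>: "\<nu> \<in> radon_measures_on ?E"
      and bd: "esssup lebesgue (\<lambda>x. ereal (norm (riesz_transform s \<nu> x))) \<le> 1"
      and pos: "0 < measure \<nu> UNIV" for \<nu>
  proof -
    define M where "M = (measure \<nu> UNIV)\<^sup>2"
    have M: "0 < M" using pos by (simp add: M_def)
    have "(\<Sum>j<n. v j) \<le> 4 * block_const * (36872 * A\<^sup>2) / M" for n
      using measure_bound[OF d p \<omega>[unfolded A_def] \<nu> bd, of n] M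
      by (simp add: A_def M_def pos_le_divide_eq mult.commute)
    from energy_integral_le[OF this]
    have "energy_integral s h 1 \<le> ennreal ((h 1)\<^sup>2 * K / M)" by (simp add: K_def mult_ac)
    then have le: "I \<le> ennreal ((h 1)\<^sup>2 * K / M)"
      using energy_integral_mono[OF T(2), of s h] unfolding I_def by (rule order_trans[rotated])
    have "I \<noteq> \<infinity>" using le by (auto simp: top_unique)
    moreover have "enn2real I \<le> (h 1)\<^sup>2 * K / M"
      using enn2real_mono[OF le] K0 M by simp
    ultimately show ?thesis using M by (simp add: M_def pos_le_divide_eq mult.commute)
  qed
  let ?rhs = "if I = \<infinity> then 0
        else ennreal (sqrt K * cover_const d) * hausdorff_content h ?E * ennreal (enn2real I powr (- 1 / 2))"
  have "gamma_plus s ?E \<le> ?rhs"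
    unfolding gamma_plus_def
  proof (rule Sup_least, clarify)
    fix \<nu> :: "(real ^ 'n) measure"
    assume \<nu>: "\<nu> \<in> radon_measures_on ?E"
      and bd: "esssup lebesgue (\<lambda>x. ereal (norm (riesz_transform s \<nu> x))) \<le> 1"
    note R = radon_measures_on_finite[OF \<nu> compact_cantor_set]
    interpret finite_measure \<nu> by (rule R)
    have em: "emeasure \<nu> (space \<nu>) = ennreal (measure \<nu> UNIV)" by (simp add: R(3) emeasure_eq_measure)
    show "emeasure \<nu> (space \<nu>) \<le> ?rhs"
    proof (cases "measure \<nu> UNIV = 0")
      case False
      then have pos: "0 < measure \<nu> UNIV" by (simp add: zero_less_measure_iff)
      have fin: "I \<noteq> \<infinity>" and le: "(measure \<nu> UNIV)\<^sup>2 * enn2real I \<le> (h 1)\<^sup>2 * K"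
        using bound[OF \<nu> bd pos] by auto
      define i where "i = enn2real I"
      have i0: "0 < i" unfolding i_def using I0 fin by (simp add: enn2real_positive_iff less_top)
      have "sqrt ((measure \<nu> UNIV)\<^sup>2 * i) \<le> sqrt ((h 1)\<^sup>2 * K)" using le by (simp add: i_def)
      then have "measure \<nu> UNIV * sqrt i \<le> h 1 * sqrt K" using h1 by (simp add: real_sqrt_mult)
      then have "measure \<nu> UNIV \<le> h 1 * sqrt K / sqrt i" using i0 by (simp add: pos_le_divide_eq)
      \<comment> \<open>The lower bound on the content trades h(1) for the content.\<close>
      also have "\<dots> \<le> (cover_const d * H) * sqrt K / sqrt i"
        using Hl cc i0 K0 by (intro divide_right_mono mult_right_mono) (auto simp: field_simps)
      also have "\<dots> = sqrt K * cover_const d * H * i powr (- 1 / 2)"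
        using i0 by (simp add: powr_minus_divide powr_half_sqrt)
      finally have "ennreal (measure \<nu> UNIV) \<le> ennreal (sqrt K * cover_const d * H * i powr (- 1 / 2))"
        by (rule ennreal_leI)
      also have "\<dots> = ennreal (sqrt K * cover_const d) * ennreal H * ennreal (i powr (- 1 / 2))"
        using K0 cc H0 by (simp add: ennreal_mult)
      finally show ?thesis using fin by (simp add: em H i_def)
    qed (simp add: em)
  qed
  then show ?thesis
    using compact_cantor_set H H0 T unfolding I_def
    by (intro exI[of _ ?E] exI[of _ T]) auto
qed

end

theorem proposition7p3:
  fixes s :: real
  assumes "0 < s" and "s < real CARD('n::finite)"
  shows "\<exists>C::real. 0 < C \<and>
    (\<forall>h. measure_function h \<and> antimono_on {0<..} (\<lambda>r. h r / r ^ CARD('n)) \<longrightarrow>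
      (\<exists>(E :: (real ^ 'n) set) t\<^sub>2.
         compact E \<and> hausdorff_content h E > 0 \<and>
         0 \<le> t\<^sub>2 \<and> ennreal (h t\<^sub>2) = hausdorff_content h E \<and>
         gamma_plus s E \<le>
           (if energy_integral s h t\<^sub>2 = \<infinity> then 0
            else ennreal C * hausdorff_content h E *
                 ennreal (enn2real (energy_integral s h t\<^sub>2) powr (- 1 / 2)))))"
proof -
  define d where "d = CARD('n)"
  \<comment> \<open>Room above s for both exponents: \<open>\<beta>\<close> and \<open>p\<close> are
    placed at one and two thirds of the gap, which yields p < d and p <= s + 1.\<close>
  define g where "g = min (real d - s) 1"
  define \<beta> p where "\<beta> = s + g / 3" and "p = s + 2 * g / 3"
  have g: "0 < g" "g \<le> real d - s" "g \<le> 1" using assms by (auto simp: g_def d_def)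
  have ord: "s < \<beta>" "\<beta> < p" "p < real d" "p \<le> s + 1" using g by (auto simp: \<beta>_def p_def)
  have d0: "0 < d" by (simp add: d_def)
  define A where "A = transfer_const s"
  have A0: "0 < A" unfolding A_def using assms(1) by (rule transfer_const_pos)
  have CK: "1 \<le> lip_const s" using assms(1) by (rule lip_const_ge_1)
  define L where "L = 4 * (18436 * A\<^sup>2) + 36864 * lip_const s"
  have L: "36864 * lip_const s \<le> L" by (simp add: L_def)
  \<comment> \<open>L * \<open>\<omega>\<close> = 1/2 is the absorption condition of
    \<open>total_energy_bound\<close>; the other two follow as L is at least 36864 *
    \<open>lip_const s\<close>.\<close>
  define \<omega> where "\<omega> = 1 / (2 * L)"
  have \<omega>: "0 < \<omega>" "\<omega> \<le> 1" "lip_const s * \<omega> \<le> 1/4" "L * \<omega> \<le> 1/2"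
    using L CK by (auto simp: \<omega>_def field_simps)
  have \<beta>0: "0 < \<beta>" using assms ord by simp
  let ?A = "\<lambda>J. 0 < J \<and>
      32 * real d * 2 powr (- (real J * (real d / \<beta> - 1))) \<le> 1 \<and>
      16 * 2 powr (- (real J * (2 * s))) \<le> 1 \<and>
      (8 * real d) powr p * grid_const d p * 2 powr (- (real J * (real d * (p / \<beta> - 1)))) \<le> \<omega>"
  have "eventually ?A sequentially"
    using assms ord \<omega> \<beta>0 d0
    by (intro eventually_conj eventually_gt_at_top eventually_decay_le mult_pos_pos) auto
  then obtain J where J: "?A J" by (auto dest!: eventually_happens)
  \<comment> \<open>The value of \<open>block_const\<close> written outside the locale: it is fixed
    before h is introduced, so the constant is uniform in h.\<close>
  define bc where "bc = real J * 4 ^ (d * J) + 1 / (1 - 2 powr (- (2 * real d * (1 - s / \<beta>))))"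
  define K where "K = 4 ^ d / (2 * s) * (4 * bc * (36872 * A\<^sup>2))"
  have sel: "selection h d s \<beta> p \<omega> J"
    if "measure_function h" "antimono_on {0<..} (\<lambda>r. h r / r ^ d)" for h
    using that assms ord J d0 by unfold_locales (auto simp: mult_ac)
  have sol: "\<exists>(E :: (real ^ 'n) set) T. compact E \<and> hausdorff_content h E > 0 \<and> 0 \<le> T \<and>
      ennreal (h T) = hausdorff_content h E \<and>
      gamma_plus s E \<le> (if energy_integral s h T = \<infinity> then 0
        else ennreal (sqrt K * cover_const d) * hausdorff_content h E *
             ennreal (enn2real (energy_integral s h T) powr (- 1 / 2)))"
    if h: "measure_function h" "antimono_on {0<..} (\<lambda>r. h r / r ^ d)" for h
  proof -
    interpret selection h d s \<beta> p \<omega> J by (rule sel[OF h])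
    have bc: "block_const = bc" by (simp add: block_const_def \<rho>_def bc_def)
    show ?thesis
      unfolding K_def A_def
      by (rule capacity_bound[OF d_def ord(4) \<omega>(1,2,3) \<omega>(4)[unfolded L_def A_def], unfolded bc])
  qed
  have "0 < bc"
  proof -
    have "0 < 2 * real d * (1 - s / \<beta>)" using d0 ord \<beta>0 by (intro mult_pos_pos) auto
    then have "2 powr (- (2 * real d * (1 - s / \<beta>))) < 1" using powr_less_mono[of _ 0 "2::real"] by simp
    then show ?thesis unfolding bc_def by (intro add_nonneg_pos) auto
  qed
  then have "0 < sqrt K * cover_const d"
    unfolding K_def cover_const_def using A0 assms(1) d0 by (intro mult_pos_pos) auto
  then show ?thesis
    using sol unfolding d_def by (intro exI[of _ "sqrt K * cover_const CARD('n)"]) auto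
qed

end
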